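(* Consider the disordered harmonic chain of size $N$ with i.i.d. random masses (as described in the context), initially prepared in the local Gibbs state with parameters $\beta,\mathsf r,\mathsf p$, where $\beta\in\mathcal C^0([0,1])$ with $\beta>0$ on $[0,1]$, $\mathsf r\in\mathcal C^1([0,1])$ with $\mathsf r(0)=\mathsf r(1)=0$, and $\mathsf p\in\mathcal C^1([0,1])$. Let $f\in\mathcal C^1([0,1])$ and, for $s\ge0$, let $$\mathcal F_N(s)=\frac1N\sum_{x=1}^N f(x/N)\left(\frac{\langle\!\langle \widetilde p_x(Ns)^2\rangle\!\rangle}{2m_x}+\frac{\langle\!\langle\widetilde r_x(Ns)^2\rangle\!\rangle}{2}\right),\qquad \widetilde p_x=p_x-\langle\!\langle p_x\rangle\!\rangle,\quad \widetilde r_x=r_x-\langle\!\langle r_x\rangle\!\rangle .$$ Then for every $\alpha\ge1$ and every $t\ge0$, almost surely with respect to the masses, $$\mathcal F_N(N^{\alpha-1}t)-\mathcal F_N(0)\to0\qquad\text{as }N\to\infty .$$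
   Context: **Masses.** $(m_x)_{x\ge1}$ are i.i.d. random variables on a probability space with probability $\mathsf P$; the law of $m_x$ has a smooth density compactly supported in $[m_-,m_+]$ with $m_->0$. The mean mass is $\overline m=\mathsf E(m_x)$. The chain of size $N$ uses $m_1,\dots,m_N$. **Dynamics.** The chain of size $N$ has phase space variables $r=(r_1,\dots,r_{N-1})\in\mathbb R^{N-1}$ and $p=(p_1,\dots,p_N)\in\mathbb R^N$, with the convention $r_0=r_N=0$. The (deterministic, linear) equations of motion are $$\dot r_x=\frac{p_{x+1}}{m_{x+1}}-\frac{p_x}{m_x}\ (1\le x\le N-1),\qquad \dot p_x=r_x-r_{x-1}\ (1\le x\le N).$$ **Initial state.** Given the masses, the initial condition $(r(0),p(0))$ is distributed according to the local Gibbs state with density on $\mathbb R^{N-1}\times\mathbb R^N$ $$\rho_{\rm loc}(r,p)=\frac1{Z_{\rm loc}}\exp\Big\{-\frac12\sum_{x=1}^N\beta(x/N)\,m_x\Big(\frac{p_x}{m_x}-\frac{\mathsf p(x/N)}{\overline m}\Big)^2-\frac12\sum_{x=1}^{N-1}\beta(x/N)\big(r_x-\mathsf r(x/N)\big)^2\Big\},$$ with $Z_{\rm loc}$ the normalizing constant. For fixed masses, $\langle\!\langle\cdot\rangle\!\rangle$ denotes expectation with respect to this initial distribution; $r_x(s),p_x(s)$ are evaluated along the solution at time $s$ started from the random initial condition. *)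

theory Defs
  imports "HOL-Probability.Probability"
begin

text \<open>The library's \<^const>\<open>C1_differentiable_on\<close> asks for two-sided derivatives also at the
  end points; for functions in \<open>C\<^sup>1([0,1])\<close> the derivative at \<open>0\<close> and \<open>1\<close> is one-sided.\<close>

definition C1_unit_interval :: "(real \<Rightarrow> real) \<Rightarrow> bool" where
  "C1_unit_interval h \<longleftrightarrow>
     (\<exists>h'. continuous_on {0..1} h' \<and>
           (\<forall>u\<in>{0..1}. (h has_real_derivative h' u) (at u within {0..1})))"

definition smooth :: "(real \<Rightarrow> real) \<Rightarrow> bool" where
  "smooth g \<longleftrightarrow> (\<forall>k. (deriv ^^ k) g differentiable_on UNIV)"

text \<open>The masses are the values at the indices \<open>x \<ge> 1\<close> only; \<open>m 0\<close> is irrelevant.\<close>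

definition iid_masses :: "'w measure \<Rightarrow> (nat \<Rightarrow> 'w \<Rightarrow> real) \<Rightarrow> bool" where
  "iid_masses M m \<longleftrightarrow>
     prob_space.indep_vars M (\<lambda>_. borel) m {1..} \<and>
     (\<exists>g a b. smooth g \<and> (\<forall>u. 0 \<le> g u) \<and> 0 < a \<and> (\<forall>u. u \<notin> {a..b} \<longrightarrow> g u = 0) \<and>
        (\<forall>x\<ge>1. distributed M lborel (m x) (\<lambda>u. ennreal (g u))))"


text \<open>Equations of motion on the time interval \<open>[0, \<infinity>)\<close>, for a fixed realization \<open>m\<close> of the
  masses. The boundary convention \<open>r\<^sub>0 = r\<^sub>N = 0\<close> is part of the notion of trajectory.\<close>

definition chain_trajectory ::
  "nat \<Rightarrow> (nat \<Rightarrow> real) \<Rightarrow> (real \<Rightarrow> nat \<Rightarrow> real) \<Rightarrow> (real \<Rightarrow> nat \<Rightarrow> real) \<Rightarrow> bool" where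
  "chain_trajectory N m r p \<longleftrightarrow>
     (\<forall>s\<ge>0. r s 0 = 0 \<and> r s N = 0 \<and>
        (\<forall>x\<in>{1..<N}. ((\<lambda>s. r s x) has_real_derivative
            p s (x + 1) / m (x + 1) - p s x / m x) (at s within {0..})) \<and>
        (\<forall>x\<in>{1..N}. ((\<lambda>s. p s x) has_real_derivative
            r s x - r s (x - 1)) (at s within {0..})))"

text \<open>A phase space point \<open>z = (r, p)\<close> consists of the coordinates \<open>r x\<close> with \<open>1 \<le> x \<le> N - 1\<close>
  and \<open>p x\<close> with \<open>1 \<le> x \<le> N\<close>.  The system is linear, so the trajectory starting from \<open>z\<close> exists,
  and it is unique in the coordinates \<open>r x\<close>, \<open>0 \<le> x \<le> N\<close>, and \<open>p x\<close>, \<open>1 \<le> x \<le> N\<close>; the choice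
  operator only affects the remaining, meaningless indices and negative times.\<close>

definition chain_flow ::
  "nat \<Rightarrow> (nat \<Rightarrow> real) \<Rightarrow> (nat \<Rightarrow> real) \<times> (nat \<Rightarrow> real) \<Rightarrow>
     (real \<Rightarrow> nat \<Rightarrow> real) \<times> (real \<Rightarrow> nat \<Rightarrow> real)" where
  "chain_flow N m z = (SOME (r, p). chain_trajectory N m r p \<and>
     (\<forall>x\<in>{1..<N}. r 0 x = fst z x) \<and> (\<forall>x\<in>{1..N}. p 0 x = snd z x))"

definition flow_r :: "nat \<Rightarrow> (nat \<Rightarrow> real) \<Rightarrow> real \<Rightarrow> nat \<Rightarrow> (nat \<Rightarrow> real) \<times> (nat \<Rightarrow> real) \<Rightarrow> real" where
  "flow_r N m s x z = fst (chain_flow N m z) s x"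

definition flow_p :: "nat \<Rightarrow> (nat \<Rightarrow> real) \<Rightarrow> real \<Rightarrow> nat \<Rightarrow> (nat \<Rightarrow> real) \<times> (nat \<Rightarrow> real) \<Rightarrow> real" where
  "flow_p N m s x z = snd (chain_flow N m z) s x"


text \<open>Lebesgue measure on \<open>\<real>\<^bsup>N-1\<^esup> \<times> \<real>\<^bsup>N\<^esup>\<close>.\<close>

definition phase_space :: "nat \<Rightarrow> ((nat \<Rightarrow> real) \<times> (nat \<Rightarrow> real)) measure" where
  "phase_space N = PiM {1..<N} (\<lambda>_. lborel) \<Otimes>\<^sub>M PiM {1..N} (\<lambda>_. lborel)"

text \<open>In what follows \<open>mbar\<close> is the mean mass, and \<open>\<beta>\<close>, \<open>rr\<close>, \<open>pp\<close> are the macroscopic profiles of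
  inverse temperature, stretch and momentum.\<close>

definition gibbs_weight ::
  "(real \<Rightarrow> real) \<Rightarrow> (real \<Rightarrow> real) \<Rightarrow> (real \<Rightarrow> real) \<Rightarrow> real \<Rightarrow> nat \<Rightarrow> (nat \<Rightarrow> real) \<Rightarrow>
     (nat \<Rightarrow> real) \<times> (nat \<Rightarrow> real) \<Rightarrow> real" where
  "gibbs_weight \<beta> rr pp mbar N m = (\<lambda>(r, p).
     exp (- (1/2) * (\<Sum>x=1..N. \<beta> (x / N) * m x * (p x / m x - pp (x / N) / mbar)\<^sup>2)
          - (1/2) * (\<Sum>x=1..<N. \<beta> (x / N) * (r x - rr (x / N))\<^sup>2)))"

definition gibbs_Z ::
  "(real \<Rightarrow> real) \<Rightarrow> (real \<Rightarrow> real) \<Rightarrow> (real \<Rightarrow> real) \<Rightarrow> real \<Rightarrow> nat \<Rightarrow> (nat \<Rightarrow> real) \<Rightarrow> real" where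
  "gibbs_Z \<beta> rr pp mbar N m =
     integral\<^sup>L (phase_space N) (gibbs_weight \<beta> rr pp mbar N m)"

definition local_gibbs ::
  "(real \<Rightarrow> real) \<Rightarrow> (real \<Rightarrow> real) \<Rightarrow> (real \<Rightarrow> real) \<Rightarrow> real \<Rightarrow> nat \<Rightarrow> (nat \<Rightarrow> real) \<Rightarrow>
     ((nat \<Rightarrow> real) \<times> (nat \<Rightarrow> real)) measure" where
  "local_gibbs \<beta> rr pp mbar N m =
     density (phase_space N)
       (\<lambda>z. ennreal (gibbs_weight \<beta> rr pp mbar N m z / gibbs_Z \<beta> rr pp mbar N m))"

definition centered_square_mean :: "'z measure \<Rightarrow> ('z \<Rightarrow> real) \<Rightarrow> real" where
  "centered_square_mean G X = integral\<^sup>L G (\<lambda>z. (X z - integral\<^sup>L G X)\<^sup>2)"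

text \<open>\<open>\<F>\<^sub>N(s)\<close> for a fixed realization \<open>m\<close> of the masses. In the term \<open>x = N\<close> the coordinate
  \<open>r\<^sub>N\<close> vanishes identically along trajectories.\<close>

definition thermal_energy ::
  "(real \<Rightarrow> real) \<Rightarrow> (real \<Rightarrow> real) \<Rightarrow> (real \<Rightarrow> real) \<Rightarrow> (real \<Rightarrow> real) \<Rightarrow> real \<Rightarrow> nat \<Rightarrow>
     (nat \<Rightarrow> real) \<Rightarrow> real \<Rightarrow> real" where
  "thermal_energy f \<beta> rr pp mbar N m s =
     (let G = local_gibbs \<beta> rr pp mbar N m in
      (1 / N) * (\<Sum>x=1..N. f (x / N) *
        (centered_square_mean G (flow_p N m (N * s) x) / (2 * m x) +
         centered_square_mean G (flow_r N m (N * s) x) / 2)))"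

end

theory Submission
  imports Defs "HOL-Complex_Analysis.Complex_Analysis" "HOL-Real_Asymp.Real_Asymp"
begin

text \<open>In the coordinates \<open>v (2 x - 1) = p x / m x\<close>, \<open>v (2 x) = r x\<close> the dynamics is \<open>v' = D\<^sup>-\<^sup>1 J v\<close> with \<open>D\<close>
  a positive diagonal matrix and \<open>J\<close> real, tridiagonal and antisymmetric; it conserves the energy
  \<open>\<Sum>i. D i * (v i)\<^sup>2\<close>. The initial state is a product of Gaussians, so the thermal energy at time \<open>s\<close> is
  obtained from the profile \<open>1 / \<beta>\<close> by redistributing the energy of each excitation \<open>basis j\<close> along the
  flow. As \<open>f\<close> is uniformly continuous, only the energy transported over macroscopic distances matters.

  Split \<open>basis j\<close> by the filter \<open>(1 - \<epsilon> R(\<epsilon>))\<^sup>k\<close>, where \<open>R\<close> is the resolvent. The removed low-frequency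
  part has squared norm \<open>O(\<epsilon>)\<close> on average over \<open>j\<close>. The flow of the filtered part is a contour integral of
  the exponential times the resolvent over a rectangle of half-width \<open>N\<close> to the power \<open>- A\<close>, \<open>A \<ge> \<alpha>\<close>, on which
  the exponential stays bounded up to time \<open>t\<close> times \<open>N\<close> to the power \<open>\<alpha>\<close>. Near \<open>\<zeta> = 0\<close> the
  filter has a zero of order \<open>k\<close>, which beats the trivial bound of the resolvent. For \<open>\<bar>\<zeta>\<bar> \<ge> \<nu>\<close> the
  Green function decays over blocks of at least \<open>N\<close> to the power \<open>3 / 4\<close> sites: its size is controlled
  by the measure of the points in the unit polydisc of \<open>\<complex>\<^sup>2\<close> that the random transfer matrices keep there,
  and this measure has exponentially small expectation. Indeed, averaging over one mass is averaging
  over shears of \<open>\<complex>\<^sup>2\<close>, and no function is almost invariant under shears in two different directions,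
  so the averaged transfer operator contracts the \<open>L\<^sup>2\<close> norm. Markov's inequality and the
  Borel--Cantelli lemma on a polynomially fine grid of points \<open>\<zeta>\<close> conclude.\<close>

section \<open>Continuants and Green functions\<close>

text \<open>The obstacle is the bottom of the spectrum. A two-step average contracts only by 1 - c
  |\<zeta>|^4, so the decay length obtained is of order |\<zeta>|^(-4) and blows up at \<zeta> = 0,
  while times of order N^\<alpha> force the contour to within N^(-A) of the spectrum, where the
  resolvent is only known to be at most of order N^A. The filter mediates: with \<open>nu\<close> =
  \<open>eps\<close>^2 its factor below \<open>nu\<close> is of order \<open>eps\<close> to the
  power k, which for a fixed large k beats N^A. Above \<open>nu\<close> = N^(-1/8) the decay length
  is about N^(1/2), so blocks of N^(3/4) sites leave a gain exp(- c N^(1/4)). Re \<zeta> > 0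
  excludes cancellation: all ratios of neighbouring continuants lie in the right half plane, so the
  Green function, a block determinant and the entries of a transfer matrix are comparable up to
  powers of 1 / Re \<zeta>. These losses are polynomial in N and are absorbed by the exponential
  gain. Growth of the random product is measured by an overlap because its expectation is a matrix
  coefficient of a power of one linear operator on L^2; thus neither Lyapunov exponents nor
  invariant measures on the projective line have to be analysed.\<close>

fun continuant :: "(nat \<Rightarrow> complex) \<Rightarrow> nat \<Rightarrow> nat \<Rightarrow> complex" where
  "continuant a i 0 = 0"
| "continuant a i (Suc 0) = 1"
| "continuant a i (Suc (Suc n)) = a (i + n) * continuant a i (Suc n) + continuant a i n"

lemma continuant_split:
  "continuant a i (Suc (p + q)) =
     continuant a i (Suc p) * continuant a (i + p) (Suc q) +
     continuant a i p * continuant a (Suc (i + p)) q"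
proof (induction q rule: less_induct)
  case (less q)
  consider "q = 0" | "q = Suc 0" | r where "q = Suc (Suc r)"
    by (metis nat.exhaust)
  then show ?case
  proof cases
    case 3
    have 1: "continuant a i (Suc (p + Suc r)) = continuant a i (Suc p) * continuant a (i + p) (Suc (Suc r)) +
     continuant a i p * continuant a (Suc (i + p)) (Suc r)"
      by (rule less) (simp add: 3)
    have 2: "continuant a i (Suc (p + r)) = continuant a i (Suc p) * continuant a (i + p) (Suc r) +
     continuant a i p * continuant a (Suc (i + p)) r"
      by (rule less) (simp add: 3)
    have "continuant a i (Suc (p + q)) =
        a (i + p + Suc r) * continuant a i (Suc (p + Suc r)) + continuant a i (Suc (p + r))"
      by (simp add: 3 add_ac)
    then show ?thesis
      unfolding 1 2 by (simp add: 3 algebra_simps)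
  qed (simp_all add: algebra_simps)
qed

lemma continuant_left:
  "continuant a i (Suc (Suc n)) = a i * continuant a (Suc i) (Suc n) + continuant a (Suc (Suc i)) n"
  using continuant_split[of a i 1 n] by simp

text \<open>Reflecting \<zeta> changes continuants only by a sign, which reduces the left half plane
  to the right one.\<close>

lemma continuant_uminus: "continuant (\<lambda>k. - a k) i n = (- 1) ^ Suc n * continuant a i n"
  by (induction a i n rule: continuant.induct) (auto simp: algebra_simps)

lemma norm_continuant_uminus: "norm (continuant (\<lambda>k. - a k) i n) = norm (continuant a i n)"
  by (simp add: continuant_uminus norm_mult norm_power)

lemma divide_mult_self: "(x :: complex) \<noteq> 0 \<Longrightarrow> x / (z * x) = inverse z"
  by (cases "z = 0") (simp_all add: field_simps)

lemma Re_inverse_nonneg: "0 \<le> Re z \<Longrightarrow> 0 \<le> Re (inverse z)"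
  by (simp add: divide_nonneg_nonneg)

section \<open>Continuants with diagonal entries in a right half plane\<close>

context
  fixes a :: "nat \<Rightarrow> complex" and c :: real
  assumes c: "0 < c" and Re_ge: "\<And>k. c \<le> Re (a k)"
begin

text \<open>The ratio of consecutive continuants is a continued fraction, updated by x -> 1 / (a +
  x). For Re a \<ge> c > 0 this map preserves the closed right half plane and never meets a zero
  denominator.\<close>

lemma continuant_right_aux:
  "continuant a i (Suc n) \<noteq> 0 \<and> 0 \<le> Re (continuant a i n / continuant a i (Suc n))"
proof (induction n)
  case (Suc n)
  let ?x = "continuant a i n / continuant a i (Suc n)"
  have eq: "continuant a i (Suc (Suc n)) = (a (i + n) + ?x) * continuant a i (Suc n)"
    using Suc by (simp add: field_simps)
  have re: "c \<le> Re (a (i + n) + ?x)"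
    using Suc Re_ge[of "i + n"] by simp
  then have nz: "a (i + n) + ?x \<noteq> 0" using c by (metis not_le zero_complex.simps(1))
  have "continuant a i (Suc n) / continuant a i (Suc (Suc n)) = inverse (a (i + n) + ?x)"
    unfolding eq using Suc by (intro divide_mult_self) blast
  moreover have "0 \<le> Re (inverse (a (i + n) + ?x))"
    using re c by (intro Re_inverse_nonneg) linarith
  ultimately show ?case
    using eq nz Suc by (metis mult_eq_0_iff)
qed simp

lemma continuant_nonzero: "continuant a i (Suc n) \<noteq> 0"
  using continuant_right_aux by blast

lemma continuant_left_aux: "0 \<le> Re (continuant a (Suc i) n / continuant a i (Suc n))"
proof (induction n arbitrary: i)
  case (Suc n)
  let ?x = "continuant a (Suc (Suc i)) n / continuant a (Suc i) (Suc n)"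
  have eq: "continuant a i (Suc (Suc n)) = (a i + ?x) * continuant a (Suc i) (Suc n)"
    unfolding continuant_left using continuant_nonzero[of "Suc i" n] by (simp add: field_simps)
  have re: "c \<le> Re (a i + ?x)"
    using Suc[of "Suc i"] Re_ge[of i] by simp
  then have nz: "a i + ?x \<noteq> 0" using c by (metis not_le zero_complex.simps(1))
  have "continuant a (Suc i) (Suc n) / continuant a i (Suc (Suc n)) = inverse (a i + ?x)"
    unfolding eq by (rule divide_mult_self) (rule continuant_nonzero)
  moreover have "0 \<le> Re (inverse (a i + ?x))"
    using re c by (intro Re_inverse_nonneg) linarith
  ultimately show ?case by metis
qed simp

lemma norm_continuant_right: "c * norm (continuant a i n) \<le> norm (continuant a i (Suc n))"
proof (cases n)
  case (Suc k)
  let ?x = "continuant a i k / continuant a i (Suc k)"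
  have eq: "continuant a i (Suc n) = (a (i + k) + ?x) * continuant a i n"
    using continuant_nonzero[of i k] Suc by (simp add: field_simps)
  have "c \<le> Re (a (i + k) + ?x)"
    using continuant_right_aux[of i k] Re_ge[of "i + k"] by simp
  then have "c \<le> norm (a (i + k) + ?x)" by (meson complex_Re_le_cmod order_trans)
  then show ?thesis
    unfolding eq norm_mult by (intro mult_right_mono) auto
qed simp

lemma norm_continuant_left: "c * norm (continuant a (Suc i) n) \<le> norm (continuant a i (Suc n))"
proof (cases n)
  case (Suc k)
  let ?x = "continuant a (Suc (Suc i)) k / continuant a (Suc i) (Suc k)"
  have eq: "continuant a i (Suc n) = (a i + ?x) * continuant a (Suc i) n"
    using continuant_nonzero[of "Suc i" k] Suc continuant_left[of a i k]
    by (simp add: field_simps)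
  have "c \<le> Re (a i + ?x)"
    using continuant_left_aux[of "Suc i" k] Re_ge[of i] by simp
  then have "c \<le> norm (a i + ?x)" by (meson complex_Re_le_cmod order_trans)
  then show ?thesis
    unfolding eq norm_mult by (intro mult_right_mono) auto
qed simp

text \<open>Site \<open>b + p\<close> is cut out. Divided by the product of the two remaining
  blocks, the whole determinant is a + x + y with the continued fractions x and y coming from the
  left and from the right; real parts add up, so nothing cancels.\<close>

lemma norm_continuant_cut:
  "c * norm (continuant a b (Suc p) * continuant a (Suc (b + p)) (Suc q))
     \<le> norm (continuant a b (Suc (Suc (p + q))))"
proof -
  let ?x = "continuant a b p / continuant a b (Suc p)"
  let ?y = "continuant a (Suc (Suc (b + p))) q / continuant a (Suc (b + p)) (Suc q)"
  let ?P = "continuant a b (Suc p) * continuant a (Suc (b + p)) (Suc q)"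
  have eq: "continuant a b (Suc (Suc (p + q))) = (a (b + p) + ?x + ?y) * ?P"
    using continuant_split[of a b p "Suc q"] continuant_left[of a "b + p" q]
      continuant_nonzero[of b p] continuant_nonzero[of "Suc (b + p)" q]
    by (simp add: field_simps del: continuant.simps)
  have "c \<le> Re (a (b + p) + ?x + ?y)"
    using continuant_right_aux[of b p] continuant_left_aux[of "Suc (b + p)" q] Re_ge[of "b + p"]
    by simp
  then have "c \<le> norm (a (b + p) + ?x + ?y)" by (meson complex_Re_le_cmod order_trans)
  then show ?thesis
    unfolding eq norm_mult by (intro mult_right_mono) auto
qed

text \<open>Each end loses at most one site, and each lost site costs one factor c. This passes from
  the block between two arbitrary sites to one made of whole mass-spring pairs.\<close>

lemma norm_continuant_subblock:
  assumes "c \<le> 1" "e \<le> 1" "e' \<le> 1"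
  shows "c\<^sup>2 * norm (continuant a (b + e) (Suc l)) \<le> norm (continuant a b (Suc l + e + e'))"
proof -
  have 1: "c * norm (continuant a (b + e) (Suc l)) \<le> norm (continuant a b (Suc l + e))"
  proof (cases "e = 0")
    case True
    then show ?thesis using assms(1) c by (simp add: mult_left_le_one_le)
  next
    case False
    then have e: "e = 1" using assms by simp
    show ?thesis using norm_continuant_left[of b "Suc l"] unfolding e by simp
  qed
  have 2: "c * norm (continuant a b (Suc l + e)) \<le> norm (continuant a b (Suc l + e + e'))"
  proof (cases "e' = 0")
    case True
    then show ?thesis using assms(1) c by (simp add: mult_left_le_one_le)
  next
    case False
    then have e: "e' = 1" using assms by simp
    show ?thesis using norm_continuant_right[of b "Suc l + e"] unfolding e by simp
  qed
  show ?thesis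
    using mult_left_mono[OF 1 less_imp_le[OF c]] 2
    by (simp add: power2_eq_square mult.assoc del: continuant.simps)
qed

end

section \<open>Continuants with diagonal entries of modulus at least three\<close>

context
  fixes a :: "nat \<Rightarrow> complex"
  assumes large: "\<And>k. 3 \<le> norm (a k)"
begin

text \<open>Diagonal dominance takes over where Re \<zeta> may vanish, on the horizontal edges of
  the contour: each further site multiplies the modulus by at least 3 - 1 = 2.\<close>

lemma continuant_large_right:
  "continuant a i (Suc n) \<noteq> 0 \<and> 2 * norm (continuant a i n) \<le> norm (continuant a i (Suc n))"
proof (induction n)
  case (Suc n)
  have "norm (a (i + n) * continuant a i (Suc n)) \<ge> 3 * norm (continuant a i (Suc n))"
    unfolding norm_mult using large by (intro mult_right_mono) auto
  moreover have "norm (continuant a i (Suc (Suc n))) \<ge>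
      norm (a (i + n) * continuant a i (Suc n)) - norm (continuant a i n)"
    by (simp add: norm_diff_ineq)
  moreover have "norm (continuant a i n) \<le> norm (continuant a i (Suc n))"
    using Suc norm_ge_zero[of "continuant a i n"] by linarith
  moreover have "norm (continuant a i (Suc n)) > 0" using Suc by simp
  ultimately have "norm (continuant a i (Suc (Suc n))) > 0 \<and>
     2 * norm (continuant a i (Suc n)) \<le> norm (continuant a i (Suc (Suc n)))"
    by linarith
  then show ?case by auto
qed simp

lemma continuant_large_nonzero: "continuant a i (Suc n) \<noteq> 0"
  using continuant_large_right by blast

lemma continuant_large_left:
  "2 * norm (continuant a (Suc i) n) \<le> norm (continuant a i (Suc n))"
proof (induction n arbitrary: i)
  case (Suc n)
  have "norm (a i * continuant a (Suc i) (Suc n)) \<ge> 3 * norm (continuant a (Suc i) (Suc n))"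
    unfolding norm_mult using large by (intro mult_right_mono) auto
  moreover have "norm (continuant a i (Suc (Suc n))) \<ge>
      norm (a i * continuant a (Suc i) (Suc n)) - norm (continuant a (Suc (Suc i)) n)"
    unfolding continuant_left by (simp add: norm_diff_ineq)
  moreover have "norm (continuant a (Suc (Suc i)) n) \<le> norm (continuant a (Suc i) (Suc n))"
    using Suc[of "Suc i"] norm_ge_zero[of "continuant a (Suc (Suc i)) n"] by linarith
  ultimately show ?case by linarith
qed simp

lemma continuant_large_growth: "2 ^ n \<le> norm (continuant a i (Suc n))"
proof (induction n)
  case (Suc n)
  then show ?case using continuant_large_right[of i "Suc n"] by simp
qed simp

lemma norm_continuant_cut_large:
  "norm (continuant a b (Suc p) * continuant a (Suc (b + p)) (Suc q))
     \<le> norm (continuant a b (Suc (Suc (p + q))))"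
proof -
  let ?x = "continuant a b p" and ?x' = "continuant a b (Suc p)"
  let ?y = "continuant a (Suc (Suc (b + p))) q" and ?y' = "continuant a (Suc (b + p)) (Suc q)"
  have eq: "continuant a b (Suc (Suc (p + q))) = a (b + p) * (?x' * ?y') + (?x * ?y' + ?x' * ?y)"
    using continuant_split[of a b p "Suc q"] continuant_left[of a "b + p" q]
    by (simp add: algebra_simps del: continuant.simps)
  have "norm (a (b + p) * (?x' * ?y')) \<ge> 3 * norm (?x' * ?y')"
    unfolding norm_mult[of "a _"] using large by (intro mult_right_mono) auto
  moreover have "norm ?x \<le> norm ?x'" "norm ?y \<le> norm ?y'"
    using continuant_large_right[of b p] norm_ge_zero[of ?x]
      continuant_large_left[of "Suc (b + p)" q] norm_ge_zero[of ?y] by linarith+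
  then have "norm (?x * ?y') \<le> norm (?x' * ?y')" "norm (?x' * ?y) \<le> norm (?x' * ?y')"
    unfolding norm_mult by (simp_all add: mult_right_mono mult_left_mono del: continuant.simps)
  moreover have "norm (?x * ?y' + ?x' * ?y) \<le> norm (?x * ?y') + norm (?x' * ?y)"
    by (rule norm_triangle_ineq)
  moreover have "norm (continuant a b (Suc (Suc (p + q)))) \<ge>
       norm (a (b + p) * (?x' * ?y')) - norm (?x * ?y' + ?x' * ?y)"
    unfolding eq by (rule norm_diff_ineq)
  ultimately show ?thesis using norm_ge_zero[of "?x' * ?y'"] by linarith
qed

end

text \<open>Green's function of the tridiagonal matrix with diagonal \<open>a\<close>, superdiagonal \<open>- 1\<close> and
  subdiagonal \<open>1\<close>.\<close>

definition green :: "(nat \<Rightarrow> complex) \<Rightarrow> nat \<Rightarrow> nat \<Rightarrow> nat \<Rightarrow> complex" where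
  "green a n i j =
     (if i \<le> j then continuant a 1 i * continuant a (Suc j) (Suc n - j)
      else (- 1) ^ (i - j) * continuant a 1 j * continuant a (Suc i) (Suc n - i))
     / continuant a 1 (Suc n)"

lemma green_0 [simp]: "green a n 0 j = 0"
  by (simp add: green_def)

lemma green_end: "j \<le> n \<Longrightarrow> green a n (Suc n) j = 0"
  by (simp add: green_def)

lemma norm_green_commute: "norm (green a n i j) = norm (green a n j i)"
  by (auto simp: green_def norm_mult norm_divide norm_power)

lemma norm_green_uminus: "norm (green (\<lambda>k. - a k) n i j) = norm (green a n i j)"
  by (simp add: green_def norm_mult norm_divide norm_power norm_continuant_uminus)

lemma continuant_green_eq:
  assumes "1 \<le> j" "j \<le> n"
  shows "continuant a 1 (Suc n) =
     continuant a 1 j * continuant a j (Suc (Suc n) - j) +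
     continuant a 1 (j - 1) * continuant a (Suc j) (Suc n - j)"
proof -
  obtain p where p: "j = Suc p" using assms by (cases j) auto
  have q: "n = p + Suc (n - Suc p)" using assms by (simp add: p)
  define q where "q = n - Suc p"
  with q have q: "n = p + Suc q" by simp
  show ?thesis using continuant_split[of a 1 p "Suc q"] by (simp add: p q)
qed

text \<open>Off the diagonal the equation is the three-term recursion of one of the two continuants
  in the numerator. On the diagonal the terms no longer cancel: they add up to the expansion of the
  full determinant at site j, which the denominator normalizes to 1.\<close>

lemma green_equation:
  assumes i: "1 \<le> i" "i \<le> n" and j: "1 \<le> j" "j \<le> n" and nz: "continuant a 1 (Suc n) \<noteq> 0"
  shows "a i * green a n i j - green a n (Suc i) j + green a n (i - 1) j = (if i = j then 1 else 0)"
proof -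
  obtain k where k: "i = Suc k" using i by (cases i) auto
  obtain q where q: "n = i + q" using i le_Suc_ex by blast
  define G where "G i j = (if i \<le> j then continuant a 1 i * continuant a (Suc j) (Suc n - j)
      else (- 1) ^ (i - j) * continuant a 1 j * continuant a (Suc i) (Suc n - i))" for i j
  have up: "continuant a 1 (Suc i) = a i * continuant a 1 i + continuant a 1 (i - 1)"
    by (simp add: k)
  have down: "continuant a i (Suc (Suc n) - i) =
      a i * continuant a (Suc i) (Suc n - i) + continuant a (Suc (Suc i)) (n - i)"
    using continuant_left[of a i q] by (simp add: q)
  have "a i * G i j - G (Suc i) j + G (i - 1) j = (if i = j then continuant a 1 (Suc n) else 0)"
  proof -
    consider "i < j" | "i = j" | "i = Suc j" | l where "i = Suc (Suc (j + l))"
    proof -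
      assume *: "i < j \<Longrightarrow> thesis" "i = j \<Longrightarrow> thesis" "i = Suc j \<Longrightarrow> thesis"
        "\<And>l. i = Suc (Suc (j + l)) \<Longrightarrow> thesis"
      show thesis
      proof (cases "Suc j < i")
        case True
        then have "i = Suc (Suc (j + (i - j - 2)))" by simp
        then show thesis by (rule *(4))
      qed (use * in linarith)
    qed
    then show ?thesis
    proof cases
      case 1
      then have "G (Suc i) j = continuant a 1 (Suc i) * continuant a (Suc j) (Suc n - j)"
        "G i j = continuant a 1 i * continuant a (Suc j) (Suc n - j)"
        "G (i - 1) j = continuant a 1 (i - 1) * continuant a (Suc j) (Suc n - j)"
        by (simp_all add: G_def)
      with 1 show ?thesis unfolding up by (simp add: algebra_simps)
    next
      case 2
      then have "G (Suc i) j = - (continuant a 1 i * continuant a (Suc (Suc i)) (n - i))"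
        "G i j = continuant a 1 i * continuant a (Suc i) (Suc n - i)"
        "G (i - 1) j = continuant a 1 (i - 1) * continuant a (Suc i) (Suc n - i)"
        by (simp_all add: G_def)
      with 2 show ?thesis
        using continuant_green_eq[OF i, of a] down by (simp add: algebra_simps)
    next
      case 3
      then have "G (Suc i) j = continuant a 1 j * continuant a (Suc (Suc i)) (n - i)"
        "G i j = - (continuant a 1 j * continuant a (Suc i) (Suc n - i))"
        "G (i - 1) j = continuant a 1 j * continuant a i (Suc (Suc n) - i)"
        by (simp_all add: G_def)
      with 3 show ?thesis unfolding down by (simp add: algebra_simps)
    next
      case 4
      then have "G (Suc i) j = - ((- 1) ^ l * continuant a 1 j * continuant a (Suc (Suc i)) (n - i))"
        "G i j = (- 1) ^ l * continuant a 1 j * continuant a (Suc i) (Suc n - i)"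
        "G (i - 1) j = - ((- 1) ^ l * continuant a 1 j * continuant a i (Suc (Suc n) - i))"
        by (simp_all add: G_def Suc_diff_le)
      then show ?thesis
        using 4 unfolding down by (simp only:) (simp add: algebra_simps)
    qed
  qed
  moreover have geq: "green a n i j = G i j / continuant a 1 (Suc n)" for i j
    by (simp add: green_def G_def)
  have "a i * green a n i j - green a n (Suc i) j + green a n (i - 1) j
      = (a i * G i j - G (Suc i) j + G (i - 1) j) / continuant a 1 (Suc n)"
    unfolding geq by (simp add: add_divide_distrib diff_divide_distrib)
  ultimately show ?thesis
    using nz by auto
qed

text \<open>The numerator of the Green function is the block before i times the block after j.
  Cutting the full determinant at i and then at j bounds it below by this numerator times the block
  strictly between i and j; the two cuts cost \<kappa>^2.\<close>

lemma continuant_cut_bound_imp_green: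
  fixes \<kappa> :: real
  assumes \<kappa>: "0 < \<kappa>"
    and cut: "\<And>b p q. \<kappa> * norm (continuant a b (Suc p) * continuant a (Suc (b + p)) (Suc q))
       \<le> norm (continuant a b (Suc (Suc (p + q))))"
    and nz: "\<And>b p. continuant a b (Suc p) \<noteq> 0"
    and i: "1 \<le> i" "i < j" and j: "j \<le> n"
  shows "norm (green a n i j) \<le> 1 / (\<kappa>\<^sup>2 * norm (continuant a (Suc i) (j - i)))"
proof -
  obtain p where p: "i = Suc p" using i by (cases i) auto
  obtain q where q: "j = i + Suc q" using i less_iff_Suc_add by auto
  obtain r where r: "n = j + r" using j le_Suc_ex by blast
  let ?A = "continuant a 1 i" and ?B = "continuant a (Suc i) (j - i)"
    and ?C = "continuant a (Suc j) (Suc n - j)" and ?D = "continuant a (Suc i) (Suc n - i)"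
    and ?P = "continuant a 1 (Suc n)"
  have nz': "?A \<noteq> 0" "?B \<noteq> 0" "?C \<noteq> 0" "?D \<noteq> 0" "?P \<noteq> 0"
    using nz[of 1 p] nz[of "Suc i" q] nz[of "Suc j" r] nz[of "Suc i" "Suc (q + r)"] nz[of 1 n]
    by (simp_all add: p q r del: continuant.simps)
  have 1: "\<kappa> * (norm ?A * norm ?D) \<le> norm ?P"
    using cut[of 1 p "Suc (q + r)"] by (simp add: p q r norm_mult algebra_simps del: continuant.simps)
  have 2: "\<kappa> * (norm ?B * norm ?C) \<le> norm ?D"
    using cut[of "Suc i" q r] by (simp add: p q r norm_mult algebra_simps del: continuant.simps)
  have "\<kappa>\<^sup>2 * norm ?B * (norm ?A * norm ?C) = \<kappa> * norm ?A * (\<kappa> * (norm ?B * norm ?C))"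
    by (simp add: power2_eq_square)
  also have "\<dots> \<le> \<kappa> * norm ?A * norm ?D"
    using 2 \<kappa> by (intro mult_left_mono) auto
  also have "\<dots> \<le> norm ?P" using 1 by (simp add: mult.assoc)
  finally have "\<kappa>\<^sup>2 * norm ?B * (norm ?A * norm ?C) \<le> norm ?P" .
  then show ?thesis
    using i nz' \<kappa>
    by (simp add: green_def norm_mult norm_divide field_simps del: continuant.simps)
qed

section \<open>The generator of a weighted chain and its resolvent\<close>

fun continuant_poly :: "(nat \<Rightarrow> real) \<Rightarrow> nat \<Rightarrow> nat \<Rightarrow> complex poly" where
  "continuant_poly d i 0 = 0"
| "continuant_poly d i (Suc 0) = 1"
| "continuant_poly d i (Suc (Suc n)) =
     [:0, of_real (d (i + n)):] * continuant_poly d i (Suc n) + continuant_poly d i n"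

lemma poly_continuant_poly: "poly (continuant_poly d i n) \<zeta> = continuant (\<lambda>k. \<zeta> * d k) i n"
  by (induction d i n rule: continuant_poly.induct) (simp_all add: algebra_simps)

lemma holomorphic_continuant [holomorphic_intros]:
  "(\<lambda>\<zeta>. continuant (\<lambda>k. \<zeta> * of_real (d k)) i n) holomorphic_on S"
  unfolding poly_continuant_poly[symmetric] by (intro holomorphic_intros)

locale weighted_chain =
  fixes d :: "nat \<Rightarrow> real" and n :: nat and dl du :: real
  assumes dl: "0 < dl" "dl \<le> 1" and du: "1 \<le> du"
    and d_bounds: "\<And>i. dl \<le> d i \<and> d i \<le> du"
begin

lemma d_pos: "0 < d i"
  using d_bounds[of i] dl by linarith

text \<open>Vectors are functions on all naturals vanishing off the chain; thus the fixed ends are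
  built in, and \<open>gen\<close> reads zeros at sites 0 and n + 1.\<close>

definition supported :: "(nat \<Rightarrow> complex) \<Rightarrow> bool" where
  "supported w \<longleftrightarrow> (\<forall>i. i \<notin> {1..n} \<longrightarrow> w i = 0)"

definition gen :: "(nat \<Rightarrow> complex) \<Rightarrow> nat \<Rightarrow> complex" where
  "gen w i = (if i \<in> {1..n} then (w (Suc i) - w (i - 1)) / d i else 0)"

definition nrm2 :: "(nat \<Rightarrow> complex) \<Rightarrow> real" where
  "nrm2 w = (\<Sum>i=1..n. d i * (cmod (w i))\<^sup>2)"

definition det :: "complex \<Rightarrow> complex" where
  "det \<zeta> = continuant (\<lambda>k. \<zeta> * d k) 1 (Suc n)"

definition res :: "complex \<Rightarrow> (nat \<Rightarrow> complex) \<Rightarrow> nat \<Rightarrow> complex" where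
  "res \<zeta> w i = (if i \<in> {1..n} then \<Sum>j=1..n. green (\<lambda>k. \<zeta> * d k) n i j * d j * w j else 0)"

lemma supported_gen [simp]: "supported (gen w)"
  by (simp add: supported_def gen_def)

lemma supported_res [simp]: "supported (res \<zeta> w)"
  by (simp add: supported_def res_def)

lemma gen_eq: "i \<in> {1..n} \<Longrightarrow> d i * gen w i = w (Suc i) - w (i - 1)"
  using d_pos[of i] by (simp add: gen_def)

lemma Re_inner:
  fixes v w :: "nat \<Rightarrow> complex"
  shows "Re (\<Sum>i=1..n. d i * v i * cnj (w i)) = (\<Sum>i=1..n. d i * Re (v i * cnj (w i)))"
  by (simp add: mult.assoc)

lemma gen_diff: "gen (\<lambda>i. v i - w i) = (\<lambda>i. gen v i - gen w i)"
  by (rule ext) (simp add: gen_def diff_divide_distrib)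

lemma gen_mult: "gen (\<lambda>i. c * w i) = (\<lambda>i. c * gen w i)"
  by (rule ext) (simp add: gen_def right_diff_distrib)

lemma res_diff: "res \<zeta> (\<lambda>i. v i - w i) = (\<lambda>i. res \<zeta> v i - res \<zeta> w i)"
  by (rule ext) (simp add: res_def right_diff_distrib sum_subtractf)

lemma res_mult: "res \<zeta> (\<lambda>i. c * w i) = (\<lambda>i. c * res \<zeta> w i)"
  by (rule ext) (simp add: res_def sum_distrib_left mult_ac)

lemma nrm2_nonneg: "0 \<le> nrm2 w"
  unfolding nrm2_def using d_pos by (intro sum_nonneg mult_nonneg_nonneg) (auto simp: less_imp_le)

lemma nrm2_entry: "d i * (cmod (w i))\<^sup>2 \<le> nrm2 w" if "i \<in> {1..n}"
  unfolding nrm2_def using that d_pos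
  by (intro member_le_sum[of i "{1..n}" "\<lambda>i. d i * (cmod (w i))\<^sup>2"]) (auto simp: less_imp_le)

lemma nrm2_0D: "nrm2 w = 0 \<Longrightarrow> supported w \<Longrightarrow> w i = 0"
  using nrm2_entry[of i w] d_pos[of i]
  by (cases "i \<in> {1..n}") (auto simp: supported_def mult_le_0_iff power2_eq_square)

text \<open>Antisymmetry of J turns the sum into a telescoping one: the current \<open>T\<close>
  vanishes at both ends.\<close>

lemma gen_energy:
  assumes "supported w"
  shows "Re (\<Sum>i=1..n. d i * gen w i * cnj (w i)) = 0"
proof -
  define T where "T i = Re (w (Suc i) * cnj (w i))" for i
  have "Re (\<Sum>i=1..n. d i * gen w i * cnj (w i)) = (\<Sum>i=1..n. T i - T (i - 1))"
    unfolding Re_sum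
  proof (rule sum.cong)
    fix i assume i: "i \<in> {1..n}"
    then have "d i * gen w i * cnj (w i) = w (Suc i) * cnj (w i) - w (i - 1) * cnj (w i)"
      by (simp only: gen_eq left_diff_distrib)
    moreover have "Suc (i - 1) = i" using i by simp
    ultimately show "Re (d i * gen w i * cnj (w i)) = T i - T (i - 1)"
      by (simp add: T_def mult.commute)
  qed simp
  also have "\<dots> = T n - T 0"
    by (induction n) simp_all
  also have "\<dots> = 0"
    using assms by (simp add: T_def supported_def)
  finally show ?thesis .
qed

section \<open>The resolvent equation, uniqueness and the energy bound\<close>

lemma res_equation:
  assumes det: "det \<zeta> \<noteq> 0" and i: "i \<in> {1..n}"
  shows "\<zeta> * res \<zeta> w i - gen (res \<zeta> w) i = w i"
proof -
  let ?g = "green (\<lambda>k. \<zeta> * d k) n"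
  \<comment> \<open>The Green function vanishes at the sites 0 and n + 1, so the defining sum also
    holds there and \<open>gen\<close> may be applied to it.\<close>
  have R: "res \<zeta> w k = (\<Sum>j=1..n. ?g k j * d j * w j)" if "k \<le> Suc n" for k
  proof (cases "k \<in> {1..n}")
    case False
    then have "k = 0 \<or> k = Suc n" using that by auto
    then show ?thesis
      using False by (auto simp: res_def green_end intro!: sum.neutral[symmetric])
  qed (simp add: res_def)
  have "d i * (\<zeta> * res \<zeta> w i - gen (res \<zeta> w) i) =
      (\<zeta> * d i) * res \<zeta> w i - res \<zeta> w (Suc i) + res \<zeta> w (i - 1)"
    using gen_eq[OF i, of "res \<zeta> w"] by (simp add: algebra_simps)
  also have "\<dots> = (\<Sum>j=1..n. (\<zeta> * d i * ?g i j - ?g (Suc i) j + ?g (i - 1) j) * (d j * w j))"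
    using i by (subst (1 2 3) R)
      (auto simp: sum_distrib_left sum_subtractf[symmetric] sum.distrib[symmetric] algebra_simps
        intro!: sum.cong)
  also have "\<dots> = (\<Sum>j=1..n. (if i = j then 1 else 0) * (d j * w j))"
    using i det by (intro sum.cong refl, subst green_equation) (auto simp: det_def)
  also have "\<dots> = (\<Sum>j=1..n. if i = j then d j * w j else 0)"
    by (intro sum.cong) auto
  also have "\<dots> = d i * w i" using i by simp
  finally show ?thesis using d_pos[of i] by simp
qed

text \<open>The difference of two solutions obeys the recursion of the continuants, hence is its
  first entry times a continuant. At site n + 1 this continuant is \<open>det \<zeta>\<close>, and
  vanishing there forces the first entry to be 0.\<close>

lemma res_unique:
  assumes det: "det \<zeta> \<noteq> 0" and y: "supported y"
    and eq: "\<And>i. i \<in> {1..n} \<Longrightarrow> \<zeta> * y i - gen y i = w i"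
  shows "y i = res \<zeta> w i"
proof -
  define x where "x i = y i - res \<zeta> w i" for i
  have x: "supported x" using y supported_res[of \<zeta> w] by (simp add: x_def supported_def)
  have step: "x (Suc i) = \<zeta> * d i * x i + x (i - 1)" if i: "i \<in> {1..n}" for i
  proof -
    have "\<zeta> * x i = gen x i"
      using eq[OF i] res_equation[OF det i, of w]
      unfolding x_def gen_diff by (simp add: algebra_simps)
    then show ?thesis
      using i d_pos[of i] by (simp add: gen_def field_simps)
  qed
  have "x k = x 1 * continuant (\<lambda>k. \<zeta> * d k) 1 k" if "k \<le> Suc n" for k
    using that
  proof (induction k rule: less_induct)
    case (less k)
    consider "k = 0" | "k = Suc 0" | l where "k = Suc (Suc l)"
      by (metis nat.exhaust)
    then show ?case
    proof cases
      case 1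
      then show ?thesis using x by (simp add: supported_def)
    next
      case 3
      then have "x k = \<zeta> * d (Suc l) * x (Suc l) + x l"
        using step[of "Suc l"] less(2) by simp
      also have "x (Suc l) = x 1 * continuant (\<lambda>k. \<zeta> * d k) 1 (Suc l)"
        by (rule less(1)) (use 3 less(2) in auto)
      also have "x l = x 1 * continuant (\<lambda>k. \<zeta> * d k) 1 l"
        by (rule less(1)) (use 3 less(2) in auto)
      finally show ?thesis by (simp add: 3 algebra_simps)
    qed simp
  qed note * = this
  have "x 1 = 0"
    using *[of "Suc n"] x det unfolding det_def by (simp add: supported_def)
  then have "x i = 0"
    using *[of i] x by (cases "i \<le> Suc n") (auto simp: supported_def)
  then show ?thesis by (simp add: x_def)
qed

lemma res_gen:
  assumes "det \<zeta> \<noteq> 0" "supported w"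
  shows "gen (res \<zeta> w) i = res \<zeta> (gen w) i"
proof (rule res_unique[OF assms(1)])
  fix i assume i: "i \<in> {1..n}"
  let ?y = "res \<zeta> w"
  have "gen ?y = (\<lambda>i. \<zeta> * ?y i - w i)"
  proof
    fix i show "gen ?y i = \<zeta> * ?y i - w i"
    proof (cases "i \<in> {1..n}")
      case True
      show ?thesis using res_equation[OF assms(1) True, of w] by (simp add: algebra_simps)
    next
      case False
      moreover from False have "gen ?y i = 0" "?y i = 0"
        by (simp_all only: gen_def res_def if_False)
      ultimately show ?thesis using assms(2) by (simp add: supported_def)
    qed
  qed
  then have "gen (gen ?y) i = \<zeta> * gen ?y i - gen w i"
    by (metis (no_types) gen_diff gen_mult)
  then show "\<zeta> * gen ?y i - gen (gen ?y) i = gen w i" by simp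
qed simp

lemma res_res_identity:
  assumes "det \<zeta> \<noteq> 0" "det \<epsilon> \<noteq> 0" "\<zeta> \<noteq> \<epsilon>" "supported w"
  shows "res \<zeta> (res \<epsilon> w) i = (res \<epsilon> w i - res \<zeta> w i) / (\<zeta> - \<epsilon>)"
proof -
  let ?y = "res \<epsilon> w"
  have "?y i = res \<zeta> (\<lambda>i. w i - (\<epsilon> - \<zeta>) * ?y i) i"
    using res_equation[OF assms(2)]
    by (intro res_unique[OF assms(1)]) (auto simp: algebra_simps)
  then have "?y i = res \<zeta> w i - (\<epsilon> - \<zeta>) * res \<zeta> ?y i"
    unfolding res_diff res_mult .
  then show ?thesis using assms(3) by (simp add: field_simps)
qed

text \<open>The resolvent equation is paired with its own solution; by conservation of energy the
  generator drops out of the real part.\<close>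

lemma inner_res:
  fixes w :: "nat \<Rightarrow> complex"
  assumes det: "det \<zeta> \<noteq> 0"
  shows "Re \<zeta> * nrm2 (res \<zeta> w) = Re (\<Sum>i=1..n. d i * w i * cnj (res \<zeta> w i))"
proof -
  let ?y = "res \<zeta> w"
  have "Re (\<Sum>i=1..n. d i * w i * cnj (?y i)) =
      Re (\<Sum>i=1..n. \<zeta> * (d i * (?y i * cnj (?y i))) - d i * gen ?y i * cnj (?y i))"
  proof (intro arg_cong[where f = Re] sum.cong refl)
    fix i assume i: "i \<in> {1..n}"
    have "w i = \<zeta> * ?y i - gen ?y i"
      using res_equation[OF det i] by simp
    then show "d i * w i * cnj (?y i) = \<zeta> * (d i * (?y i * cnj (?y i))) - d i * gen ?y i * cnj (?y i)"
      by (simp only:) (simp add: algebra_simps)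
  qed
  also have "\<dots> = Re (\<Sum>i=1..n. \<zeta> * (d i * (?y i * cnj (?y i))))"
    using gen_energy[of ?y] by (simp only: sum_subtractf minus_complex.simps) simp
  also have "\<dots> = Re \<zeta> * nrm2 ?y"
    unfolding nrm2_def Re_sum sum_distrib_left
    by (intro sum.cong) (auto simp: complex_norm_square[symmetric] simp flip: of_real_power of_real_mult)
  finally show ?thesis by simp
qed

text \<open>The usual bound 1 / Re \<zeta> for a skew-adjoint generator, by Young's inequality in
  \<open>inner_res\<close>.\<close>

lemma nrm2_res_le:
  assumes det: "det \<zeta> \<noteq> 0" and pos: "0 < Re \<zeta>"
  shows "nrm2 (res \<zeta> w) \<le> nrm2 w / (Re \<zeta>)\<^sup>2"
proof -
  let ?y = "res \<zeta> w" and ?s = "Re \<zeta>"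
  have "2 * ?s * (?s * nrm2 ?y) = (\<Sum>i=1..n. d i * (2 * ?s * Re (w i * cnj (?y i))))"
    unfolding inner_res[OF det] Re_inner by (simp add: sum_distrib_left mult_ac del: Re_sum)
  also have "\<dots> \<le> (\<Sum>i=1..n. d i * (cmod (w i))\<^sup>2 + ?s\<^sup>2 * (d i * (cmod (?y i))\<^sup>2))"
  proof (rule sum_mono)
    fix i
    have "Re (w i * cnj (?y i)) \<le> cmod (w i) * cmod (?y i)"
      using complex_Re_le_cmod[of "w i * cnj (?y i)"] by (simp add: norm_mult)
    then have "2 * ?s * Re (w i * cnj (?y i)) \<le> 2 * ?s * (cmod (w i) * cmod (?y i))"
      using pos by (intro mult_left_mono) auto
    also have "\<dots> \<le> (cmod (w i))\<^sup>2 + ?s\<^sup>2 * (cmod (?y i))\<^sup>2"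
      using sum_squares_bound[of "cmod (w i)" "?s * cmod (?y i)"]
      by (simp add: power_mult_distrib algebra_simps)
    finally have "d i * (2 * ?s * Re (w i * cnj (?y i))) \<le> d i * ((cmod (w i))\<^sup>2 + ?s\<^sup>2 * (cmod (?y i))\<^sup>2)"
      using d_pos[of i] by (intro mult_left_mono) auto
    then show "d i * (2 * ?s * Re (w i * cnj (?y i))) \<le> d i * (cmod (w i))\<^sup>2 + ?s\<^sup>2 * (d i * (cmod (?y i))\<^sup>2)"
      by (simp add: algebra_simps)
  qed
  also have "\<dots> = nrm2 w + ?s\<^sup>2 * nrm2 ?y"
    by (simp add: nrm2_def sum.distrib sum_distrib_left)
  finally have "?s\<^sup>2 * nrm2 ?y \<le> nrm2 w"
    by (simp add: power2_eq_square)
  then show ?thesis using pos by (simp add: field_simps)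
qed

text \<open>Right half plane by positivity, left half plane by reflection, large \<zeta> by diagonal
  dominance. So all zeros lie on a bounded segment of the imaginary axis.\<close>

lemma det_nonzero:
  assumes "Re \<zeta> \<noteq> 0 \<or> 3 \<le> dl * cmod \<zeta>"
  shows "det \<zeta> \<noteq> 0"
proof -
  consider "0 < Re \<zeta>" | "Re \<zeta> < 0" | "3 \<le> dl * cmod \<zeta>" using assms by linarith
  then show ?thesis
  proof cases
    case 1
    have "dl * Re \<zeta> \<le> Re (\<zeta> * d k)" for k
      using d_bounds[of k] 1 by simp
    then show ?thesis
      unfolding det_def by (intro continuant_nonzero[of "dl * Re \<zeta>"]) (use 1 dl in auto)
  next
    case 2
    have "dl * - Re \<zeta> \<le> Re (- (\<zeta> * d k))" for k
      using d_bounds[of k] 2 by simp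
    then have "continuant (\<lambda>k. - (\<zeta> * d k)) 1 (Suc n) \<noteq> 0"
      by (intro continuant_nonzero[of "dl * - Re \<zeta>"]) (use 2 dl in \<open>auto simp: mult_less_0_iff\<close>)
    then show ?thesis
      unfolding det_def continuant_uminus[of "\<lambda>k. \<zeta> * d k"] by simp
  next
    case 3
    have "3 \<le> cmod (\<zeta> * d k)" for k
    proof -
      have "dl * cmod \<zeta> \<le> d k * cmod \<zeta>"
        using d_bounds[of k] by (intro mult_right_mono) auto
      then show ?thesis using 3 d_pos[of k] by (simp add: norm_mult mult.commute)
    qed
    then show ?thesis
      unfolding det_def by (intro continuant_large_nonzero)
  qed
qed

section \<open>Spectral filter\<close>

text \<open>In the spectral variable \<lambda> of \<open>gen\<close>, which is purely imaginary,
  this is multiplication by \<lambda> / (\<lambda> - \<epsilon>): of modulus at most 1, and with a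
  simple zero at \<lambda> = 0.\<close>

definition high :: "real \<Rightarrow> (nat \<Rightarrow> complex) \<Rightarrow> nat \<Rightarrow> complex" where
  "high \<epsilon> w i = w i - \<epsilon> * res \<epsilon> w i"

lemma supported_high: "supported w \<Longrightarrow> supported (high \<epsilon> w)"
  by (simp add: supported_def high_def res_def)

lemma supported_high_pow: "supported w \<Longrightarrow> supported ((high \<epsilon> ^^ k) w)"
  by (induction k) (simp_all add: supported_high)

lemma high_diff: "high \<epsilon> (\<lambda>i. v i - w i) = (\<lambda>i. high \<epsilon> v i - high \<epsilon> w i)"
  by (rule ext) (simp add: high_def res_diff algebra_simps)

lemma high_pow_diff: "(high \<epsilon> ^^ k) (\<lambda>i. v i - w i) = (\<lambda>i. (high \<epsilon> ^^ k) v i - (high \<epsilon> ^^ k) w i)"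
  by (induction k) (simp_all add: high_diff)

text \<open>In the expanded square, \<open>inner_res\<close> turns the cross term into -2 times the
  last term; so the square of the removed part is exactly what the norm loses.\<close>

lemma nrm2_high:
  assumes \<epsilon>: "0 < \<epsilon>"
  shows "nrm2 (high \<epsilon> w) \<le> nrm2 w"
proof -
  let ?y = "res \<epsilon> w"
  have det: "det \<epsilon> \<noteq> 0" using \<epsilon> by (intro det_nonzero) simp
  have "nrm2 (high \<epsilon> w) = (\<Sum>i=1..n. d i * (cmod (w i))\<^sup>2 - 2 * \<epsilon> * Re (d i * w i * cnj (?y i)) +
      \<epsilon>\<^sup>2 * (d i * (cmod (?y i))\<^sup>2))"
    unfolding nrm2_def high_def cmod_power2
    by (intro sum.cong refl) (simp add: algebra_simps power2_eq_square)
  also have "\<dots> = nrm2 w - 2 * \<epsilon> * Re (\<Sum>i=1..n. d i * w i * cnj (?y i)) + \<epsilon>\<^sup>2 * nrm2 ?y"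
    by (simp only: sum.distrib sum_subtractf sum_distrib_left nrm2_def Re_sum)
  also have "Re (\<Sum>i=1..n. d i * w i * cnj (?y i)) = \<epsilon> * nrm2 ?y"
    using inner_res[OF det, of w] by simp
  also have "nrm2 w - 2 * \<epsilon> * (\<epsilon> * nrm2 ?y) + \<epsilon>\<^sup>2 * nrm2 ?y = nrm2 w - \<epsilon>\<^sup>2 * nrm2 ?y"
    by (simp add: power2_eq_square)
  finally show ?thesis using nrm2_nonneg[of ?y] by simp
qed

lemma nrm2_high_pow: "0 < \<epsilon> \<Longrightarrow> nrm2 ((high \<epsilon> ^^ k) w) \<le> nrm2 w"
  by (induction k) (auto intro: order_trans[OF nrm2_high])

lemma nrm2_sum:
  fixes x :: "nat \<Rightarrow> nat \<Rightarrow> complex"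
  shows "nrm2 (\<lambda>i. \<Sum>l<k. x l i) \<le> k * (\<Sum>l<k. nrm2 (x l))"
proof -
  have "(cmod (\<Sum>l<k. x l i))\<^sup>2 \<le> k * (\<Sum>l<k. (cmod (x l i))\<^sup>2)" for i
  proof -
    have "(cmod (\<Sum>l<k. x l i))\<^sup>2 \<le> (\<Sum>l<k. cmod (x l i))\<^sup>2"
      by (intro power_mono norm_sum) auto
    also have "\<dots> \<le> k * (\<Sum>l<k. (cmod (x l i))\<^sup>2)"
      using sum_squared_le_sum_of_squares[of "\<lambda>l. cmod (x l i)" "{..<k}"] by (simp add: mult.commute)
    finally show ?thesis .
  qed
  then have "nrm2 (\<lambda>i. \<Sum>l<k. x l i) \<le> (\<Sum>i=1..n. d i * (k * (\<Sum>l<k. (cmod (x l i))\<^sup>2)))"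
    unfolding nrm2_def using d_pos by (intro sum_mono mult_left_mono) (auto simp: less_imp_le)
  also have "\<dots> = k * (\<Sum>i=1..n. \<Sum>l<k. d i * (cmod (x l i))\<^sup>2)"
    by (simp add: sum_distrib_left mult_ac)
  also have "\<dots> = k * (\<Sum>l<k. nrm2 (x l))"
    unfolding nrm2_def by (subst sum.swap) simp
  finally show ?thesis .
qed

text \<open>Telescoping over the powers of the filter: each of the k increments is a contraction
  applied to the first one, and Cauchy-Schwarz yields the factor k^2.\<close>

lemma nrm2_high_pow_error:
  fixes w :: "nat \<Rightarrow> complex"
  assumes \<epsilon>: "0 < \<epsilon>"
  shows "nrm2 (\<lambda>i. w i - (high \<epsilon> ^^ k) w i) \<le> (real k)\<^sup>2 * nrm2 (\<lambda>i. \<epsilon> * res \<epsilon> w i)"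
proof -
  have *: "\<epsilon> * res \<epsilon> w i = w i - high \<epsilon> w i" for i by (simp add: high_def)
  have "(\<lambda>i. w i - (high \<epsilon> ^^ k) w i) = (\<lambda>i. \<Sum>l<k. (high \<epsilon> ^^ l) (\<lambda>i. \<epsilon> * res \<epsilon> w i) i)"
  proof
    fix i show "w i - (high \<epsilon> ^^ k) w i = (\<Sum>l<k. (high \<epsilon> ^^ l) (\<lambda>i. \<epsilon> * res \<epsilon> w i) i)"
    proof (induction k)
      case (Suc k)
      have "(high \<epsilon> ^^ k) (\<lambda>i. \<epsilon> * res \<epsilon> w i) i = (high \<epsilon> ^^ k) w i - (high \<epsilon> ^^ Suc k) w i"
        unfolding * high_pow_diff by (simp add: funpow_swap1)
      moreover have "(\<Sum>l<k. (high \<epsilon> ^^ l) (\<lambda>i. \<epsilon> * res \<epsilon> w i) i) = w i - (high \<epsilon> ^^ k) w i"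
        by (rule Suc[symmetric])
      ultimately show ?case by (simp only: sum.lessThan_Suc) simp
    qed simp
  qed
  then have "nrm2 (\<lambda>i. w i - (high \<epsilon> ^^ k) w i)
      \<le> k * (\<Sum>l<k. nrm2 ((high \<epsilon> ^^ l) (\<lambda>i. \<epsilon> * res \<epsilon> w i)))"
    using nrm2_sum by metis
  also have "\<dots> \<le> k * (\<Sum>l<k. nrm2 (\<lambda>i. \<epsilon> * res \<epsilon> w i))"
    by (intro mult_left_mono sum_mono nrm2_high_pow[OF \<epsilon>]) auto
  finally show ?thesis by (simp add: power2_eq_square)
qed

definition basis :: "nat \<Rightarrow> nat \<Rightarrow> complex" where
  "basis j i = (if i = j then 1 else 0)"

lemma supported_basis: "j \<in> {1..n} \<Longrightarrow> supported (basis j)"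
  by (auto simp: supported_def basis_def)

lemma nrm2_basis: "j \<in> {1..n} \<Longrightarrow> nrm2 (basis j) = d j"
proof -
  assume j: "j \<in> {1..n}"
  have "nrm2 (basis j) = (\<Sum>i=1..n. if i = j then d j else 0)"
    unfolding nrm2_def by (intro sum.cong) (auto simp: basis_def)
  then show ?thesis using j by simp
qed

lemma res_basis: "j \<in> {1..n} \<Longrightarrow> i \<in> {1..n} \<Longrightarrow>
    res \<zeta> (basis j) i = green (\<lambda>k. \<zeta> * d k) n i j * d j"
proof -
  assume j: "j \<in> {1..n}" and i: "i \<in> {1..n}"
  have "(\<Sum>k=1..n. green (\<lambda>k. \<zeta> * d k) n i k * d k * basis j k) =
     (\<Sum>k=1..n. if k = j then green (\<lambda>k. \<zeta> * d k) n i j * d j else 0)"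
    by (intro sum.cong) (auto simp: basis_def)
  then have "res \<zeta> (basis j) i = (\<Sum>k=1..n. if k = j then green (\<lambda>k. \<zeta> * d k) n i j * d j else 0)"
    using i by (simp add: res_def)
  then show ?thesis using j by simp
qed

text \<open>By the energy identity the norm of the low-frequency part is \<epsilon> times a diagonal
  entry of the resolvent. Hence a bound on this entry that is uniform in \<epsilon> makes the norm
  O(\<epsilon>).\<close>

lemma nrm2_low_basis:
  fixes \<epsilon> :: real
  assumes \<epsilon>: "0 < \<epsilon>" and j: "j \<in> {1..n}"
  shows "nrm2 (\<lambda>i. \<epsilon> * res \<epsilon> (basis j) i) = \<epsilon> * d j * Re (res \<epsilon> (basis j) j)"
proof -
  let ?y = "res \<epsilon> (basis j)"
  have det: "det \<epsilon> \<noteq> 0" using \<epsilon> by (intro det_nonzero) simp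
  have "nrm2 (\<lambda>i. \<epsilon> * ?y i) = \<epsilon> * (\<epsilon> * nrm2 ?y)"
    using \<epsilon> by (simp add: nrm2_def norm_mult power_mult_distrib sum_distrib_left power2_eq_square mult_ac)
  also have "\<epsilon> * nrm2 ?y = Re (\<Sum>i=1..n. d i * basis j i * cnj (?y i))"
    using inner_res[OF det, of "basis j"] by simp
  also have "(\<Sum>i=1..n. d i * basis j i * cnj (?y i)) = (\<Sum>i=1..n. if i = j then d j * cnj (?y j) else 0)"
    by (intro sum.cong) (auto simp: basis_def)
  finally show ?thesis using j by simp
qed

lemma nrm2_low_basis_trivial:
  fixes \<epsilon> :: real
  assumes \<epsilon>: "0 < \<epsilon>" and j: "j \<in> {1..n}"
  shows "nrm2 (\<lambda>i. \<epsilon> * res \<epsilon> (basis j) i) \<le> du"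
proof -
  have det: "det \<epsilon> \<noteq> 0" using \<epsilon> by (intro det_nonzero) simp
  have "nrm2 (\<lambda>i. \<epsilon> * res \<epsilon> (basis j) i) = \<epsilon>\<^sup>2 * nrm2 (res \<epsilon> (basis j))"
    using \<epsilon> by (simp add: nrm2_def norm_mult power_mult_distrib sum_distrib_left mult_ac)
  also have "\<dots> \<le> \<epsilon>\<^sup>2 * (nrm2 (basis j) / \<epsilon>\<^sup>2)"
    using nrm2_res_le[OF det, of "basis j"] \<epsilon> by (intro mult_left_mono) auto
  finally show ?thesis using \<epsilon> d_bounds[of j] nrm2_basis[OF j] by simp
qed

text \<open>Along the indices \<open>j, j + 2, j + 4, \<dots>\<close> the resolvent applied to \<open>basis j\<close> varies slowly, while
  its norm is controlled by its value at \<open>j\<close>.\<close>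

lemma res_basis_diagonal_bound:
  fixes \<epsilon> :: real
  assumes \<epsilon>: "0 < \<epsilon>" and j: "j \<in> {1..n}" and L: "0 < L" "j + 2 * L \<le> n"
  shows "Re (res \<epsilon> (basis j) j) \<le> 2 * du * (1 / (dl * L * \<epsilon>) + L * \<epsilon> * du)"
proof -
  let ?y = "res \<epsilon> (basis j)"
  define y0 where "y0 = cmod (?y j)"
  define Q where "Q = nrm2 ?y"
  have det: "det \<epsilon> \<noteq> 0" using \<epsilon> by (intro det_nonzero) simp
  \<comment> \<open>The source sits at j only, so beyond j a difference over two sites is \<epsilon>
    times the weighted entry in between.\<close>
  have step: "?y (Suc (Suc i)) - ?y i = \<epsilon> * d (Suc i) * ?y (Suc i)" if "i \<ge> j" "Suc i \<le> n" for i
  proof -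
    have "\<epsilon> * ?y (Suc i) = gen ?y (Suc i)"
      using res_equation[OF det, of "Suc i" "basis j"] that by (auto simp: basis_def)
    then show ?thesis
      using d_pos[of "Suc i"] that by (simp add: gen_def field_simps)
  qed
  have diff: "?y (j + 2 * l) - ?y j = (\<Sum>p<l. \<epsilon> * d (j + 2 * p + 1) * ?y (j + 2 * p + 1))" if "l \<le> L" for l
    using that
  proof (induction l)
    case (Suc l)
    then show ?case using step[of "j + 2 * l"] L by (simp add: algebra_simps)
  qed simp
  have odd_sum: "(\<Sum>p<l. d (j + 2 * p + 1) * (cmod (?y (j + 2 * p + 1)))\<^sup>2) \<le> Q" if "l \<le> L" for l
  proof -
    have "(\<Sum>p<l. d (j + 2 * p + 1) * (cmod (?y (j + 2 * p + 1)))\<^sup>2) =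
       (\<Sum>i\<in>(\<lambda>p. j + 2 * p + 1) ` {..<l}. d i * (cmod (?y i))\<^sup>2)"
      by (subst sum.reindex) (auto simp: inj_on_def)
    also have "\<dots> \<le> Q"
      unfolding Q_def nrm2_def using that L d_pos by (intro sum_mono2) (auto simp: less_imp_le)
    finally show ?thesis .
  qed
  have even_sum: "(\<Sum>l<L. d (j + 2 * l) * (cmod (?y (j + 2 * l)))\<^sup>2) \<le> Q"
  proof -
    have "(\<Sum>l<L. d (j + 2 * l) * (cmod (?y (j + 2 * l)))\<^sup>2) =
       (\<Sum>i\<in>(\<lambda>p. j + 2 * p) ` {..<L}. d i * (cmod (?y i))\<^sup>2)"
      by (subst sum.reindex) (auto simp: inj_on_def)
    also have "\<dots> \<le> Q"
      unfolding Q_def nrm2_def using j L d_pos by (intro sum_mono2) (auto simp: less_imp_le)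
    finally show ?thesis .
  qed
  have pt: "y0\<^sup>2 \<le> 2 * (cmod (?y (j + 2 * l)))\<^sup>2 + 2 * L * \<epsilon>\<^sup>2 * du * Q" if l: "l < L" for l
  proof -
    let ?D = "?y (j + 2 * l) - ?y j"
    have "(cmod ?D)\<^sup>2 \<le> (\<Sum>p<l. \<epsilon> * d (j + 2 * p + 1) * cmod (?y (j + 2 * p + 1)))\<^sup>2"
    proof (intro power_mono)
      show "cmod ?D \<le> (\<Sum>p<l. \<epsilon> * d (j + 2 * p + 1) * cmod (?y (j + 2 * p + 1)))"
        unfolding diff[OF less_imp_le[OF l]]
        by (rule order_trans[OF norm_sum]) (use \<epsilon> d_pos in \<open>auto simp: norm_mult less_imp_le intro!: sum_mono\<close>)
    qed simp
    also have "\<dots> \<le> l * (\<Sum>p<l. (\<epsilon> * d (j + 2 * p + 1) * cmod (?y (j + 2 * p + 1)))\<^sup>2)"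
      using sum_squared_le_sum_of_squares[of "\<lambda>p. \<epsilon> * d (j + 2 * p + 1) * cmod (?y (j + 2 * p + 1))" "{..<l}"]
      by (simp add: mult.commute)
    also have "\<dots> \<le> l * (\<Sum>p<l. \<epsilon>\<^sup>2 * du * (d (j + 2 * p + 1) * (cmod (?y (j + 2 * p + 1)))\<^sup>2))"
    proof (intro mult_left_mono sum_mono)
      fix p
      let ?d = "d (j + 2 * p + 1)" and ?c = "(cmod (?y (j + 2 * p + 1)))\<^sup>2"
      have "?d * (\<epsilon>\<^sup>2 * ?d * ?c) \<le> du * (\<epsilon>\<^sup>2 * ?d * ?c)"
        using d_bounds d_pos by (intro mult_right_mono) (auto simp: less_imp_le)
      then show "(\<epsilon> * ?d * cmod (?y (j + 2 * p + 1)))\<^sup>2 \<le> \<epsilon>\<^sup>2 * du * (?d * ?c)"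
        by (simp add: power_mult_distrib power2_eq_square mult_ac)
    qed simp
    also have "\<dots> = l * (\<epsilon>\<^sup>2 * du * (\<Sum>p<l. d (j + 2 * p + 1) * (cmod (?y (j + 2 * p + 1)))\<^sup>2))"
      by (simp add: sum_distrib_left)
    also have "\<dots> \<le> L * (\<epsilon>\<^sup>2 * du * Q)"
    proof (intro mult_mono mult_left_mono odd_sum)
      show "0 \<le> \<epsilon>\<^sup>2 * du * (\<Sum>p<l. d (j + 2 * p + 1) * (cmod (?y (j + 2 * p + 1)))\<^sup>2)"
        using du less_imp_le[OF d_pos] by (intro mult_nonneg_nonneg sum_nonneg) auto
    qed (use l du less_imp_le[OF d_pos] in \<open>auto intro!: sum_nonneg mult_nonneg_nonneg\<close>)
    finally have D: "(cmod ?D)\<^sup>2 \<le> L * (\<epsilon>\<^sup>2 * du * Q)" .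
    have "y0 \<le> cmod (?y (j + 2 * l)) + cmod ?D"
      unfolding y0_def by (metis add.commute norm_triangle_sub norm_minus_commute)
    then have "y0\<^sup>2 \<le> (cmod (?y (j + 2 * l)) + cmod ?D)\<^sup>2"
      unfolding y0_def by (intro power_mono) auto
    also have "\<dots> \<le> 2 * (cmod (?y (j + 2 * l)))\<^sup>2 + 2 * (cmod ?D)\<^sup>2"
      using sum_squares_bound[of "cmod (?y (j + 2 * l))" "cmod ?D"] by (simp add: power2_sum)
    finally show ?thesis using D by (simp add: algebra_simps)
  qed
  have "dl * (L * y0\<^sup>2) = (\<Sum>l<L. dl * y0\<^sup>2)" by simp
  also have "\<dots> \<le> (\<Sum>l<L. 2 * (d (j + 2 * l) * (cmod (?y (j + 2 * l)))\<^sup>2) + dl * (2 * L * \<epsilon>\<^sup>2 * du * Q))"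
  proof (rule sum_mono)
    fix l assume "l \<in> {..<L}"
    then have "dl * y0\<^sup>2 \<le> dl * (2 * (cmod (?y (j + 2 * l)))\<^sup>2 + 2 * L * \<epsilon>\<^sup>2 * du * Q)"
      using pt dl by (intro mult_left_mono) auto
    moreover have "dl * (cmod (?y (j + 2 * l)))\<^sup>2 \<le> d (j + 2 * l) * (cmod (?y (j + 2 * l)))\<^sup>2"
      using d_bounds by (intro mult_right_mono) auto
    ultimately show "dl * y0\<^sup>2 \<le> 2 * (d (j + 2 * l) * (cmod (?y (j + 2 * l)))\<^sup>2) + dl * (2 * L * \<epsilon>\<^sup>2 * du * Q)"
      by (simp add: algebra_simps)
  qed
  also have "\<dots> = 2 * (\<Sum>l<L. d (j + 2 * l) * (cmod (?y (j + 2 * l)))\<^sup>2) + dl * L * (2 * L * \<epsilon>\<^sup>2 * du * Q)"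
    by (simp add: sum.distrib sum_distrib_left)
  also have "\<dots> \<le> 2 * Q + dl * L * (2 * L * \<epsilon>\<^sup>2 * du * Q)"
    using even_sum by simp
  finally have "dl * L * y0\<^sup>2 \<le> 2 * Q + dl * L * (2 * L * \<epsilon>\<^sup>2 * du * Q)"
    by (simp add: mult.assoc)
  moreover define P where "P = dl * L"
  moreover have P: "0 < P" using dl L by (simp add: P_def)
  ultimately have "y0\<^sup>2 \<le> (2 * Q + P * (2 * L * \<epsilon>\<^sup>2 * du * Q)) / P"
    by (simp add: pos_le_divide_eq mult.commute)
  also have "\<dots> = Q * (2 / P + 2 * L * \<epsilon>\<^sup>2 * du)"
    using P by (simp add: add_divide_distrib algebra_simps)
  \<comment> \<open>The energy identity bounds \<open>Q\<close> by the value at j itself. The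
    inequality then reads y0^2 \<le> y0 times a constant, and one factor y0 cancels.\<close>
  also have "\<dots> \<le> (du * y0 / \<epsilon>) * (2 / P + 2 * L * \<epsilon>\<^sup>2 * du)"
  proof (rule mult_right_mono)
    have "\<epsilon> * Q = d j * Re (?y j)"
    proof -
      have "nrm2 (\<lambda>i. \<epsilon> * ?y i) = \<epsilon> * (\<epsilon> * Q)"
        using \<epsilon> by (simp add: Q_def nrm2_def norm_mult power_mult_distrib sum_distrib_left power2_eq_square mult_ac)
      then show ?thesis using nrm2_low_basis[OF \<epsilon> j] \<epsilon> by simp
    qed
    also have "\<dots> \<le> d j * y0"
      unfolding y0_def using d_pos[of j] by (intro mult_left_mono complex_Re_le_cmod) auto
    also have "\<dots> \<le> du * y0"
      using d_bounds[of j] by (intro mult_right_mono) (auto simp: y0_def)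
    finally show "Q \<le> du * y0 / \<epsilon>" using \<epsilon> by (simp add: field_simps)
    show "0 \<le> 2 / P + 2 * L * \<epsilon>\<^sup>2 * du" using P du by auto
  qed
  also have "\<dots> = y0 * (2 * du * (1 / (P * \<epsilon>) + L * \<epsilon> * du))"
    using \<epsilon> P by (simp add: divide_simps power2_eq_square)
  finally have *: "y0 * y0 \<le> y0 * (2 * du * (1 / (dl * L * \<epsilon>) + L * \<epsilon> * du))"
    by (simp only: power2_eq_square P_def)
  have "y0 \<le> 2 * du * (1 / (dl * L * \<epsilon>) + L * \<epsilon> * du) \<or> y0 = 0"
  proof (cases "y0 = 0")
    case False
    then have "0 < y0" by (simp add: y0_def)
    with * show ?thesis using mult_left_le_imp_le by blast
  qed simp
  moreover have "0 \<le> 2 * du * (1 / (dl * L * \<epsilon>) + L * \<epsilon> * du)"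
    using dl du \<epsilon> by (intro mult_nonneg_nonneg add_nonneg_nonneg) auto
  ultimately show ?thesis
    using complex_Re_le_cmod[of "?y j"] unfolding y0_def by linarith
qed

end

lemma norm_contour_integral_rectpath_le:
  assumes f: "f contour_integrable_on rectpath a b" and ab: "Re a \<le> Re b" "Im a \<le> Im b"
    and B: "\<And>z. z \<in> path_image (rectpath a b) \<Longrightarrow> cmod (f z) \<le> B"
  shows "cmod (contour_integral (rectpath a b) f) \<le> B * (2 * (Re b - Re a) + 2 * (Im b - Im a))"
proof -
  let ?a2 = "Complex (Re b) (Im a)" and ?a4 = "Complex (Re a) (Im b)"
  have int: "f contour_integrable_on linepath a ?a2" "f contour_integrable_on linepath ?a2 b"
    "f contour_integrable_on linepath b ?a4" "f contour_integrable_on linepath ?a4 a"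
    using f unfolding rectpath_def Let_def by simp_all
  have pi: "path_image (rectpath a b) =
      closed_segment a ?a2 \<union> (closed_segment ?a2 b \<union> (closed_segment b ?a4 \<union> closed_segment ?a4 a))"
    unfolding rectpath_def Let_def by (simp add: path_image_join)
  have "a \<in> path_image (rectpath a b)" unfolding pi by simp
  then have "0 \<le> B" using B by (meson norm_ge_zero order_trans)
  have seg: "cmod (contour_integral (linepath x y) f) \<le> B * cmod (y - x)"
    if "f contour_integrable_on linepath x y" "closed_segment x y \<subseteq> path_image (rectpath a b)" for x y
    using that B \<open>0 \<le> B\<close> by (intro contour_integral_bound_linepath) auto
  have "contour_integral (rectpath a b) f =
      contour_integral (linepath a ?a2) f + (contour_integral (linepath ?a2 b) f +
      (contour_integral (linepath b ?a4) f + contour_integral (linepath ?a4 a) f))"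
    unfolding rectpath_def Let_def using int by simp
  also have "cmod \<dots> \<le> B * cmod (?a2 - a) + (B * cmod (b - ?a2) + (B * cmod (?a4 - b) + B * cmod (a - ?a4)))"
    by (intro norm_triangle_mono seg int) (auto simp: pi)
  also have "\<dots> = B * (2 * (Re b - Re a) + 2 * (Im b - Im a))"
    using ab by (simp add: cmod_def algebra_simps)
  finally show ?thesis .
qed

section \<open>Entrywise bounds for the generator and its powers\<close>

context weighted_chain
begin

lemma gen_out: "i \<notin> {1..n} \<Longrightarrow> gen w i = 0"
  by (simp only: gen_def if_False)

lemma res_out: "i \<notin> {1..n} \<Longrightarrow> res \<zeta> w i = 0"
  by (simp only: res_def if_False)

lemma supportedD: "supported w \<Longrightarrow> i \<notin> {1..n} \<Longrightarrow> w i = 0"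
  unfolding supported_def by blast

lemma gen_sum: "gen (\<lambda>i. \<Sum>k\<in>K. c k * w k i) = (\<lambda>i. \<Sum>k\<in>K. c k * gen (w k) i)"
proof
  fix i show "gen (\<lambda>i. \<Sum>k\<in>K. c k * w k i) i = (\<Sum>k\<in>K. c k * gen (w k) i)"
  proof (cases "i \<in> {1..n}")
    case True
    then show ?thesis
      by (simp add: gen_def sum_subtractf[symmetric] sum_divide_distrib right_diff_distrib)
  next
    case False
    show ?thesis by (simp add: gen_out[OF False] del: atLeastAtMost_iff)
  qed
qed

lemma supported_gen_pow: "supported w \<Longrightarrow> supported ((gen ^^ k) w)"
  by (induction k) simp_all

lemma gen_norm_le:
  assumes B: "\<And>i. cmod (w i) \<le> B"
  shows "cmod (gen w i) \<le> 2 / dl * B"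
proof (cases "i \<in> {1..n}")
  case True
  have "cmod (gen w i) = cmod (w (Suc i) - w (i - 1)) / d i"
    using True d_pos[of i] by (simp add: gen_def norm_divide)
  also have "\<dots> \<le> (B + B) / dl"
    using d_bounds[of i] dl B by (intro frac_le norm_triangle_le_diff add_mono) (auto intro: add_nonneg_nonneg order_trans[OF norm_ge_zero])
  finally show ?thesis by (simp add: mult.commute)
next
  case False
  have "0 \<le> B" using B norm_ge_zero order_trans by blast
  then show ?thesis using dl unfolding gen_out[OF False] by simp
qed

lemma gen_pow_norm_le:
  assumes B: "\<And>i. cmod (w i) \<le> B"
  shows "cmod ((gen ^^ k) w i) \<le> (2 / dl) ^ k * B"
proof (induction k arbitrary: i)
  case (Suc k)
  have "cmod (gen ((gen ^^ k) w) i) \<le> 2 / dl * ((2 / dl) ^ k * B)"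
    using Suc by (rule gen_norm_le)
  then show ?case by (simp add: mult.assoc)
qed (simp add: B)

lemma supported_bounded:
  assumes "supported w"
  obtains B where "\<And>i. cmod (w i) \<le> B"
proof
  fix i show "cmod (w i) \<le> (\<Sum>j=1..n. cmod (w j))"
  proof (cases "i \<in> {1..n}")
    case True
    then show ?thesis by (intro member_le_sum) auto
  qed (use assms in \<open>auto simp: supported_def intro!: sum_nonneg\<close>)
qed

section \<open>The flow\<close>

text \<open>The exponential of s times \<open>gen\<close>, as an entrywise power series. With
  complex s, coefficients and variable lie in the same field and the series can be differentiated
  term by term.\<close>

definition flow :: "complex \<Rightarrow> (nat \<Rightarrow> complex) \<Rightarrow> nat \<Rightarrow> complex" where
  "flow s w i = (\<Sum>k. (gen ^^ k) w i / fact k * s ^ k)"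

lemma exp_majorant_summable: "summable (\<lambda>k. x ^ k / fact k * (C :: real))"
proof -
  have "summable (\<lambda>k. inverse (fact k) * x ^ k * C)"
    by (intro summable_mult2 summable_exp)
  then show ?thesis by (simp add: divide_inverse mult_ac)
qed

lemma flow_summable:
  assumes "supported w"
  shows "summable (\<lambda>k. (gen ^^ k) w i / fact k * s ^ k)"
proof -
  obtain B where B: "\<And>i. cmod (w i) \<le> B" using supported_bounded[OF assms] by blast
  show ?thesis
  proof (rule summable_comparison_test')
    show "summable (\<lambda>k. (2 / dl * cmod s) ^ k / fact k * B)" by (rule exp_majorant_summable)
    fix k
    show "norm ((gen ^^ k) w i / fact k * s ^ k) \<le> (2 / dl * cmod s) ^ k / fact k * B"
      using mult_right_mono[OF gen_pow_norm_le[of w B k i, OF B], of "cmod s ^ k / fact k"]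
      unfolding power_mult_distrib by (simp add: norm_mult norm_divide norm_power mult_ac)
  qed
qed

lemma flow_0: "flow 0 w = w"
  unfolding flow_def by (rule ext, subst powser_zero) simp

lemma supported_flow: "supported w \<Longrightarrow> supported (flow s w)"
  using supported_gen_pow by (simp add: supported_def flow_def)

lemma gen_pow_diff: "(gen ^^ k) (\<lambda>i. v i - w i) = (\<lambda>i. (gen ^^ k) v i - (gen ^^ k) w i)"
  by (induction k) (simp_all add: gen_diff)

lemma gen_pow_sum: "(gen ^^ k) (\<lambda>i. \<Sum>j\<in>K. c j * w j i) = (\<lambda>i. \<Sum>j\<in>K. c j * (gen ^^ k) (w j) i)"
  by (induction k) (simp_all add: gen_sum)

lemma flow_diff:
  assumes "supported v" "supported w"
  shows "flow s (\<lambda>i. v i - w i) i = flow s v i - flow s w i"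
  unfolding flow_def gen_pow_diff
  by (subst suminf_diff[OF flow_summable[OF assms(1)] flow_summable[OF assms(2)]])
    (simp add: diff_divide_distrib left_diff_distrib)

lemma flow_sum:
  assumes "\<And>j. j \<in> K \<Longrightarrow> supported (w j)"
  shows "flow s (\<lambda>i. \<Sum>j\<in>K. c j * w j i) i = (\<Sum>j\<in>K. c j * flow s (w j) i)"
proof -
  have "(\<Sum>j\<in>K. c j * flow s (w j) i) = (\<Sum>j\<in>K. \<Sum>k. c j * ((gen ^^ k) (w j) i / fact k * s ^ k))"
    unfolding flow_def by (intro sum.cong refl suminf_mult[symmetric] flow_summable assms)
  also have "\<dots> = (\<Sum>k. \<Sum>j\<in>K. c j * ((gen ^^ k) (w j) i / fact k * s ^ k))"
    by (intro suminf_sum[symmetric] summable_mult flow_summable assms)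
  also have "\<dots> = flow s (\<lambda>i. \<Sum>j\<in>K. c j * w j i) i"
    unfolding flow_def gen_pow_sum sum_divide_distrib sum_distrib_right by (simp only: times_divide_eq_right times_divide_eq_left mult.assoc)
  finally show ?thesis ..
qed

lemma flow_gen:
  assumes "supported w"
  shows "flow s (gen w) i = gen (flow s w) i"
proof (cases "i \<in> {1..n}")
  case True
  have "gen (flow s w) i = ((\<Sum>k. (gen ^^ k) w (Suc i) / fact k * s ^ k) - (\<Sum>k. (gen ^^ k) w (i - 1) / fact k * s ^ k)) / d i"
    using True by (simp add: gen_def flow_def)
  also have "\<dots> = (\<Sum>k. ((gen ^^ k) w (Suc i) / fact k * s ^ k - (gen ^^ k) w (i - 1) / fact k * s ^ k) / d i)"
    using flow_summable[OF assms] by (subst suminf_diff) (auto intro!: suminf_divide[symmetric] summable_diff)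
  also have "\<dots> = (\<Sum>k. gen ((gen ^^ k) w) i / fact k * s ^ k)"
    using True by (intro arg_cong[where f = suminf] ext) (simp add: gen_def divide_simps algebra_simps)
  also have "\<dots> = flow s (gen w) i" by (simp add: flow_def funpow_swap1)
  finally show ?thesis ..
next
  case False
  show ?thesis
    unfolding gen_out[OF False] by (rule supportedD[OF supported_flow[OF supported_gen] False])
qed

lemma flow_has_derivative:
  assumes "supported w"
  shows "((\<lambda>s. flow s w i) has_field_derivative gen (flow s w) i) (at s)"
proof -
  have "((\<lambda>s. flow s w i) has_field_derivative (\<Sum>k. diffs (\<lambda>k. (gen ^^ k) w i / fact k) k * s ^ k)) (at s)"
    unfolding flow_def using flow_summable[OF assms] by (rule termdiffs_strong_converges_everywhere)
  also have "(\<lambda>k. diffs (\<lambda>k. (gen ^^ k) w i / fact k) k) = (\<lambda>k. (gen ^^ k) (gen w) i / fact k)"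
    by (rule ext) (simp add: diffs_def funpow_swap1 del: of_nat_Suc)
  then have "(\<Sum>k. diffs (\<lambda>k. (gen ^^ k) w i / fact k) k * s ^ k) = flow s (gen w) i"
    unfolding flow_def by metis
  finally show ?thesis by (simp only: flow_gen[OF assms])
qed

definition solution :: "(real \<Rightarrow> nat \<Rightarrow> complex) \<Rightarrow> bool" where
  "solution v \<longleftrightarrow> (\<forall>s\<ge>0. supported (v s) \<and>
     (\<forall>i\<in>{1..n}. ((\<lambda>s. v s i) has_vector_derivative gen (v s) i) (at s within {0..})))"

lemma solution_flow: "supported w \<Longrightarrow> solution (\<lambda>s. flow (of_real s) w)"
  unfolding solution_def
  by (auto intro!: has_vector_derivative_real_field flow_has_derivative supported_flow)

lemma solution_diff:
  assumes "solution u" "solution v"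
  shows "solution (\<lambda>s i. u s i - v s i)"
  using assms unfolding solution_def gen_diff
  by (auto simp: supported_def intro!: has_vector_derivative_diff)

lemma solution_energy:
  assumes v: "solution v" and s: "0 \<le> s"
  shows "nrm2 (v s) = nrm2 (v 0)"
proof -
  have "((\<lambda>s. nrm2 (v s)) has_real_derivative 0) (at s within {0..})" if "s \<in> {0..}" for s
  proof -
    have sup: "supported (v s)"
      and der: "\<And>i. i \<in> {1..n} \<Longrightarrow> ((\<lambda>s. v s i) has_vector_derivative gen (v s) i) (at s within {0..})"
      using v that by (auto simp: solution_def)
    have "((\<lambda>s. nrm2 (v s)) has_vector_derivative
        (\<Sum>i=1..n. d i * (2 * Re (gen (v s) i * cnj (v s i))))) (at s within {0..})"
      unfolding nrm2_def
    proof (intro has_vector_derivative_sum)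
      fix i assume i: "i \<in> {1..n}"
      have "((\<lambda>s. Re (v s i * cnj (v s i))) has_vector_derivative
           Re (v s i * cnj (gen (v s) i) + gen (v s) i * cnj (v s i))) (at s within {0..})"
        by (intro has_vector_derivative_mult bounded_linear.has_vector_derivative[OF bounded_linear_Re]
            bounded_linear.has_vector_derivative[OF bounded_linear_cnj] der[OF i])
      then have "((\<lambda>s. (cmod (v s i))\<^sup>2) has_vector_derivative 2 * Re (gen (v s) i * cnj (v s i))) (at s within {0..})"
        unfolding cmod_power2 by (simp add: power2_eq_square algebra_simps)
      then show "((\<lambda>s. d i * (cmod (v s i))\<^sup>2) has_vector_derivative
         d i * (2 * Re (gen (v s) i * cnj (v s i)))) (at s within {0..})"
        by (intro has_vector_derivative_mult_right)
    qed
    moreover have "(\<Sum>i=1..n. d i * (2 * Re (gen (v s) i * cnj (v s i)))) =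
        2 * Re (\<Sum>i=1..n. d i * gen (v s) i * cnj (v s i))"
      unfolding Re_inner by (simp only: sum_distrib_left mult_ac)
    ultimately show ?thesis
      using gen_energy[OF sup] by (simp add: has_real_derivative_iff_has_vector_derivative)
  qed
  then have "\<exists>c. \<forall>s\<in>{0..}. nrm2 (v s) = c"
    by (intro has_field_derivative_zero_constant) auto
  then show ?thesis using s by (metis atLeast_iff order_refl)
qed

text \<open>Uniqueness by energy: the difference of two solutions starts with norm 0 and keeps
  it.\<close>

lemma solution_eq_flow:
  assumes v: "solution v" and s: "0 \<le> s"
  shows "v s i = flow s (v 0) i"
proof -
  have sup: "supported (v 0)" using v by (simp add: solution_def)
  let ?u = "\<lambda>s i. v s i - flow (of_real s) (v 0) i"
  have sol: "solution ?u" by (intro solution_diff v solution_flow sup)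
  have "nrm2 (?u s) = nrm2 (?u 0)" by (rule solution_energy[OF sol s])
  also have "\<dots> = 0" by (simp add: flow_0 nrm2_def)
  finally have "?u s i = 0"
    by (rule nrm2_0D) (use sol s in \<open>simp add: solution_def\<close>)
  then show ?thesis by simp
qed

lemma nrm2_flow: "supported w \<Longrightarrow> 0 \<le> s \<Longrightarrow> nrm2 (flow (of_real s) w) = nrm2 w"
  using solution_energy[OF solution_flow] by (simp add: flow_0)

section \<open>Contour representation of the filtered flow\<close>

lemma det_poly: "det \<zeta> = poly (continuant_poly d 1 (Suc n)) \<zeta>"
  by (simp add: det_def poly_continuant_poly)

lemma finite_det_zeros: "finite {\<zeta>. det \<zeta> = 0}"
proof -
  have "continuant_poly d 1 (Suc n) \<noteq> 0"
    using det_nonzero[of 1] unfolding det_poly by auto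
  then show ?thesis unfolding det_poly by (rule poly_roots_finite)
qed

lemma open_det_nonzero: "open {\<zeta>. det \<zeta> \<noteq> 0}"
  unfolding det_poly by (intro open_Collect_neq continuous_intros)

lemma res_holomorphic: "(\<lambda>\<zeta>. res \<zeta> w i) holomorphic_on {\<zeta>. det \<zeta> \<noteq> 0}"
proof (cases "i \<in> {1..n}")
  case True
  have "(\<lambda>\<zeta>. green (\<lambda>k. \<zeta> * of_real (d k)) n i j) holomorphic_on {\<zeta>. det \<zeta> \<noteq> 0}" for j
    unfolding green_def
    by (cases "i \<le> j") (auto simp: det_def intro!: holomorphic_intros)
  then show ?thesis
    using True unfolding res_def by (auto intro!: holomorphic_intros)
next
  case False
  then have "(\<lambda>\<zeta>. res \<zeta> w i) = (\<lambda>_. 0)" unfolding res_def by auto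
  then show ?thesis by simp
qed

text \<open>The sup norm of \<open>gen\<close> is at most 2 / dl, so for |\<zeta>| \<ge> 3 / dl the
  generator term can be absorbed and the resolvent is at most 3 B / |\<zeta>|. Inserting this into
  the equation once more leaves the leading term w / \<zeta>, which carries the whole residue at
  infinity.\<close>

lemma res_decay:
  assumes B: "\<And>i. cmod (w i) \<le> B" and sup: "supported w" and \<zeta>: "3 \<le> dl * cmod \<zeta>"
  shows "cmod (res \<zeta> w i - w i / \<zeta>) \<le> 6 / dl * B / (cmod \<zeta>)\<^sup>2"
proof -
  let ?y = "res \<zeta> w"
  have det: "det \<zeta> \<noteq> 0" using \<zeta> by (intro det_nonzero) simp
  have \<zeta>0: "0 < cmod \<zeta>" using \<zeta> dl by (cases "\<zeta> = 0") auto
  have B0: "0 \<le> B" using B norm_ge_zero order_trans by blast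
  define M where "M = Max (insert 0 ((\<lambda>i. cmod (?y i)) ` {1..n}))"
  have M: "cmod (?y i) \<le> M" for i
  proof (cases "i \<in> {1..n}")
    case False
    show ?thesis unfolding res_out[OF False] by (simp add: M_def)
  next
    case True
    then show ?thesis unfolding M_def by (intro Max_ge) auto
  qed
  have eq: "\<zeta> * ?y i - gen ?y i = w i" for i
  proof (cases "i \<in> {1..n}")
    case True
    then show ?thesis by (rule res_equation[OF det])
  next
    case False
    show ?thesis unfolding res_out[OF False] gen_out[OF False] supportedD[OF sup False] by simp
  qed
  have "cmod \<zeta> * cmod (?y i) \<le> B + 2 / dl * M" for i
  proof -
    have "\<zeta> * ?y i = w i + gen ?y i" using eq[of i] by (simp add: algebra_simps)
    then have "cmod \<zeta> * cmod (?y i) \<le> cmod (w i) + cmod (gen ?y i)"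
      by (metis norm_mult norm_triangle_ineq)
    then show ?thesis using B[of i] gen_norm_le[of ?y M i, OF M] by linarith
  qed
  moreover have "M = 0 \<or> (\<exists>i. M = cmod (?y i))"
    using Max_in[of "insert 0 ((\<lambda>i. cmod (?y i)) ` {1..n})"] unfolding M_def by auto
  moreover have M0: "0 \<le> M" using M norm_ge_zero order_trans by blast
  ultimately have "cmod \<zeta> * M \<le> B + 2 / dl * M"
    using B0 dl by auto
  moreover have "2 / dl * M \<le> 2 / 3 * (cmod \<zeta> * M)"
  proof -
    have "2 / dl \<le> 2 / 3 * cmod \<zeta>" using \<zeta> dl by (simp add: field_simps)
    from mult_right_mono[OF this M0] show ?thesis by (simp add: mult.assoc)
  qed
  ultimately have "cmod \<zeta> * M \<le> 3 * B" by linarith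
  then have M3: "M \<le> 3 * B / cmod \<zeta>" using \<zeta>0 by (simp add: field_simps)
  have "\<zeta> * ?y i = w i + gen ?y i" using eq[of i] by (simp add: algebra_simps)
  then have "?y i - w i / \<zeta> = gen ?y i / \<zeta>" using \<zeta>0 by (auto simp: field_simps)
  then have "cmod (?y i - w i / \<zeta>) = cmod (gen ?y i) / cmod \<zeta>" by (simp add: norm_divide)
  also have "\<dots> \<le> (2 / dl * (3 * B / cmod \<zeta>)) / cmod \<zeta>"
    using gen_norm_le[of ?y M i, OF M] M3 dl \<zeta>0
    by (intro divide_right_mono order_trans[OF gen_norm_le[OF M]] mult_left_mono) auto
  finally show ?thesis by (simp add: power2_eq_square)
qed

section \<open>Functional calculus by contour integrals around the spectrum\<close>

context
  fixes \<eta> Y :: real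
  assumes \<eta>: "0 < \<eta>" and Y: "0 < Y" "3 \<le> dl * Y"
begin

abbreviation "rect \<equiv> rectpath (Complex (- \<eta>) (- Y)) (Complex \<eta> Y)"

lemma path_image_rect:
  "path_image rect = {z. \<bar>Re z\<bar> = \<eta> \<and> \<bar>Im z\<bar> \<le> Y} \<union> {z. \<bar>Im z\<bar> = Y \<and> \<bar>Re z\<bar> \<le> \<eta>}"
  using \<eta> Y by (subst path_image_rectpath) (auto simp: abs_if split: if_splits)

text \<open>The rectangle meets the imaginary axis only at height Y, beyond all zeros of the
  determinant.\<close>

lemma rect_det: "path_image rect \<subseteq> {\<zeta>. det \<zeta> \<noteq> 0}"
proof
  fix \<zeta> assume \<zeta>: "\<zeta> \<in> path_image rect"
  have "Re \<zeta> \<noteq> 0 \<or> 3 \<le> dl * cmod \<zeta>"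
  proof (cases "Re \<zeta> = 0")
    case True
    then have "\<bar>Im \<zeta>\<bar> = Y" using \<zeta> \<eta> unfolding path_image_rect by auto
    then have "Y \<le> cmod \<zeta>" using abs_Im_le_cmod[of \<zeta>] by simp
    then have "dl * Y \<le> dl * cmod \<zeta>" using dl by (intro mult_left_mono) auto
    then show ?thesis using Y by simp
  qed simp
  then show "\<zeta> \<in> {\<zeta>. det \<zeta> \<noteq> 0}" using det_nonzero by simp
qed

lemma rect_integrable:
  assumes "f holomorphic_on S" "open S" "path_image rect \<subseteq> S"
  shows "f contour_integrable_on rect"
  using assms by (intro contour_integrable_holomorphic_simple) auto

lemma rect_entire_res_integrable:
  assumes "f holomorphic_on S" "open S" "path_image rect \<subseteq> S"
  shows "(\<lambda>\<zeta>. f \<zeta> * res \<zeta> w i) contour_integrable_on rect"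
  using assms rect_det open_det_nonzero
  by (intro rect_integrable[of _ "S \<inter> {\<zeta>. det \<zeta> \<noteq> 0}"] holomorphic_intros
      holomorphic_on_subset[OF res_holomorphic] open_Int)
    (auto elim: holomorphic_on_subset)

text \<open>All poles lie on the imaginary segment inside the rectangle. By the residue theorem the
  rectangle may be replaced by circles of arbitrarily large radius \<rho>, on which the resolvent is
  w / \<zeta> up to an error whose integral is O(1 / \<rho>).\<close>

lemma contour_integral_res:
  assumes sup: "supported w"
  shows "contour_integral rect (\<lambda>\<zeta>. res \<zeta> w i) = 2 * pi * \<i> * w i"
proof -
  let ?f = "\<lambda>\<zeta>. res \<zeta> w i" and ?Z = "{\<zeta>. det \<zeta> = 0}"
  define I where "I = contour_integral rect ?f"
  obtain B where B: "\<And>i. cmod (w i) \<le> B" using supported_bounded[OF sup] by blast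
  have B0: "0 \<le> B" using B norm_ge_zero order_trans by blast
  have Z: "Re p = 0" "\<bar>Im p\<bar> < Y" if "p \<in> ?Z" for p
  proof -
    have p: "\<not> (Re p \<noteq> 0 \<or> 3 \<le> dl * cmod p)" using det_nonzero[of p] that by auto
    then show "Re p = 0" by simp
    have "dl * \<bar>Im p\<bar> < dl * Y"
      using p Y mult_left_mono[OF abs_Im_le_cmod[of p], of dl] dl by linarith
    then show "\<bar>Im p\<bar> < Y" using dl by simp
  qed
  have holo: "?f holomorphic_on UNIV - ?Z"
    by (rule holomorphic_on_subset[OF res_holomorphic]) auto
  have I: "I = 2 * pi * \<i> * (\<Sum>p\<in>?Z. winding_number rect p * residue ?f p)"
    unfolding I_def using rect_det
    by (intro Residue_theorem[OF _ _ finite_det_zeros holo]) auto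
  have w1: "winding_number rect p = 1" if "p \<in> ?Z" for p
    using Z[OF that] \<eta> by (intro winding_number_rectpath) (auto simp: in_box_complex_iff)
  have circ: "cmod (I - 2 * pi * \<i> * w i) \<le> 12 * pi / dl * B / \<rho>" if \<rho>: "Y < \<rho>" for \<rho>
  proof -
    have \<rho>0: "0 < \<rho>" using \<rho> Y by simp
    have big: "3 \<le> dl * cmod \<zeta>" if "cmod \<zeta> = \<rho>" for \<zeta>
      using mult_left_mono[of Y \<rho> dl] \<rho> Y dl unfolding that by linarith
    have img: "path_image (circlepath 0 \<rho>) \<subseteq> {\<zeta>. det \<zeta> \<noteq> 0}"
      using big det_nonzero \<rho>0 by (auto simp: sphere_def)
    have "contour_integral (circlepath 0 \<rho>) ?f =
        2 * pi * \<i> * (\<Sum>p\<in>?Z. winding_number (circlepath 0 \<rho>) p * residue ?f p)"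
      using img by (intro Residue_theorem[OF _ _ finite_det_zeros holo]) auto
    also have "\<dots> = I"
      unfolding I
    proof (intro arg_cong[where f = "(*) _"] sum.cong refl arg_cong2[where f = "(*)"])
      fix p assume p: "p \<in> ?Z"
      then have "cmod p = \<bar>Im p\<bar>" using Z by (simp add: cmod_def)
      then show "winding_number (circlepath 0 \<rho>) p = winding_number rect p"
        using Z(2)[OF p] w1[OF p] \<rho> by (subst winding_number_circlepath) auto
    qed
    finally have 1: "contour_integral (circlepath 0 \<rho>) ?f = I" .
    have i1: "?f contour_integrable_on circlepath 0 \<rho>"
      using img by (intro contour_integrable_holomorphic_simple[OF res_holomorphic open_det_nonzero]) auto
    have i2: "(\<lambda>\<zeta>. 1 / (\<zeta> - 0)) contour_integrable_on circlepath 0 \<rho>"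
      using \<rho>0 by (intro contour_integrable_holomorphic_simple[of _ "- {0}"] holomorphic_intros) auto
    have "((\<lambda>\<zeta>. ?f \<zeta> - w i * (1 / (\<zeta> - 0))) has_contour_integral (I - w i * (2 * pi * \<i>))) (circlepath 0 \<rho>)"
      using has_contour_integral_integral[OF i1] has_contour_integral_integral[OF i2] 1
        contour_integral_circlepath[OF \<rho>0, of 0]
      by (intro has_contour_integral_diff has_contour_integral_lmul) simp_all
    then have "cmod (I - w i * (2 * pi * \<i>)) \<le> (6 / dl * B / \<rho>\<^sup>2) * (2 * pi * \<rho>)"
    proof (rule has_contour_integral_bound_circlepath)
      show "0 \<le> 6 / dl * B / \<rho>\<^sup>2" using B0 dl by simp
      fix x :: complex assume "cmod (x - 0) = \<rho>"
      then have x: "cmod x = \<rho>" by simp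
      show "cmod (?f x - w i * (1 / (x - 0))) \<le> 6 / dl * B / \<rho>\<^sup>2"
        using res_decay[OF B sup big[OF x]] by (simp add: x)
    qed (rule \<rho>0)
    then show ?thesis using \<rho>0 by (simp add: power2_eq_square mult_ac)
  qed
  have "I - 2 * pi * \<i> * w i = 0"
  proof (rule ccontr)
    define c where "c = cmod (I - 2 * pi * \<i> * w i)"
    define K where "K = 12 * pi / dl * B"
    assume "I - 2 * pi * \<i> * w i \<noteq> 0"
    then have c: "0 < c" by (simp add: c_def)
    have K: "0 \<le> K" using B0 dl by (simp add: K_def)
    define \<rho> where "\<rho> = Y + K / c + 1"
    have "Y < \<rho>" using K c by (simp add: \<rho>_def add_nonneg_pos)
    then have "c \<le> K / \<rho>" using circ unfolding c_def K_def by blast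
    moreover have "0 < \<rho>" using \<open>Y < \<rho>\<close> Y by simp
    ultimately have "c * \<rho> \<le> K" by (simp add: pos_le_divide_eq)
    moreover have "c * \<rho> = c * Y + K + c" using c by (simp add: \<rho>_def algebra_simps)
    moreover have "0 < c * Y" using c Y by simp
    ultimately show False using c by linarith
  qed
  then show ?thesis by (simp add: I_def)
qed

text \<open>On the contour \<zeta> R(\<zeta>) w = w + R(\<zeta>) (gen w). The polynomial part
  integrates to 0, so each power of \<zeta> becomes one application of \<open>gen\<close>.\<close>

lemma contour_integral_power_res:
  "supported w \<Longrightarrow> contour_integral rect (\<lambda>\<zeta>. \<zeta> ^ k * res \<zeta> w i) = 2 * pi * \<i> * (gen ^^ k) w i"
proof (induction k arbitrary: w)
  case 0
  then show ?case using contour_integral_res by simp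
next
  case (Suc k)
  have eq: "\<zeta> ^ Suc k * res \<zeta> w i = \<zeta> ^ k * w i + \<zeta> ^ k * res \<zeta> (gen w) i" if "\<zeta> \<in> path_image rect" for \<zeta>
  proof -
    have det: "det \<zeta> \<noteq> 0" using rect_det that by auto
    have "\<zeta> * res \<zeta> w i = w i + res \<zeta> (gen w) i"
    proof (cases "i \<in> {1..n}")
      case True
      then show ?thesis
        using res_equation[OF det True, of w] res_gen[OF det Suc.prems, of i] by (simp add: algebra_simps)
    next
      case False
      show ?thesis
        unfolding res_out[OF False] supportedD[OF Suc.prems False] by simp
    qed
    then have "\<zeta> ^ k * (\<zeta> * res \<zeta> w i) = \<zeta> ^ k * (w i + res \<zeta> (gen w) i)" by (simp only:)
    then show ?thesis by (simp only: power_Suc2 distrib_left mult.assoc)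
  qed
  have 1: "((\<lambda>\<zeta>. \<zeta> ^ k * w i) has_contour_integral 0) rect"
    by (rule Cauchy_theorem_convex_simple[of _ UNIV]) (auto intro!: holomorphic_intros)
  have 2: "(\<lambda>\<zeta>. \<zeta> ^ k * res \<zeta> (gen w) i) contour_integrable_on rect"
    by (rule rect_entire_res_integrable[of _ UNIV]) (auto intro!: holomorphic_intros)
  have "contour_integral rect (\<lambda>\<zeta>. \<zeta> ^ Suc k * res \<zeta> w i) =
      contour_integral rect (\<lambda>\<zeta>. \<zeta> ^ k * w i + \<zeta> ^ k * res \<zeta> (gen w) i)"
    using eq by (intro contour_integral_eq) auto
  also have "\<dots> = 0 + contour_integral rect (\<lambda>\<zeta>. \<zeta> ^ k * res \<zeta> (gen w) i)"
    using 1 2 by (subst contour_integral_add) (auto simp: contour_integral_unique has_contour_integral_integrable)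
  also have "\<dots> = 2 * pi * \<i> * (gen ^^ k) (gen w) i"
    using Suc.IH[of "gen w"] by simp
  finally show ?case by (simp add: funpow_swap1)
qed

text \<open>The exponential series converges uniformly on the compact contour, where the resolvent
  is bounded; so sum and integral may be interchanged.\<close>

lemma contour_integral_exp_res:
  assumes sup: "supported w"
  shows "contour_integral rect (\<lambda>\<zeta>. exp (s * \<zeta>) * res \<zeta> w i) = 2 * pi * \<i> * flow s w i"
proof -
  let ?P = "\<lambda>K \<zeta>. \<Sum>k<K. s ^ k / fact k * \<zeta> ^ k"
  have cont: "continuous_on (path_image rect) (\<lambda>\<zeta>. res \<zeta> w i)"
    by (rule continuous_on_subset[OF holomorphic_on_imp_continuous_on[OF res_holomorphic] rect_det])
  have comp: "compact (path_image rect)" by (intro compact_path_image) auto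
  obtain R where R: "\<And>\<zeta>. \<zeta> \<in> path_image rect \<Longrightarrow> cmod (res \<zeta> w i) \<le> R" and R0: "0 < R"
    using compact_imp_bounded[OF compact_continuous_image[OF cont comp]]
    unfolding bounded_pos by auto
  obtain D where D: "\<And>\<zeta>. \<zeta> \<in> path_image rect \<Longrightarrow> cmod \<zeta> \<le> D"
    using compact_imp_bounded[OF comp] unfolding bounded_iff by auto
  have exp_sum: "(\<Sum>k. s ^ k / fact k * \<zeta> ^ k) = exp (s * \<zeta>)" for \<zeta>
    unfolding exp_def by (intro arg_cong[where f = suminf] ext)
      (simp add: power_mult_distrib scaleR_conv_of_real divide_inverse of_real_inverse)
  have unif: "uniform_limit (path_image rect) ?P (\<lambda>\<zeta>. exp (s * \<zeta>)) sequentially"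
    unfolding exp_sum[symmetric]
  proof (rule Weierstrass_m_test)
    show "summable (\<lambda>k. (cmod s * D) ^ k / fact k * 1)" by (rule exp_majorant_summable)
    fix k \<zeta> assume "\<zeta> \<in> path_image rect"
    then show "norm (s ^ k / fact k * \<zeta> ^ k) \<le> (cmod s * D) ^ k / fact k * 1"
      using power_mono[OF D[of \<zeta>], of k]
      by (simp add: norm_mult norm_divide norm_power power_mult_distrib divide_right_mono mult_left_mono)
  qed
  define L where "L = 2 * (Re (Complex \<eta> Y) - Re (Complex (- \<eta>) (- Y))) + 2 * (Im (Complex \<eta> Y) - Im (Complex (- \<eta>) (- Y)))"
  have L0: "0 < L" using \<eta> Y by (simp add: L_def)
  have part: "contour_integral rect (\<lambda>\<zeta>. ?P K \<zeta> * res \<zeta> w i) = 2 * pi * \<i> * (\<Sum>k<K. (gen ^^ k) w i / fact k * s ^ k)" for K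
  proof -
    have int: "(\<lambda>\<zeta>. \<zeta> ^ k * res \<zeta> w i) contour_integrable_on rect" for k
      by (rule rect_entire_res_integrable[of _ UNIV]) (auto intro!: holomorphic_intros)
    have "contour_integral rect (\<lambda>\<zeta>. ?P K \<zeta> * res \<zeta> w i) =
        contour_integral rect (\<lambda>\<zeta>. \<Sum>k<K. s ^ k / fact k * (\<zeta> ^ k * res \<zeta> w i))"
      by (simp add: sum_distrib_right mult.assoc)
    also have "\<dots> = (\<Sum>k<K. s ^ k / fact k * contour_integral rect (\<lambda>\<zeta>. \<zeta> ^ k * res \<zeta> w i))"
      using int by (subst contour_integral_sum) (simp_all only: contour_integral_lmul contour_integrable_lmul finite_lessThan)
    finally show ?thesis
      unfolding contour_integral_power_res[OF sup] by (simp add: sum_distrib_left mult_ac)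
  qed
  have lim: "(\<lambda>K. contour_integral rect (\<lambda>\<zeta>. ?P K \<zeta> * res \<zeta> w i)) \<longlonglongrightarrow>
      contour_integral rect (\<lambda>\<zeta>. exp (s * \<zeta>) * res \<zeta> w i)"
  proof (rule LIMSEQ_I)
    fix r :: real assume r: "0 < r"
    define e where "e = r / (2 * R * L)"
    have e: "0 < e" using r R0 L0 unfolding e_def by (intro divide_pos_pos mult_pos_pos) auto
    obtain K0 where K0: "\<And>K \<zeta>. K \<ge> K0 \<Longrightarrow> \<zeta> \<in> path_image rect \<Longrightarrow> dist (?P K \<zeta>) (exp (s * \<zeta>)) < e"
      using uniform_limitD[OF unif e] unfolding eventually_sequentially by blast
    show "\<exists>K0. \<forall>K\<ge>K0. norm (contour_integral rect (\<lambda>\<zeta>. ?P K \<zeta> * res \<zeta> w i) -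
        contour_integral rect (\<lambda>\<zeta>. exp (s * \<zeta>) * res \<zeta> w i)) < r"
    proof (intro exI[of _ K0] allI impI)
      fix K assume K: "K \<ge> K0"
      have i1: "(\<lambda>\<zeta>. ?P K \<zeta> * res \<zeta> w i) contour_integrable_on rect"
        and i2: "(\<lambda>\<zeta>. exp (s * \<zeta>) * res \<zeta> w i) contour_integrable_on rect"
        and i3: "(\<lambda>\<zeta>. (?P K \<zeta> - exp (s * \<zeta>)) * res \<zeta> w i) contour_integrable_on rect"
        by (rule rect_entire_res_integrable[of _ UNIV]; auto intro!: holomorphic_intros)+
      have "contour_integral rect (\<lambda>\<zeta>. ?P K \<zeta> * res \<zeta> w i) - contour_integral rect (\<lambda>\<zeta>. exp (s * \<zeta>) * res \<zeta> w i)
        = contour_integral rect (\<lambda>\<zeta>. (?P K \<zeta> - exp (s * \<zeta>)) * res \<zeta> w i)"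
        using i1 i2 by (subst contour_integral_diff[symmetric]) (auto simp: left_diff_distrib)
      also have "cmod \<dots> \<le> (e * R) * L"
        unfolding L_def
      proof (rule norm_contour_integral_rectpath_le[OF i3])
        fix \<zeta> assume \<zeta>: "\<zeta> \<in> path_image rect"
        show "cmod ((?P K \<zeta> - exp (s * \<zeta>)) * res \<zeta> w i) \<le> e * R"
          unfolding norm_mult using K0[OF K \<zeta>] R[OF \<zeta>] e by (intro mult_mono) (auto simp: dist_norm)
      qed (use \<eta> Y in auto)
      also have "\<dots> = r / 2" using R0 L0 unfolding e_def by simp
      also have "\<dots> < r" using r by simp
      finally show "norm (contour_integral rect (\<lambda>\<zeta>. ?P K \<zeta> * res \<zeta> w i) -
        contour_integral rect (\<lambda>\<zeta>. exp (s * \<zeta>) * res \<zeta> w i)) < r" .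
    qed
  qed
  moreover have "(\<lambda>K. contour_integral rect (\<lambda>\<zeta>. ?P K \<zeta> * res \<zeta> w i)) \<longlonglongrightarrow> 2 * pi * \<i> * flow s w i"
    unfolding part flow_def by (intro tendsto_mult_left summable_LIMSEQ flow_summable sup)
  ultimately show ?thesis by (rule LIMSEQ_unique)
qed

text \<open>By the resolvent identity, R(\<zeta>) applied to the filtered vector is \<zeta> /
  (\<zeta> - \<epsilon>) times R(\<zeta>) w minus a term without R(\<zeta>). As \<eta> < \<epsilon>,
  that term is holomorphic on a half plane containing the rectangle and integrates to 0.\<close>

lemma contour_integral_filtered:
  assumes \<epsilon>: "\<eta> < \<epsilon>"
  shows "supported w \<Longrightarrow>
    contour_integral rect (\<lambda>\<zeta>. exp (s * \<zeta>) * (\<zeta> / (\<zeta> - of_real \<epsilon>)) ^ k * res \<zeta> w i) =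
      2 * pi * \<i> * flow s ((high \<epsilon> ^^ k) w) i"
proof (induction k arbitrary: w)
  case 0
  then show ?case using contour_integral_exp_res by simp
next
  case (Suc k)
  let ?h = "\<lambda>\<zeta>. exp (s * \<zeta>) * (\<zeta> / (\<zeta> - of_real \<epsilon>)) ^ k"
  let ?H = "{\<zeta>. Re \<zeta> < \<epsilon>}"
  have H: "open ?H" "convex ?H" "path_image rect \<subseteq> ?H"
    using \<epsilon> \<eta> unfolding path_image_rect
    by (auto simp: open_halfspace_Re_lt convex_halfspace_Re_lt)
  have ne: "\<zeta> \<noteq> of_real \<epsilon>" if "\<zeta> \<in> ?H" for \<zeta> using that by auto
  have det\<epsilon>: "det \<epsilon> \<noteq> 0" using \<epsilon> \<eta> by (intro det_nonzero) simp
  have eq: "?h \<zeta> * res \<zeta> (high \<epsilon> w) i =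
      ?h \<zeta> * (\<zeta> / (\<zeta> - of_real \<epsilon>)) * res \<zeta> w i - \<epsilon> * res \<epsilon> w i * (?h \<zeta> / (\<zeta> - of_real \<epsilon>))"
    if "\<zeta> \<in> path_image rect" for \<zeta>
  proof -
    have det: "det \<zeta> \<noteq> 0" and n\<epsilon>: "\<zeta> \<noteq> of_real \<epsilon>" using rect_det H(3) ne that by auto
    then have nz: "\<zeta> - of_real \<epsilon> \<noteq> 0" by simp
    have "res \<zeta> (high \<epsilon> w) i = res \<zeta> w i - \<epsilon> * res \<zeta> (res \<epsilon> w) i"
      unfolding high_def[abs_def] res_diff res_mult ..
    also have "\<dots> = res \<zeta> w i - \<epsilon> * ((res \<epsilon> w i - res \<zeta> w i) / (\<zeta> - \<epsilon>))"
      unfolding res_res_identity[OF det det\<epsilon> n\<epsilon> Suc.prems] ..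
    also have "\<dots> = (\<zeta> / (\<zeta> - of_real \<epsilon>)) * res \<zeta> w i - \<epsilon> * res \<epsilon> w i / (\<zeta> - of_real \<epsilon>)"
      using nz by (simp add: divide_simps) (simp add: algebra_simps)
    finally have *: "res \<zeta> (high \<epsilon> w) i =
        (\<zeta> / (\<zeta> - of_real \<epsilon>)) * res \<zeta> w i - \<epsilon> * res \<epsilon> w i / (\<zeta> - of_real \<epsilon>)" .
    have "h * ((\<zeta> / (\<zeta> - of_real \<epsilon>)) * res \<zeta> w i - \<epsilon> * res \<epsilon> w i / (\<zeta> - of_real \<epsilon>)) =
      h * (\<zeta> / (\<zeta> - of_real \<epsilon>)) * res \<zeta> w i - \<epsilon> * res \<epsilon> w i * (h / (\<zeta> - of_real \<epsilon>))" for h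
      by (simp add: algebra_simps)
    then show ?thesis unfolding * .
  qed
  have holo: "?h holomorphic_on ?H" "(\<lambda>\<zeta>. ?h \<zeta> / (\<zeta> - of_real \<epsilon>)) holomorphic_on ?H"
    "(\<lambda>\<zeta>. ?h \<zeta> * (\<zeta> / (\<zeta> - of_real \<epsilon>))) holomorphic_on ?H"
    using ne by (auto intro!: holomorphic_intros)
  have 1: "((\<lambda>\<zeta>. ?h \<zeta> / (\<zeta> - of_real \<epsilon>)) has_contour_integral 0) rect"
    by (rule Cauchy_theorem_convex_simple[OF holo(2) H(2)]) (use H(3) in auto)
  have 2: "(\<lambda>\<zeta>. ?h \<zeta> * (\<zeta> / (\<zeta> - of_real \<epsilon>)) * res \<zeta> w i) contour_integrable_on rect"
    by (rule rect_entire_res_integrable[OF holo(3) H(1,3)])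
  have "2 * pi * \<i> * flow s ((high \<epsilon> ^^ Suc k) w) i = 2 * pi * \<i> * flow s ((high \<epsilon> ^^ k) (high \<epsilon> w)) i"
    by (simp add: funpow_swap1)
  also have "\<dots> = contour_integral rect (\<lambda>\<zeta>. ?h \<zeta> * res \<zeta> (high \<epsilon> w) i)"
    using Suc.IH[OF supported_high[OF Suc.prems], of \<epsilon>] by simp
  also have "\<dots> = contour_integral rect (\<lambda>\<zeta>. ?h \<zeta> * (\<zeta> / (\<zeta> - of_real \<epsilon>)) * res \<zeta> w i
       - \<epsilon> * res \<epsilon> w i * (?h \<zeta> / (\<zeta> - of_real \<epsilon>)))"
    using eq by (intro contour_integral_eq) auto
  also have "\<dots> = contour_integral rect (\<lambda>\<zeta>. ?h \<zeta> * (\<zeta> / (\<zeta> - of_real \<epsilon>)) * res \<zeta> w i) - \<epsilon> * res \<epsilon> w i * 0"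
    using has_contour_integral_diff[OF has_contour_integral_integral[OF 2] has_contour_integral_lmul[OF 1]]
    by (rule contour_integral_unique)
  finally show ?case by (simp add: mult_ac)
qed

lemma flow_filtered_bound:
  assumes \<epsilon>: "\<eta> < \<epsilon>" and s: "0 \<le> s" and sup: "supported w"
    and B: "\<And>\<zeta>. \<zeta> \<in> path_image rect \<Longrightarrow> cmod ((\<zeta> / (\<zeta> - of_real \<epsilon>)) ^ k * res \<zeta> w i) \<le> B"
  shows "cmod (flow (of_real s) ((high \<epsilon> ^^ k) w) i) \<le> exp (s * \<eta>) * B * (\<eta> + Y)"
proof -
  let ?f = "\<lambda>\<zeta>. exp (of_real s * \<zeta>) * (\<zeta> / (\<zeta> - of_real \<epsilon>)) ^ k * res \<zeta> w i"
  have "\<eta> + \<i> * Y \<in> path_image rect" unfolding path_image_rect using \<eta> Y by auto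
  then have B0: "0 \<le> B" using B norm_ge_zero order_trans by blast
  have int: "?f contour_integrable_on rect"
    using \<epsilon> \<eta> by (intro rect_entire_res_integrable[of _ "{\<zeta>. Re \<zeta> < \<epsilon>}"] holomorphic_intros)
      (auto simp: path_image_rect open_halfspace_Re_lt)
  have "2 * pi * cmod (flow s ((high \<epsilon> ^^ k) w) i) = cmod (contour_integral rect ?f)"
    unfolding contour_integral_filtered[OF \<epsilon> sup] by (simp add: norm_mult)
  also have "\<dots> \<le> (exp (s * \<eta>) * B) * (2 * (\<eta> + \<eta>) + 2 * (Y + Y))"
  proof -
    have "cmod (?f \<zeta>) \<le> exp (s * \<eta>) * B" if "\<zeta> \<in> path_image rect" for \<zeta>
    proof -
      have "Re \<zeta> \<le> \<eta>" using that unfolding path_image_rect by auto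
      then have "s * Re \<zeta> \<le> s * \<eta>" using s by (intro mult_left_mono)
      then have "cmod (exp (of_real s * \<zeta>)) \<le> exp (s * \<eta>)" by simp
      then show ?thesis
        unfolding mult.assoc norm_mult[of "exp _"] using B[OF that] B0 by (intro mult_mono) auto
    qed
    from norm_contour_integral_rectpath_le[OF int _ _ this] show ?thesis using \<eta> Y by simp
  qed
  also have "\<dots> = 4 * (exp (s * \<eta>) * B * (\<eta> + Y))" by (simp add: algebra_simps)
  \<comment> \<open>The perimeter is 4 (\<eta> + Y), and 4 \<le> 2 pi lets the Cauchy factor absorb
    the constant.\<close>
  also have "\<dots> \<le> (2 * pi) * (exp (s * \<eta>) * B * (\<eta> + Y))"
    using pi_gt3 B0 \<eta> Y by (intro mult_right_mono) auto
  finally show ?thesis using pi_gt_zero by simp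
qed

end

end

section \<open>Shears of the phase plane\<close>

definition shear :: "complex \<Rightarrow> complex \<times> complex \<Rightarrow> complex \<times> complex" where
  "shear c z = (fst z, snd z + c * fst z)"

definition coshear :: "complex \<Rightarrow> complex \<times> complex \<Rightarrow> complex \<times> complex" where
  "coshear c z = (fst z + c * snd z, snd z)"

lemma shear_shear: "shear a (shear b z) = shear (a + b) z"
  by (simp add: shear_def algebra_simps)

lemma shear_0 [simp]: "shear 0 z = z"
  by (simp add: shear_def)

definition measure_preserving_map :: "(complex \<times> complex \<Rightarrow> complex \<times> complex) \<Rightarrow> bool" where
  "measure_preserving_map T \<longleftrightarrow> T \<in> borel_measurable borel \<and> distr lborel borel T = lborel"

lemma measurable_shear [measurable]: "shear c \<in> borel_measurable borel"
  unfolding shear_def by (intro borel_measurable_continuous_onI continuous_intros)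

lemma measurable_coshear [measurable]: "coshear c \<in> borel_measurable borel"
  unfolding coshear_def by (intro borel_measurable_continuous_onI continuous_intros)

lemma nn_integral_translate:
  fixes c :: "'a::euclidean_space"
  assumes "f \<in> borel_measurable borel"
  shows "(\<integral>\<^sup>+x. f (x + c) \<partial>lborel) = (\<integral>\<^sup>+x. f x \<partial>lborel)"
proof -
  have "(\<integral>\<^sup>+x. f x \<partial>lborel) = (\<integral>\<^sup>+x. f x \<partial>distr lborel borel ((+) c))"
    by (simp only: lborel_distr_plus)
  also have "\<dots> = (\<integral>\<^sup>+x. f (c + x) \<partial>lborel)"
    using assms by (subst nn_integral_distr) auto
  finally show ?thesis by (simp add: add.commute)
qed

lemma nn_integral_lborel_pair:
  fixes f :: "complex \<times> complex \<Rightarrow> ennreal"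
  assumes [measurable]: "f \<in> borel_measurable borel"
  shows "(\<integral>\<^sup>+z. f z \<partial>lborel) = (\<integral>\<^sup>+u. \<integral>\<^sup>+v. f (u, v) \<partial>lborel \<partial>lborel)"
    and "(\<integral>\<^sup>+z. f z \<partial>lborel) = (\<integral>\<^sup>+v. \<integral>\<^sup>+u. f (u, v) \<partial>lborel \<partial>lborel)"
proof -
  have f: "f \<in> borel_measurable (lborel \<Otimes>\<^sub>M lborel)"
    by (simp add: lborel_prod)
  show "(\<integral>\<^sup>+z. f z \<partial>lborel) = (\<integral>\<^sup>+u. \<integral>\<^sup>+v. f (u, v) \<partial>lborel \<partial>lborel)"
    using lborel.nn_integral_fst[OF f] by (simp add: lborel_prod)
  show "(\<integral>\<^sup>+z. f z \<partial>lborel) = (\<integral>\<^sup>+v. \<integral>\<^sup>+u. f (u, v) \<partial>lborel \<partial>lborel)"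
    using lborel_pair.nn_integral_snd[OF f] by (simp add: lborel_prod)
qed

lemma measurable_Pair_left: "f \<in> borel_measurable borel \<Longrightarrow> (\<lambda>v. f (u, v)) \<in> borel_measurable borel"
  for f :: "complex \<times> complex \<Rightarrow> 'a::topological_space"
  by (rule measurable_compose[of "\<lambda>v. (u, v)"])
    (auto intro!: borel_measurable_continuous_onI continuous_intros)

lemma measurable_Pair_right: "f \<in> borel_measurable borel \<Longrightarrow> (\<lambda>u. f (u, v)) \<in> borel_measurable borel"
  for f :: "complex \<times> complex \<Rightarrow> 'a::topological_space"
  by (rule measurable_compose[of "\<lambda>u. (u, v)"])
    (auto intro!: borel_measurable_continuous_onI continuous_intros)

lemma measure_preserving_mapI:
  assumes T: "T \<in> borel_measurable borel"
    and eq: "\<And>f :: complex \<times> complex \<Rightarrow> ennreal. f \<in> borel_measurable borel \<Longrightarrow>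
      (\<integral>\<^sup>+z. f (T z) \<partial>lborel) = (\<integral>\<^sup>+z. f z \<partial>lborel)"
  shows "measure_preserving_map T"
  unfolding measure_preserving_map_def
proof (intro conjI T measure_eqI)
  fix A assume "A \<in> sets (distr lborel borel T)"
  then have A [measurable]: "A \<in> sets borel" by simp
  have "emeasure (distr lborel borel T) A = (\<integral>\<^sup>+z. indicator A z \<partial>distr lborel borel T)"
    by (subst nn_integral_indicator) auto
  also have "\<dots> = (\<integral>\<^sup>+z. indicator A (T z) \<partial>lborel)"
    using T by (subst nn_integral_distr) auto
  also have "\<dots> = (\<integral>\<^sup>+z. indicator A z \<partial>lborel)"
    by (rule eq) measurable
  finally show "emeasure (distr lborel borel T) A = emeasure lborel A" by simp
qed simp

text \<open>Fubini: with the first coordinate fixed, a shear translates the second.\<close>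

lemma measure_preserving_shear: "measure_preserving_map (shear c)"
proof (rule measure_preserving_mapI)
  fix f :: "complex \<times> complex \<Rightarrow> ennreal" assume f [measurable]: "f \<in> borel_measurable borel"
  have m: "(\<lambda>z. f (shear c z)) \<in> borel_measurable borel" by measurable
  show "(\<integral>\<^sup>+z. f (shear c z) \<partial>lborel) = (\<integral>\<^sup>+z. f z \<partial>lborel)"
    unfolding nn_integral_lborel_pair(1)[OF m] nn_integral_lborel_pair(1)[OF f]
    using nn_integral_translate[OF measurable_Pair_left[OF f]] by (simp add: shear_def)
qed measurable

lemma measure_preserving_coshear: "measure_preserving_map (coshear c)"
proof (rule measure_preserving_mapI)
  fix f :: "complex \<times> complex \<Rightarrow> ennreal" assume f [measurable]: "f \<in> borel_measurable borel"
  have m: "(\<lambda>z. f (coshear c z)) \<in> borel_measurable borel" by measurable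
  show "(\<integral>\<^sup>+z. f (coshear c z) \<partial>lborel) = (\<integral>\<^sup>+z. f z \<partial>lborel)"
    unfolding nn_integral_lborel_pair(2)[OF m] nn_integral_lborel_pair(2)[OF f]
    using nn_integral_translate[OF measurable_Pair_right[OF f]] by (simp add: coshear_def)
qed measurable

lemma integral_measure_preserving:
  fixes f :: "complex \<times> complex \<Rightarrow> real"
  assumes "measure_preserving_map T" "f \<in> borel_measurable borel"
  shows "(\<integral>z. f (T z) \<partial>lborel) = (\<integral>z. f z \<partial>lborel)"
  using assms integral_distr[of T lborel borel f] by (simp add: measure_preserving_map_def)

lemma integrable_measure_preserving:
  fixes f :: "complex \<times> complex \<Rightarrow> real"
  assumes "measure_preserving_map T" "f \<in> borel_measurable borel" "integrable lborel f"
  shows "integrable lborel (\<lambda>z. f (T z))"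
  using assms integrable_distr_eq[of T lborel borel f] by (simp add: measure_preserving_map_def)

section \<open>Bounded square integrable functions\<close>

text \<open>Boundedness makes the average over a mass exist at every point, so that actual functions
  rather than classes modulo null sets can be iterated.\<close>

definition sqint :: "(complex \<times> complex \<Rightarrow> real) \<Rightarrow> bool" where
  "sqint \<phi> \<longleftrightarrow> \<phi> \<in> borel_measurable borel \<and> (\<exists>B. \<forall>z. \<bar>\<phi> z\<bar> \<le> B) \<and> integrable lborel (\<lambda>z. (\<phi> z)\<^sup>2)"

definition sqnorm :: "(complex \<times> complex \<Rightarrow> real) \<Rightarrow> real" where
  "sqnorm \<phi> = (\<integral>z. (\<phi> z)\<^sup>2 \<partial>lborel)"

lemma sqint_measurable [measurable_dest]: "sqint \<phi> \<Longrightarrow> \<phi> \<in> borel_measurable borel"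
  by (simp add: sqint_def)

lemma sqint_integrable: "sqint \<phi> \<Longrightarrow> integrable lborel (\<lambda>z. (\<phi> z)\<^sup>2)"
  by (simp add: sqint_def)

lemma sqint_bound: "sqint \<phi> \<Longrightarrow> \<exists>B. \<forall>z. \<bar>\<phi> z\<bar> \<le> B"
  by (simp add: sqint_def)

lemma sqnorm_nonneg: "0 \<le> sqnorm \<phi>"
  by (simp add: sqnorm_def)

lemma sqint_compose:
  assumes "measure_preserving_map T" "sqint \<phi>"
  shows "sqint (\<lambda>z. \<phi> (T z))"
proof -
  have [measurable]: "T \<in> borel_measurable borel" "\<phi> \<in> borel_measurable borel"
    using assms by (auto simp: measure_preserving_map_def sqint_def)
  obtain B where "\<And>z. \<bar>\<phi> z\<bar> \<le> B" using assms(2) by (auto simp only: sqint_def)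
  then have "\<And>z. \<bar>\<phi> (T z)\<bar> \<le> B" by simp
  moreover have "integrable lborel (\<lambda>z. (\<phi> (T z))\<^sup>2)"
    using assms(2) by (intro integrable_measure_preserving[OF assms(1)]) (auto simp only: sqint_def, measurable)
  moreover have "(\<lambda>z. \<phi> (T z)) \<in> borel_measurable borel" by measurable
  ultimately show ?thesis unfolding sqint_def by blast
qed

lemma sqnorm_compose:
  assumes "measure_preserving_map T" "sqint \<phi>"
  shows "sqnorm (\<lambda>z. \<phi> (T z)) = sqnorm \<phi>"
  unfolding sqnorm_def using integral_measure_preserving[OF assms(1), of "\<lambda>z. (\<phi> z)\<^sup>2"] assms(2)
  by (simp add: sqint_def)

lemma sqint_diff:
  assumes "sqint \<phi>" "sqint \<psi>"
  shows "sqint (\<lambda>z. \<phi> z - \<psi> z)"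
proof -
  have [measurable]: "\<phi> \<in> borel_measurable borel" "\<psi> \<in> borel_measurable borel"
    using assms by (auto simp: sqint_def)
  obtain A B where "\<forall>z. \<bar>\<phi> z\<bar> \<le> A" "\<forall>z. \<bar>\<psi> z\<bar> \<le> B"
    using assms by (auto simp: sqint_def)
  then have "\<forall>z. \<bar>\<phi> z - \<psi> z\<bar> \<le> A + B"
    by (meson abs_triangle_ineq4 add_mono order_trans)
  moreover have "integrable lborel (\<lambda>z. (\<phi> z - \<psi> z)\<^sup>2)"
  proof (rule Bochner_Integration.integrable_bound)
    show "integrable lborel (\<lambda>z. 2 * (\<phi> z)\<^sup>2 + 2 * (\<psi> z)\<^sup>2)"
      using assms by (auto simp: sqint_def)
    show "AE z in lborel. norm ((\<phi> z - \<psi> z)\<^sup>2) \<le> norm (2 * (\<phi> z)\<^sup>2 + 2 * (\<psi> z)\<^sup>2)"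
    proof (rule AE_I2)
      fix z
      have "(\<phi> z - \<psi> z)\<^sup>2 + (\<phi> z + \<psi> z)\<^sup>2 = 2 * (\<phi> z)\<^sup>2 + 2 * (\<psi> z)\<^sup>2"
        by (simp add: power2_eq_square algebra_simps)
      then have "(\<phi> z - \<psi> z)\<^sup>2 \<le> 2 * (\<phi> z)\<^sup>2 + 2 * (\<psi> z)\<^sup>2"
        using zero_le_power2[of "\<phi> z + \<psi> z"] by linarith
      then show "norm ((\<phi> z - \<psi> z)\<^sup>2) \<le> norm (2 * (\<phi> z)\<^sup>2 + 2 * (\<psi> z)\<^sup>2)" by simp
    qed
  qed measurable
  ultimately show ?thesis unfolding sqint_def by auto
qed

lemma sqnorm_diff_le:
  assumes "sqint \<phi>" "sqint \<psi>" "sqint \<xi>"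
  shows "sqnorm (\<lambda>z. \<phi> z - \<xi> z) \<le> 2 * sqnorm (\<lambda>z. \<phi> z - \<psi> z) + 2 * sqnorm (\<lambda>z. \<xi> z - \<psi> z)"
proof -
  have "sqnorm (\<lambda>z. \<phi> z - \<xi> z) \<le> (\<integral>z. 2 * (\<phi> z - \<psi> z)\<^sup>2 + 2 * (\<xi> z - \<psi> z)\<^sup>2 \<partial>lborel)"
    unfolding sqnorm_def
  proof (rule integral_mono)
    fix z
    have "(\<phi> z - \<xi> z)\<^sup>2 + (\<phi> z + \<xi> z - 2 * \<psi> z)\<^sup>2 = 2 * (\<phi> z - \<psi> z)\<^sup>2 + 2 * (\<xi> z - \<psi> z)\<^sup>2"
      by (simp add: power2_eq_square algebra_simps)
    then show "(\<phi> z - \<xi> z)\<^sup>2 \<le> 2 * (\<phi> z - \<psi> z)\<^sup>2 + 2 * (\<xi> z - \<psi> z)\<^sup>2"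
      using zero_le_power2[of "\<phi> z + \<xi> z - 2 * \<psi> z"] by linarith
  qed (use assms sqint_diff sqint_integrable in \<open>auto intro!: Bochner_Integration.integrable_add integrable_mult_right\<close>)
  also have "\<dots> = 2 * sqnorm (\<lambda>z. \<phi> z - \<psi> z) + 2 * sqnorm (\<lambda>z. \<xi> z - \<psi> z)"
    unfolding sqnorm_def using sqint_integrable[OF sqint_diff[OF assms(1,2)]] sqint_integrable[OF sqint_diff[OF assms(3,2)]]
    by simp
  finally show ?thesis .
qed

text \<open>Telescoping over j shears by c: all increments have the same norm because shears
  preserve the measure, and Cauchy-Schwarz contributes j^2.\<close>

lemma sqnorm_shear_multiple:
  assumes \<phi>: "sqint \<phi>"
  shows "sqnorm (\<lambda>z. \<phi> (shear (of_nat j * c) z) - \<phi> z) \<le> (real j)\<^sup>2 * sqnorm (\<lambda>z. \<phi> (shear c z) - \<phi> z)"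
proof -
  let ?D = "\<lambda>z. \<phi> (shear c z) - \<phi> z"
  have sD: "sqint ?D" by (rule sqint_diff[OF sqint_compose[OF measure_preserving_shear \<phi>] \<phi>])
  have sDl: "sqint (\<lambda>z. ?D (shear (of_nat l * c) z))" for l
    using sqint_compose[OF measure_preserving_shear sD] .
  have tel: "\<phi> (shear (of_nat j * c) z) - \<phi> z = (\<Sum>l<j. ?D (shear (of_nat l * c) z))" for z
  proof (induction j)
    case (Suc j)
    have "shear c (shear (of_nat j * c) z) = shear (of_nat (Suc j) * c) z"
      by (simp only: shear_shear of_nat_Suc distrib_right mult_1)
    then show ?case using Suc by (simp only: sum.lessThan_Suc)
  qed simp
  have "sqnorm (\<lambda>z. \<phi> (shear (of_nat j * c) z) - \<phi> z) \<le> (\<integral>z. j * (\<Sum>l<j. (?D (shear (of_nat l * c) z))\<^sup>2) \<partial>lborel)"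
    unfolding sqnorm_def
  proof (rule integral_mono)
    show "integrable lborel (\<lambda>z. (\<phi> (shear (of_nat j * c) z) - \<phi> z)\<^sup>2)"
      by (rule sqint_integrable[OF sqint_diff[OF sqint_compose[OF measure_preserving_shear \<phi>] \<phi>]])
    show "integrable lborel (\<lambda>z. j * (\<Sum>l<j. (?D (shear (of_nat l * c) z))\<^sup>2))"
      by (intro integrable_mult_right Bochner_Integration.integrable_sum sqint_integrable[OF sDl])
    fix z
    show "(\<phi> (shear (of_nat j * c) z) - \<phi> z)\<^sup>2 \<le> j * (\<Sum>l<j. (?D (shear (of_nat l * c) z))\<^sup>2)"
      unfolding tel using sum_squared_le_sum_of_squares[of "\<lambda>l. ?D (shear (of_nat l * c) z)" "{..<j}"]
      by (simp add: mult.commute)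
  qed
  also have "\<dots> = j * (\<Sum>l<j. sqnorm (\<lambda>z. ?D (shear (of_nat l * c) z)))"
    unfolding sqnorm_def using sqint_integrable[OF sDl] by (simp add: Bochner_Integration.integral_sum)
  also have "\<dots> = j * (\<Sum>l<j. sqnorm ?D)"
    using sqnorm_compose[OF measure_preserving_shear sD] by simp
  finally show ?thesis by (simp add: power2_eq_square)
qed

text \<open>A function that is almost invariant under the shear by \<open>c\<close> has little mass in the cone below,
  since sufficiently high multiples of the shear move the cone to disjoint cones.\<close>

definition cone :: "real \<Rightarrow> (complex \<times> complex) set" where
  "cone L = {z. cmod (snd z) < L * cmod (fst z)}"

lemma measurable_cone [measurable]: "cone L \<in> sets borel"
  unfolding cone_def by (intro borel_open open_Collect_less continuous_intros)

text \<open>With fst z = u, both second coordinates lie in the disc of radius L |u|, but they differ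
  by at least k |c| |u| \<ge> 2 L |u|.\<close>

lemma cone_disjoint:
  assumes k: "2 * L \<le> real k * cmod c" and z: "shear (of_nat (i * k) * c) z \<in> cone L" "shear (of_nat (j * k) * c) z \<in> cone L"
  shows "i = j"
proof (rule ccontr)
  assume "i \<noteq> j"
  let ?u = "cmod (fst z)" and ?x = "snd z + of_nat (i * k) * c * fst z" and ?y = "snd z + of_nat (j * k) * c * fst z"
  have "cmod ?x < L * ?u" "cmod ?y < L * ?u"
    using z by (auto simp: cone_def shear_def)
  then have "cmod (?x - ?y) < 2 * L * ?u"
    using norm_triangle_ineq4[of ?x ?y] by linarith
  moreover have "cmod (?x - ?y) = \<bar>real i - real j\<bar> * (real k * cmod c) * ?u"
  proof -
    have "?x - ?y = of_real (real i - real j) * (of_nat k * c) * fst z" by (simp add: algebra_simps)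
    then show ?thesis by (simp only: norm_mult norm_of_real norm_of_nat)
  qed
  moreover have "1 * (real k * cmod c) * ?u \<le> \<bar>real i - real j\<bar> * (real k * cmod c) * ?u"
    using \<open>i \<noteq> j\<close> by (intro mult_right_mono) (auto simp: abs_if)
  moreover have "2 * L * ?u \<le> real k * cmod c * ?u"
    using k by (intro mult_right_mono) auto
  ultimately show False by simp
qed

lemma cone_mass:
  assumes \<phi>: "sqint \<phi>" and k: "2 * L \<le> real k * cmod c"
  shows "(\<integral>z. indicator (cone L) z * (\<phi> z)\<^sup>2 \<partial>lborel) \<le>
    5 / 16 * sqnorm \<phi> + 35 / 2 * (real k)\<^sup>2 * sqnorm (\<lambda>z. \<phi> (shear c z) - \<phi> z)"
proof -
  let ?S = "cone L" and ?K = "sqnorm (\<lambda>z. \<phi> (shear c z) - \<phi> z)"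
  let ?I = "\<integral>z. indicator ?S z * (\<phi> z)\<^sup>2 \<partial>lborel"
  define T where "T j = shear (of_nat (j * k) * c)" for j
  define T' where "T' j = shear (- (of_nat (j * k) * c))" for j
  have mp: "measure_preserving_map (T j)" "measure_preserving_map (T' j)" for j
    unfolding T_def T'_def by (rule measure_preserving_shear)+
  have T'T: "T' j (T j z) = z" for j z by (simp add: T_def T'_def shear_shear)
  have meas [measurable]: "\<phi> \<in> borel_measurable borel" using \<phi> by (simp add: sqint_def)
  have measT [measurable]: "T j \<in> borel_measurable borel" "T' j \<in> borel_measurable borel" for j
    using mp unfolding measure_preserving_map_def by auto
  have intS: "integrable lborel (\<lambda>z. indicator A z * (\<psi> z)\<^sup>2)" if "sqint \<psi>" "A \<in> sets borel" for \<psi> A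
    using sqint_integrable[OF that(1)] that(2) by (subst mult.commute) (auto intro!: integrable_real_mult_indicator)
  have err: "sqnorm (\<lambda>z. \<phi> (T j z) - \<phi> z) \<le> (real j)\<^sup>2 * ((real k)\<^sup>2 * ?K)" for j
    using sqnorm_shear_multiple[OF \<phi>, of "j * k" c] by (simp add: T_def power_mult_distrib mult_ac)
  \<comment> \<open>Weighted Young inequality with factors 1 + 1/4 and 1 + 4. Summed over the shifts
    j = 0, 1, 2, 3, whose cones are disjoint, and divided by 4, they become 5/16 and 5 (0 + 1 + 4 +
    9) / 4 = 35/2.\<close>
  have shift: "?I \<le> 5 / 4 * (\<integral>z. indicator ?S (T' j z) * (\<phi> z)\<^sup>2 \<partial>lborel) + 5 * ((real j)\<^sup>2 * ((real k)\<^sup>2 * ?K))" for j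
  proof -
    have s1: "sqint (\<lambda>z. \<phi> (T j z))" by (rule sqint_compose[OF mp(1) \<phi>])
    have s2: "sqint (\<lambda>z. \<phi> (T j z) - \<phi> z)" by (rule sqint_diff[OF s1 \<phi>])
    have "?I \<le> (\<integral>z. 5 / 4 * (indicator ?S z * (\<phi> (T j z))\<^sup>2) + 5 * (\<phi> (T j z) - \<phi> z)\<^sup>2 \<partial>lborel)"
    proof (rule integral_mono)
      show "integrable lborel (\<lambda>z. indicator ?S z * (\<phi> z)\<^sup>2)" by (intro intS \<phi>) measurable
      show "integrable lborel (\<lambda>z. 5 / 4 * (indicator ?S z * (\<phi> (T j z))\<^sup>2) + 5 * (\<phi> (T j z) - \<phi> z)\<^sup>2)"
        using s1 s2 by (intro Bochner_Integration.integrable_add integrable_mult_right intS sqint_integrable) auto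
      fix z
      have "(\<phi> z)\<^sup>2 + (\<phi> (T j z) / 2 + 2 * (\<phi> (T j z) - \<phi> z))\<^sup>2 = 5 / 4 * (\<phi> (T j z))\<^sup>2 + 5 * (\<phi> (T j z) - \<phi> z)\<^sup>2"
        by (simp add: power2_eq_square field_simps)
      then have "(\<phi> z)\<^sup>2 \<le> 5 / 4 * (\<phi> (T j z))\<^sup>2 + 5 * (\<phi> (T j z) - \<phi> z)\<^sup>2"
        using zero_le_power2[of "\<phi> (T j z) / 2 + 2 * (\<phi> (T j z) - \<phi> z)"] by linarith
      then show "indicator ?S z * (\<phi> z)\<^sup>2 \<le> 5 / 4 * (indicator ?S z * (\<phi> (T j z))\<^sup>2) + 5 * (\<phi> (T j z) - \<phi> z)\<^sup>2"
        by (simp split: split_indicator)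
    qed
    also have "\<dots> = 5 / 4 * (\<integral>z. indicator ?S z * (\<phi> (T j z))\<^sup>2 \<partial>lborel) + 5 * sqnorm (\<lambda>z. \<phi> (T j z) - \<phi> z)"
      unfolding sqnorm_def using intS[OF s1, of ?S] sqint_integrable[OF s2]
      by (subst Bochner_Integration.integral_add) auto
    also have "(\<integral>z. indicator ?S z * (\<phi> (T j z))\<^sup>2 \<partial>lborel) = (\<integral>z. indicator ?S (T' j z) * (\<phi> z)\<^sup>2 \<partial>lborel)"
      using integral_measure_preserving[OF mp(1), of "\<lambda>z. indicator ?S (T' j z) * (\<phi> z)\<^sup>2" j]
      by (simp add: T'T)
    finally show ?thesis using err[of j] by linarith
  qed
  have "(\<Sum>j<4. \<integral>z. indicator ?S (T' j z) * (\<phi> z)\<^sup>2 \<partial>lborel) = (\<integral>z. (\<Sum>j<4. indicator ?S (T' j z) * (\<phi> z)\<^sup>2) \<partial>lborel)"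
  proof (rule Bochner_Integration.integral_sum[symmetric])
    fix j
    have "T' j -` ?S \<in> sets borel" using measurable_sets[OF measT(2), of ?S j] by simp
    from intS[OF \<phi> this] show "integrable lborel (\<lambda>z. indicator ?S (T' j z) * (\<phi> z)\<^sup>2)"
      by (simp add: indicator_vimage[unfolded comp_def, symmetric] indicator_def)
  qed
  also have "\<dots> \<le> sqnorm \<phi>"
    unfolding sqnorm_def
  proof (rule integral_mono')
    show "integrable lborel (\<lambda>z. (\<phi> z)\<^sup>2)" by (rule sqint_integrable[OF \<phi>])
    fix z
    have "(\<Sum>j<4. indicator ?S (T' j z) :: real) \<le> 1"
    proof (cases "\<exists>j<4. T' j z \<in> ?S")
      case True
      then obtain j where j: "j < 4" "T' j z \<in> ?S" by blast
      have "T' i z \<notin> ?S" if "i \<noteq> j" for i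
        using cone_disjoint[of L k "- c" i z j] k j(2) that unfolding T'_def by auto
      then have "(\<Sum>i<4. indicator ?S (T' i z) :: real) = (\<Sum>i<4. if i = j then 1 else 0)"
        using j by (intro sum.cong) (auto simp: indicator_def)
      then show ?thesis by simp
    next
      case False
      then have "(\<Sum>i<4. indicator ?S (T' i z) :: real) = 0" by (intro sum.neutral) auto
      then show ?thesis by simp
    qed
    then have "(\<Sum>j<4. indicator ?S (T' j z) :: real) * (\<phi> z)\<^sup>2 \<le> 1 * (\<phi> z)\<^sup>2"
      by (intro mult_right_mono) auto
    then show "(\<Sum>j<4. indicator ?S (T' j z) * (\<phi> z)\<^sup>2) \<le> (\<phi> z)\<^sup>2" by (simp add: sum_distrib_right)
  qed simp
  finally have tot: "(\<Sum>j<4. \<integral>z. indicator ?S (T' j z) * (\<phi> z)\<^sup>2 \<partial>lborel) \<le> sqnorm \<phi>" .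
  have "4 * ?I = (\<Sum>j<4::nat. ?I)" by simp
  also have "\<dots> \<le> (\<Sum>j<4. 5 / 4 * (\<integral>z. indicator ?S (T' j z) * (\<phi> z)\<^sup>2 \<partial>lborel) + 5 * ((real j)\<^sup>2 * ((real k)\<^sup>2 * ?K)))"
    by (intro sum_mono shift)
  also have "\<dots> = 5 / 4 * (\<Sum>j<4. \<integral>z. indicator ?S (T' j z) * (\<phi> z)\<^sup>2 \<partial>lborel) + 5 * ((\<Sum>j<4. (real j)\<^sup>2) * ((real k)\<^sup>2 * ?K))"
    by (simp only: sum.distrib sum_distrib_left sum_distrib_right mult.assoc)
  also have "(\<Sum>j<4. (real j)\<^sup>2) = 14" by (simp add: eval_nat_numeral)
  finally show ?thesis using tot by simp
qed

section \<open>Averaging over the masses\<close>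

text \<open>\<open>spread\<close> guarantees that every event of probability greater than 1/2
  contains a mass at distance at least d0 from any given one. A bounded density provides it.\<close>

locale mass_law = prob_space \<mu> for \<mu> :: "real measure" +
  fixes d0 :: real
  assumes sets_mu [measurable_cong, simp]: "sets \<mu> = sets borel"
    and d0: "0 < d0" and spread: "\<And>x. measure \<mu> {x - d0<..<x + d0} \<le> 1 / 2"
begin

definition average :: "complex \<Rightarrow> (complex \<times> complex \<Rightarrow> real) \<Rightarrow> complex \<times> complex \<Rightarrow> real" where
  "average \<zeta> \<phi> z = (\<integral>m. \<phi> (shear (\<zeta> * of_real m) z) \<partial>\<mu>)"

lemma measurable_shear_joint [measurable]:
  "(\<lambda>p. shear (\<zeta> * of_real (snd p)) (fst p)) \<in> lborel \<Otimes>\<^sub>M \<mu> \<rightarrow>\<^sub>M borel"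
proof -
  have "(\<lambda>p. shear (\<zeta> * of_real (snd p)) (fst p)) \<in> borel_measurable (borel :: ((complex \<times> complex) \<times> real) measure)"
    unfolding shear_def by (intro borel_measurable_continuous_onI continuous_intros)
  moreover have "sets (lborel \<Otimes>\<^sub>M \<mu> :: ((complex \<times> complex) \<times> real) measure) = sets borel"
  proof -
    have "sets (lborel \<Otimes>\<^sub>M \<mu> :: ((complex \<times> complex) \<times> real) measure) = sets (borel \<Otimes>\<^sub>M borel)"
      by (intro sets_pair_measure_cong) auto
    then show ?thesis by (simp only: borel_prod)
  qed
  ultimately show ?thesis using measurable_cong_sets by blast
qed

lemma measurable_mass_shear: "(\<lambda>m. shear (\<zeta> * of_real m) z) \<in> \<mu> \<rightarrow>\<^sub>M borel"
proof -
  have "(\<lambda>m. shear (\<zeta> * of_real m) z) \<in> borel_measurable borel"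
    unfolding shear_def by (intro borel_measurable_continuous_onI continuous_intros)
  then show ?thesis using measurable_cong_sets[OF sets_mu refl] by blast
qed

lemma integrable_mass:
  assumes "sqint \<phi>"
  shows "integrable \<mu> (\<lambda>m. \<phi> (shear (\<zeta> * of_real m) z))"
    and "integrable \<mu> (\<lambda>m. (\<phi> (shear (\<zeta> * of_real m) z))\<^sup>2)"
proof -
  obtain B where B: "\<And>z. \<bar>\<phi> z\<bar> \<le> B" using sqint_bound[OF assms] by blast
  have "0 \<le> B" using B abs_ge_zero order_trans by blast
  have m: "(\<lambda>m. \<phi> (shear (\<zeta> * of_real m) z)) \<in> borel_measurable \<mu>"
    using measurable_mass_shear sqint_measurable[OF assms] by (rule measurable_compose)
  then show "integrable \<mu> (\<lambda>m. \<phi> (shear (\<zeta> * of_real m) z))"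
    by (rule integrable_const_bound[of _ B, rotated]) (use B in auto)
  show "integrable \<mu> (\<lambda>m. (\<phi> (shear (\<zeta> * of_real m) z))\<^sup>2)"
  proof (rule integrable_const_bound[of _ "B\<^sup>2"])
    show "AE m in \<mu>. norm ((\<phi> (shear (\<zeta> * of_real m) z))\<^sup>2) \<le> B\<^sup>2"
      using B \<open>0 \<le> B\<close> by (auto simp: abs_le_square_iff[symmetric])
  qed (use m in measurable)
qed

lemma measurable_average: "\<phi> \<in> borel_measurable borel \<Longrightarrow> average \<zeta> \<phi> \<in> borel_measurable borel"
proof -
  assume [measurable]: "\<phi> \<in> borel_measurable borel"
  have "(\<lambda>p. \<phi> (shear (\<zeta> * of_real (snd p)) (fst p))) \<in> borel_measurable (lborel \<Otimes>\<^sub>M \<mu>)"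
    by measurable
  then have "average \<zeta> \<phi> \<in> borel_measurable lborel"
    unfolding average_def[abs_def] by (intro borel_measurable_lebesgue_integral) (simp add: split_beta')
  then show ?thesis by simp
qed

text \<open>For each point z the variance of \<phi> over the mass is the mean square minus the
  squared mean. Integrating over z and exchanging integrals turns the mean square into the invariant
  norm of \<phi>, so the loss of norm under averaging is an averaged distance between the shears of
  \<phi> and their mean.\<close>

lemma
  assumes \<phi>: "sqint \<phi>"
  shows sqint_average: "sqint (average \<zeta> \<phi>)"
    and variance_average: "(\<integral>m. sqnorm (\<lambda>z. \<phi> (shear (\<zeta> * of_real m) z) - average \<zeta> \<phi> z) \<partial>\<mu>) = sqnorm \<phi> - sqnorm (average \<zeta> \<phi>)"
    and integrable_variance: "integrable \<mu> (\<lambda>m. sqnorm (\<lambda>z. \<phi> (shear (\<zeta> * of_real m) z) - average \<zeta> \<phi> z))"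
proof -
  interpret pair_sigma_finite lborel \<mu> by standard
  let ?A = "average \<zeta> \<phi>" and ?f = "\<lambda>z m. \<phi> (shear (\<zeta> * of_real m) z)"
  have [measurable]: "\<phi> \<in> borel_measurable borel" using \<phi> by (simp add: sqint_def)
  have A [measurable]: "?A \<in> borel_measurable borel" by (rule measurable_average) measurable
  have fm [measurable]: "(\<lambda>p. ?f (fst p) (snd p)) \<in> borel_measurable (lborel \<Otimes>\<^sub>M \<mu>)" by measurable
  obtain B where B: "\<And>z. \<bar>\<phi> z\<bar> \<le> B" using sqint_bound[OF \<phi>] by blast
  have var: "(\<integral>m. (?f z m - ?A z)\<^sup>2 \<partial>\<mu>) = (\<integral>m. (?f z m)\<^sup>2 \<partial>\<mu>) - (?A z)\<^sup>2" for z
    using variance_eq[OF integrable_mass[OF \<phi>, of \<zeta> z]] by (simp add: average_def)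
  then have jensen: "(?A z)\<^sup>2 \<le> (\<integral>m. (?f z m)\<^sup>2 \<partial>\<mu>)" for z
    by (metis (no_types, lifting) diff_ge_0_iff_ge integral_nonneg_AE AE_I2 zero_le_power2)
  have fsq: "integrable (lborel \<Otimes>\<^sub>M \<mu>) (\<lambda>p. (?f (fst p) (snd p))\<^sup>2)"
  proof (rule integrableI_nonneg)
    have "(\<integral>\<^sup>+p. ennreal ((?f (fst p) (snd p))\<^sup>2) \<partial>(lborel \<Otimes>\<^sub>M \<mu>)) =
        (\<integral>\<^sup>+m. \<integral>\<^sup>+z. ennreal ((?f z m)\<^sup>2) \<partial>lborel \<partial>\<mu>)"
      by (subst nn_integral_snd[symmetric]) auto
    also have "\<dots> = (\<integral>\<^sup>+m. ennreal (sqnorm \<phi>) \<partial>\<mu>)"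
    proof (intro nn_integral_cong)
      fix m
      have s: "sqint (\<lambda>z. ?f z m)" by (rule sqint_compose[OF measure_preserving_shear \<phi>])
      show "(\<integral>\<^sup>+z. ennreal ((?f z m)\<^sup>2) \<partial>lborel) = ennreal (sqnorm \<phi>)"
        using nn_integral_eq_integral[OF sqint_integrable[OF s]]
          sqnorm_compose[OF measure_preserving_shear \<phi>] by (simp add: sqnorm_def)
    qed
    also have "\<dots> < \<infinity>" by (simp add: emeasure_space_1)
    finally show "(\<integral>\<^sup>+p. ennreal ((?f (fst p) (snd p))\<^sup>2) \<partial>(lborel \<Otimes>\<^sub>M \<mu>)) < \<infinity>" .
  qed auto
  have ifst: "integrable lborel (\<lambda>z. \<integral>m. (?f z m)\<^sup>2 \<partial>\<mu>)"
    using integrable_fst'[OF fsq] by simp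
  have Aint: "integrable lborel (\<lambda>z. (?A z)\<^sup>2)"
    by (rule Bochner_Integration.integrable_bound[OF ifst])
      (use jensen in \<open>auto intro: order_trans[OF jensen abs_ge_self]\<close>)
  have "\<bar>?A z\<bar> \<le> B" for z
  proof -
    have "\<bar>?A z\<bar> \<le> (\<integral>m. \<bar>?f z m\<bar> \<partial>\<mu>)" unfolding average_def by (rule integral_abs_bound)
    also have "\<dots> \<le> (\<integral>m. B \<partial>\<mu>)"
      using integrable_mass(1)[OF \<phi>] B by (intro integral_mono) auto
    finally show ?thesis by (simp add: prob_space)
  qed
  then show sA: "sqint ?A" unfolding sqint_def using A Aint by blast
  let ?g = "\<lambda>z m. (?f z m - ?A z)\<^sup>2"
  have Asq: "integrable (lborel \<Otimes>\<^sub>M \<mu>) (\<lambda>p. (?A (fst p))\<^sup>2)"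
  proof (rule integrableI_nonneg)
    have "(\<integral>\<^sup>+p. ennreal ((?A (fst p))\<^sup>2) \<partial>(lborel \<Otimes>\<^sub>M \<mu>)) = (\<integral>\<^sup>+z. ennreal ((?A z)\<^sup>2) \<partial>lborel)"
      by (subst nn_integral_snd[symmetric]) (auto simp: emeasure_space_1)
    also have "\<dots> < \<infinity>" using nn_integral_eq_integral[OF Aint] by simp
    finally show "(\<integral>\<^sup>+p. ennreal ((?A (fst p))\<^sup>2) \<partial>(lborel \<Otimes>\<^sub>M \<mu>)) < \<infinity>" .
  qed auto
  have gint: "integrable (lborel \<Otimes>\<^sub>M \<mu>) (\<lambda>(z, m). ?g z m)"
  proof (rule Bochner_Integration.integrable_bound)
    show "integrable (lborel \<Otimes>\<^sub>M \<mu>) (\<lambda>p. 2 * (?f (fst p) (snd p))\<^sup>2 + 2 * (?A (fst p))\<^sup>2)"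
      using fsq Asq by auto
    have "(x - y)\<^sup>2 \<le> 2 * x\<^sup>2 + 2 * y\<^sup>2" for x y :: real
      using zero_le_power2[of "x + y"] by (simp add: power2_eq_square algebra_simps)
    then show "AE p in lborel \<Otimes>\<^sub>M \<mu>. norm (case p of (z, m) \<Rightarrow> ?g z m) \<le> norm (2 * (?f (fst p) (snd p))\<^sup>2 + 2 * (?A (fst p))\<^sup>2)"
      by (auto simp: split_beta')
  qed (simp add: split_beta')
  have "(\<integral>m. (\<integral>z. ?g z m \<partial>lborel) \<partial>\<mu>) = (\<integral>z. (\<integral>m. ?g z m \<partial>\<mu>) \<partial>lborel)"
    by (rule Fubini_integral[OF gint])
  also have "\<dots> = (\<integral>z. (\<integral>m. (?f z m)\<^sup>2 \<partial>\<mu>) \<partial>lborel) - sqnorm ?A"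
    unfolding var sqnorm_def using ifst Aint by simp
  also have "(\<integral>z. (\<integral>m. (?f z m)\<^sup>2 \<partial>\<mu>) \<partial>lborel) = (\<integral>m. (\<integral>z. (?f z m)\<^sup>2 \<partial>lborel) \<partial>\<mu>)"
    using fsq by (intro Fubini_integral[symmetric]) (simp add: split_beta')
  also have "\<dots> = sqnorm \<phi>"
    using sqnorm_compose[OF measure_preserving_shear \<phi>] by (simp add: sqnorm_def prob_space)
  finally show "(\<integral>m. sqnorm (\<lambda>z. ?f z m - ?A z) \<partial>\<mu>) = sqnorm \<phi> - sqnorm ?A"
    by (simp add: sqnorm_def)
  show "integrable \<mu> (\<lambda>m. sqnorm (\<lambda>z. ?f z m - ?A z))"
    unfolding sqnorm_def using integrable_snd[OF gint] by simp
qed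

lemma sqnorm_average_le: "sqint \<phi> \<Longrightarrow> sqnorm (average \<zeta> \<phi>) \<le> sqnorm \<phi>"
  using variance_average[of \<phi> \<zeta>] integral_nonneg_AE[of "\<lambda>m. sqnorm (\<lambda>z. \<phi> (shear (\<zeta> * of_real m) z) - average \<zeta> \<phi> z)" \<mu>]
  by (simp add: sqnorm_nonneg)

text \<open>If averaging loses little, most shears of \<phi> are close to the average, hence close
  to each other. Comparing two of them and shifting one back shows that \<phi> is almost invariant
  under the shear by the difference of two masses, which \<open>spread\<close> keeps away from
  0.\<close>

lemma near_invariance:
  assumes \<phi>: "sqint \<phi>" and pos: "0 < e" and close: "sqnorm \<phi> - sqnorm (average \<zeta> \<phi>) \<le> e"
  obtains d where "d0 \<le> \<bar>d\<bar>" "sqnorm (\<lambda>z. \<phi> (shear (\<zeta> * of_real d) z) - \<phi> z) \<le> 16 * e"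
proof -
  let ?A = "average \<zeta> \<phi>"
  define D where "D m = sqnorm (\<lambda>z. \<phi> (shear (\<zeta> * of_real m) z) - ?A z)" for m
  have int: "integrable \<mu> D" unfolding D_def by (rule integrable_variance[OF \<phi>])
  have [measurable]: "D \<in> borel_measurable \<mu>" using int by auto
  have D0: "0 \<le> D m" for m by (simp add: D_def sqnorm_nonneg)
  have "(\<integral>m. D m \<partial>\<mu>) \<le> e" unfolding D_def variance_average[OF \<phi>] by (rule close)
  \<comment> \<open>Markov with threshold 4 e leaves at most probability 1/4 for bad masses.
    Together with the 1/2 from \<open>spread\<close> this is less than 1, so a good second mass
    exists; two distances below 4 e combine to 2 (4 e) + 2 (4 e) = 16 e.\<close>
  moreover have "measure \<mu> {m \<in> space \<mu>. 4 * e \<le> D m} \<le> (\<integral>m. D m \<partial>\<mu>) / (4 * e)"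
    using int pos D0 by (intro integral_Markov_inequality_measure[where A = "{}"]) auto
  ultimately have "measure \<mu> {m \<in> space \<mu>. 4 * e \<le> D m} \<le> e / (4 * e)"
    using pos by (meson divide_right_mono less_imp_le mult_pos_pos order_trans zero_less_numeral)
  then have bad: "measure \<mu> {m \<in> space \<mu>. 4 * e \<le> D m} \<le> 1 / 4"
    using pos by simp
  have sp: "space \<mu> = UNIV" using sets_eq_imp_space_eq[OF sets_mu] by simp
  have "\<exists>m. D m < 4 * e"
  proof (rule ccontr)
    assume "\<not> ?thesis"
    then have "{m \<in> space \<mu>. 4 * e \<le> D m} = space \<mu>" by (auto simp: not_less)
    then show False using bad prob_space by simp
  qed
  then obtain m1 where m1: "D m1 < 4 * e" ..
  have "\<exists>m2. d0 \<le> \<bar>m1 - m2\<bar> \<and> D m2 < 4 * e"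
  proof (rule ccontr)
    assume "\<not> ?thesis"
    then have "space \<mu> \<subseteq> {m \<in> space \<mu>. 4 * e \<le> D m} \<union> {m1 - d0<..<m1 + d0}"
      by (force simp: sp not_less not_le)
    then have "measure \<mu> (space \<mu>) \<le> measure \<mu> ({m \<in> space \<mu>. 4 * e \<le> D m} \<union> {m1 - d0<..<m1 + d0})"
      by (intro finite_measure_mono) auto
    also have "\<dots> \<le> measure \<mu> {m \<in> space \<mu>. 4 * e \<le> D m} + measure \<mu> {m1 - d0<..<m1 + d0}"
      by (intro measure_Un_le) auto
    also have "\<dots> \<le> 1 / 4 + 1 / 2" by (intro add_mono bad spread)
    finally show False by (simp add: prob_space)
  qed
  then obtain m2 where m2: "d0 \<le> \<bar>m1 - m2\<bar>" "D m2 < 4 * e" by blast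
  let ?f = "\<lambda>m z. \<phi> (shear (\<zeta> * of_real m) z)"
  have s: "sqint (?f m)" for m by (rule sqint_compose[OF measure_preserving_shear \<phi>])
  have "sqnorm (\<lambda>z. ?f m1 z - ?f m2 z) \<le> 2 * D m1 + 2 * D m2"
    unfolding D_def by (intro sqnorm_diff_le s sqint_average \<phi>)
  then have le: "sqnorm (\<lambda>z. ?f m1 z - ?f m2 z) \<le> 16 * e" using m1 m2 by linarith
  have sd: "sqint (\<lambda>z. ?f (m1 - m2) z - \<phi> z)" by (rule sqint_diff[OF s \<phi>])
  have "sqnorm (\<lambda>z. ?f (m1 - m2) z - \<phi> z) =
      sqnorm (\<lambda>z. ?f (m1 - m2) (shear (\<zeta> * of_real m2) z) - \<phi> (shear (\<zeta> * of_real m2) z))"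
    by (rule sqnorm_compose[OF measure_preserving_shear sd, symmetric])
  also have "\<dots> = sqnorm (\<lambda>z. ?f m1 z - ?f m2 z)"
    by (simp add: shear_shear algebra_simps)
  finally show thesis using that[of "m1 - m2"] m2(1) le by simp
qed

text \<open>Shears in the same direction commute, so averaging inherits almost invariance.\<close>

lemma average_shear_diff:
  assumes \<phi>: "sqint \<phi>"
  shows "sqnorm (\<lambda>z. average \<zeta> \<phi> (shear c z) - average \<zeta> \<phi> z) \<le> sqnorm (\<lambda>z. \<phi> (shear c z) - \<phi> z)"
proof -
  have s: "sqint (\<lambda>z. \<phi> (shear c z))" by (rule sqint_compose[OF measure_preserving_shear \<phi>])
  have "(\<lambda>z. average \<zeta> \<phi> (shear c z) - average \<zeta> \<phi> z) = average \<zeta> (\<lambda>z. \<phi> (shear c z) - \<phi> z)"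
  proof
    fix z
    have "average \<zeta> \<phi> (shear c z) = (\<integral>m. \<phi> (shear c (shear (\<zeta> * of_real m) z)) \<partial>\<mu>)"
      by (simp add: average_def shear_shear add.commute)
    then show "average \<zeta> \<phi> (shear c z) - average \<zeta> \<phi> z = average \<zeta> (\<lambda>z. \<phi> (shear c z) - \<phi> z) z"
      using integrable_mass(1)[OF s, of \<zeta> z] integrable_mass(1)[OF \<phi>, of \<zeta> z]
      unfolding average_def by simp
  qed
  then show ?thesis using sqnorm_average_le[OF sqint_diff[OF s \<phi>], of \<zeta>] by simp
qed

text \<open>The averaged Koopman operator of one random transfer matrix: the expectation of \<phi>
  at the image of z, across one mass and one spring.\<close>

definition transfer_op :: "complex \<Rightarrow> (complex \<times> complex \<Rightarrow> real) \<Rightarrow> complex \<times> complex \<Rightarrow> real" where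
  "transfer_op \<zeta> \<phi> = average \<zeta> (\<lambda>z. \<phi> (coshear \<zeta> z))"

lemma sqint_transfer: "sqint \<phi> \<Longrightarrow> sqint (transfer_op \<zeta> \<phi>)"
  unfolding transfer_op_def by (rule sqint_average[OF sqint_compose[OF measure_preserving_coshear]])

lemma sqnorm_transfer_le:
  assumes "sqint \<phi>"
  shows "sqnorm (transfer_op \<zeta> \<phi>) \<le> sqnorm \<phi>"
  using sqnorm_average_le[OF sqint_compose[OF measure_preserving_coshear assms], of \<zeta> \<zeta>]
    sqnorm_compose[OF measure_preserving_coshear assms, of \<zeta>]
  by (simp add: transfer_op_def)

text \<open>Averaging almost preserves the norm only of functions with little mass in a cone, and the
  coshear maps the complement of the cone into the cone. Hence two averages, separated by a coshear,
  decrease the norm by a definite factor.\<close>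

lemma transfer_contraction:
  assumes \<phi>: "sqint \<phi>" and \<zeta>: "\<zeta> \<noteq> 0" and k: "6 \<le> real k * d0 * (cmod \<zeta>)\<^sup>2"
  shows "sqnorm (transfer_op \<zeta> (transfer_op \<zeta> \<phi>)) \<le> (1 - 1 / (4500 * (real k)\<^sup>2)) * sqnorm \<phi>"
proof (rule ccontr)
  \<comment> \<open>The 3 gives the covering \<open>sub\<close> below: if neither z nor its coshear
    were in the cone, then |\<zeta> snd z| \<le> 2 |snd z| / L, which is only 2/3 of it. It also
    accounts for the 6 = 2 * 3 in the hypothesis on k.\<close>
  define L where "L = 3 / cmod \<zeta>"
  define \<psi> where "\<psi> = (\<lambda>z. \<phi> (coshear \<zeta> z))"
  define h where "h = average \<zeta> \<psi>"
  define f where "f = (\<lambda>z. h (coshear \<zeta> z))"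
  \<comment> \<open>The 4500 keeps the error 35/2 * 16 / 4500 = 280/4500 below 1/16, so that each
    cone carries at most 5/16 + 1/16 = 3/8 of the norm.\<close>
  define e where "e = 1 / (4500 * (real k)\<^sup>2) * sqnorm \<psi>"
  have \<psi>: "sqint \<psi>" unfolding \<psi>_def by (rule sqint_compose[OF measure_preserving_coshear \<phi>])
  have h: "sqint h" unfolding h_def by (rule sqint_average[OF \<psi>])
  have f: "sqint f" unfolding f_def by (rule sqint_compose[OF measure_preserving_coshear h])
  have n\<psi>: "sqnorm \<psi> = sqnorm \<phi>" unfolding \<psi>_def by (rule sqnorm_compose[OF measure_preserving_coshear \<phi>])
  have nf: "sqnorm f = sqnorm h" unfolding f_def by (rule sqnorm_compose[OF measure_preserving_coshear h])
  assume "\<not> ?thesis"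
  then have big: "sqnorm \<psi> - e < sqnorm (average \<zeta> f)"
    unfolding transfer_op_def \<psi>_def[symmetric] h_def[symmetric] f_def[symmetric]
    by (simp add: n\<psi> e_def algebra_simps)
  have af: "sqnorm (average \<zeta> f) \<le> sqnorm f" by (rule sqnorm_average_le[OF f])
  have hp: "sqnorm h \<le> sqnorm \<psi>" unfolding h_def by (rule sqnorm_average_le[OF \<psi>])
  have k0: "1 \<le> real k"
  proof (cases "k = 0")
    case True
    then show ?thesis using k by simp
  qed simp
  have "0 < sqnorm \<psi>"
  proof (rule ccontr)
    assume "\<not> ?thesis"
    then have "sqnorm \<psi> = 0" using sqnorm_nonneg[of \<psi>] by simp
    then show False using big af hp nf by (simp add: e_def)
  qed
  then have e: "0 < e" using k0 by (simp add: e_def)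
  have e_le: "e \<le> sqnorm \<psi> / 10"
  proof -
    have "1 \<le> (real k)\<^sup>2" using k0 by (simp add: one_le_power)
    then have "1 / (4500 * (real k)\<^sup>2) \<le> 1 / 10" by (intro frac_le) auto
    from mult_right_mono[OF this, of "sqnorm \<psi>"] show ?thesis using \<open>0 < sqnorm \<psi>\<close> by (simp add: e_def)
  qed
  have cone_k: "2 * L \<le> real k * cmod (\<zeta> * of_real d)" if "d0 \<le> \<bar>d\<bar>" for d
  proof -
    have "6 \<le> real k * \<bar>d\<bar> * (cmod \<zeta>)\<^sup>2"
      by (rule order_trans[OF k]) (use that in \<open>auto intro!: mult_right_mono mult_left_mono\<close>)
    then show ?thesis using \<zeta> by (simp add: L_def norm_mult field_simps power2_eq_square)
  qed
  have mass: "(\<integral>z. indicator (cone L) z * (g z)\<^sup>2 \<partial>lborel) \<le> 3 / 8 * sqnorm \<psi>"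
    if "sqint g" "sqnorm g \<le> sqnorm \<psi>" "d0 \<le> \<bar>d\<bar>" "sqnorm (\<lambda>z. g (shear (\<zeta> * of_real d) z) - g z) \<le> 16 * e" for g d
  proof -
    have "(\<integral>z. indicator (cone L) z * (g z)\<^sup>2 \<partial>lborel) \<le>
        5 / 16 * sqnorm g + 35 / 2 * (real k)\<^sup>2 * sqnorm (\<lambda>z. g (shear (\<zeta> * of_real d) z) - g z)"
      by (rule cone_mass[OF that(1) cone_k[OF that(3)]])
    also have "\<dots> \<le> 5 / 16 * sqnorm \<psi> + 35 / 2 * (real k)\<^sup>2 * (16 * e)"
      using that by (intro add_mono mult_left_mono) auto
    also have "35 / 2 * (real k)\<^sup>2 * (16 * e) = 280 / 4500 * sqnorm \<psi>"
      using k0 by (simp add: e_def)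
    finally show ?thesis using \<open>0 < sqnorm \<psi>\<close> by simp
  qed
  obtain d1 where d1: "d0 \<le> \<bar>d1\<bar>" "sqnorm (\<lambda>z. \<psi> (shear (\<zeta> * of_real d1) z) - \<psi> z) \<le> 16 * e"
    by (rule near_invariance[OF \<psi> e, of \<zeta>]) (use big af nf in \<open>simp add: h_def\<close>)
  \<comment> \<open>The shear that almost fixes \<psi> almost fixes its average h as well, so h has
    little mass in the cone; f has little mass there because the second average loses
    little.\<close>
  have mh: "(\<integral>z. indicator (cone L) z * (h z)\<^sup>2 \<partial>lborel) \<le> 3 / 8 * sqnorm \<psi>"
    by (rule mass[OF h hp d1(1)])
      (use average_shear_diff[OF \<psi>, of \<zeta> "\<zeta> * of_real d1"] d1(2) in \<open>simp add: h_def\<close>)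
  obtain d2 where d2: "d0 \<le> \<bar>d2\<bar>" "sqnorm (\<lambda>z. f (shear (\<zeta> * of_real d2) z) - f z) \<le> 16 * e"
    by (rule near_invariance[OF f e, of \<zeta>]) (use big hp nf in simp)
  have mf: "(\<integral>z. indicator (cone L) z * (f z)\<^sup>2 \<partial>lborel) \<le> 3 / 8 * sqnorm \<psi>"
    by (rule mass[OF f _ d2]) (use hp nf in simp)
  have sub: "z \<in> cone L \<or> coshear \<zeta> z \<in> cone L" if "z \<noteq> 0" for z
  proof (rule ccontr)
    assume "\<not> ?thesis"
    then have 1: "L * cmod (fst z) \<le> cmod (snd z)" and 2: "L * cmod (fst z + \<zeta> * snd z) \<le> cmod (snd z)"
      by (auto simp: cone_def coshear_def not_less)
    have "L * cmod (\<zeta> * snd z) \<le> L * (cmod (fst z + \<zeta> * snd z) + cmod (fst z))"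
      using norm_triangle_ineq4[of "fst z + \<zeta> * snd z" "fst z"] \<zeta> by (intro mult_left_mono) (auto simp: L_def)
    also have "\<dots> \<le> 2 * cmod (snd z)" using 1 2 by (simp add: distrib_left)
    finally have "3 * cmod (snd z) \<le> 2 * cmod (snd z)" using \<zeta> by (simp add: L_def norm_mult)
    then have "snd z = 0" by simp
    moreover from this have "fst z = 0" using 1 \<zeta> by (simp add: L_def divide_le_0_iff mult_le_0_iff)
    ultimately show False using that by (simp add: prod_eq_iff)
  qed
  have [measurable]: "h \<in> borel_measurable borel" "f \<in> borel_measurable borel" using h f by (auto simp: sqint_def)
  have ih: "integrable lborel (\<lambda>z. indicator (cone L) z * (h z)\<^sup>2)"
    using sqint_integrable[OF h] by (subst mult.commute) (auto intro!: integrable_real_mult_indicator)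
  have if': "integrable lborel (\<lambda>z. indicator (cone L) z * (f z)\<^sup>2)"
    using sqint_integrable[OF f] by (subst mult.commute) (auto intro!: integrable_real_mult_indicator)
  have ihc: "integrable lborel (\<lambda>z. indicator (cone L) (coshear \<zeta> z) * (f z)\<^sup>2)"
    using integrable_measure_preserving[OF measure_preserving_coshear _ ih, of \<zeta>] by (simp add: f_def)
  have "sqnorm f \<le> (\<integral>z. indicator (cone L) z * (f z)\<^sup>2 + indicator (cone L) (coshear \<zeta> z) * (f z)\<^sup>2 \<partial>lborel)"
    unfolding sqnorm_def
  proof (rule integral_mono_AE)
    have "AE z in lborel. z \<noteq> (0 :: complex \<times> complex)" by (rule AE_lborel_singleton)
    then show "AE z in lborel. (f z)\<^sup>2 \<le> indicator (cone L) z * (f z)\<^sup>2 + indicator (cone L) (coshear \<zeta> z) * (f z)\<^sup>2"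
      by eventually_elim (use sub in \<open>fastforce split: split_indicator\<close>)
  qed (use sqint_integrable[OF f] if' ihc in auto)
  also have "\<dots> = (\<integral>z. indicator (cone L) z * (f z)\<^sup>2 \<partial>lborel) + (\<integral>z. indicator (cone L) (coshear \<zeta> z) * (f z)\<^sup>2 \<partial>lborel)"
    using if' ihc by simp
  also have "(\<integral>z. indicator (cone L) (coshear \<zeta> z) * (f z)\<^sup>2 \<partial>lborel) = (\<integral>z. indicator (cone L) z * (h z)\<^sup>2 \<partial>lborel)"
    using integral_measure_preserving[OF measure_preserving_coshear, of "\<lambda>z. indicator (cone L) z * (h z)\<^sup>2" \<zeta>]
    by (simp add: f_def)
  finally have "sqnorm f \<le> 3 / 4 * sqnorm \<psi>" using mf mh by simp
  \<comment> \<open>The two cone masses bound the norm of f by 3/4, whereas the small loss assumed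
    forces at least 9/10 of the norm of \<psi>.\<close>
  then show False using big af e_le \<open>0 < sqnorm \<psi>\<close> by simp
qed

lemma sqint_transfer_pow: "sqint \<phi> \<Longrightarrow> sqint ((transfer_op \<zeta> ^^ l) \<phi>)"
  by (induction l) (simp_all add: sqint_transfer)

lemma transfer_pow_decay:
  assumes \<phi>: "sqint \<phi>" and \<zeta>: "\<zeta> \<noteq> 0" and k: "6 \<le> real k * d0 * (cmod \<zeta>)\<^sup>2"
  shows "sqnorm ((transfer_op \<zeta> ^^ (2 * q)) \<phi>) \<le> (1 - 1 / (4500 * (real k)\<^sup>2)) ^ q * sqnorm \<phi>"
proof (induction q)
  case (Suc q)
  have "1 \<le> (real k)\<^sup>2"
    using k by (cases "k = 0") (simp_all add: one_le_power)
  then have "1 / (4500 * (real k)\<^sup>2) \<le> 1 / 1" by (intro frac_le) auto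
  then have r: "0 \<le> 1 - 1 / (4500 * (real k)\<^sup>2)" by simp
  have "sqnorm ((transfer_op \<zeta> ^^ (2 * Suc q)) \<phi>) = sqnorm (transfer_op \<zeta> (transfer_op \<zeta> ((transfer_op \<zeta> ^^ (2 * q)) \<phi>)))"
    by simp
  also have "\<dots> \<le> (1 - 1 / (4500 * (real k)\<^sup>2)) * sqnorm ((transfer_op \<zeta> ^^ (2 * q)) \<phi>)"
    by (rule transfer_contraction[OF sqint_transfer_pow[OF \<phi>] \<zeta> k])
  also have "\<dots> \<le> (1 - 1 / (4500 * (real k)\<^sup>2)) * ((1 - 1 / (4500 * (real k)\<^sup>2)) ^ q * sqnorm \<phi>)"
    by (intro mult_left_mono Suc r)
  finally show ?case by (simp add: mult.assoc)
qed simp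

end

section \<open>Overlap of transfer matrices with the unit polydisc\<close>

definition step :: "complex \<Rightarrow> real \<Rightarrow> complex \<times> complex \<Rightarrow> complex \<times> complex" where
  "step \<zeta> m z = coshear \<zeta> (shear (\<zeta> * of_real m) z)"

fun orbit :: "complex \<Rightarrow> (nat \<Rightarrow> real) \<Rightarrow> nat \<Rightarrow> nat \<Rightarrow> complex \<times> complex \<Rightarrow> complex \<times> complex" where
  "orbit \<zeta> m x 0 z = z"
| "orbit \<zeta> m x (Suc l) z = step \<zeta> (m (x + Suc l)) (orbit \<zeta> m x l z)"

lemma orbit_cong:
  "(\<And>y. y \<in> {x + 1..x + l} \<Longrightarrow> m y = m' y) \<Longrightarrow> orbit \<zeta> m x l z = orbit \<zeta> m' x l z"
  by (induction l) auto

lemma measurable_step: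
  assumes [measurable]: "f \<in> borel_measurable N" "g \<in> N \<rightarrow>\<^sub>M borel"
  shows "(\<lambda>w. step \<zeta> (f w) (g w)) \<in> N \<rightarrow>\<^sub>M borel"
proof -
  have "(\<lambda>p. step \<zeta> (fst p) (snd p)) \<in> borel_measurable borel"
    unfolding step_def shear_def coshear_def by (intro borel_measurable_continuous_onI continuous_intros)
  moreover have "(\<lambda>w. (f w, g w)) \<in> borel_measurable N" by measurable
  ultimately have "(\<lambda>w. step \<zeta> (fst (f w, g w)) (snd (f w, g w))) \<in> borel_measurable N"
    by (rule measurable_compose[rotated])
  then show ?thesis by simp
qed

lemma measurable_orbit:
  assumes "\<And>y. y \<in> {x + 1..x + l} \<Longrightarrow> (\<lambda>w. m w y) \<in> borel_measurable N" and "g \<in> N \<rightarrow>\<^sub>M borel"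
  shows "(\<lambda>w. orbit \<zeta> (m w) x l (g w)) \<in> N \<rightarrow>\<^sub>M borel"
  using assms(1)
proof (induction l)
  case (Suc l)
  then show ?case
    unfolding orbit.simps by (intro measurable_step) auto
qed (use assms in simp)

definition site_weight :: "(nat \<Rightarrow> real) \<Rightarrow> nat \<Rightarrow> real" where
  "site_weight m i = (if odd i then m (Suc i div 2) else 1)"

lemma continuant_2: "continuant a i 2 = a i" and continuant_3: "continuant a i 3 = a (Suc i) * a i + 1"
  by (simp_all add: eval_nat_numeral)

text \<open>The matrix across l mass-spring pairs consists of the continuants of the block, complete
  or without its first or last site or both. This ties random products to the determinants in the
  Green function.\<close>

lemma orbit_continuant:
  fixes \<zeta> :: complex and m :: "nat \<Rightarrow> real"
  defines "K \<equiv> continuant (\<lambda>k. \<zeta> * site_weight m k)"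
  assumes "1 \<le> l"
  shows "orbit \<zeta> m x l (u, v) =
    (K (2 * x + 1) (2 * l + 1) * u + K (2 * x + 2) (2 * l) * v,
     K (2 * x + 1) (2 * l) * u + K (2 * x + 2) (2 * l - 1) * v)"
  using assms(2)
proof (induction l rule: dec_induct)
  case base
  have "site_weight m (Suc (2 * x)) = m (Suc x)" "site_weight m (Suc (Suc (2 * x))) = 1"
    by (simp_all add: site_weight_def)
  then show ?case
    by (simp add: K_def step_def shear_def coshear_def continuant_2 continuant_3 algebra_simps)
next
  case (step l)
  obtain j where l: "l = Suc j" using step(1) by (cases l) auto
  have w: "site_weight m (Suc (2 * x + 2 * l)) = m (x + Suc l)" "site_weight m (Suc (Suc (2 * x + 2 * l))) = 1"
    by (simp_all add: site_weight_def)
  have 1: "K (2 * x + 1) (2 * Suc l) = \<zeta> * m (x + Suc l) * K (2 * x + 1) (2 * l + 1) + K (2 * x + 1) (2 * l)"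
    using w(1) by (simp add: K_def l)
  have 2: "K (2 * x + 1) (2 * Suc l + 1) = \<zeta> * K (2 * x + 1) (2 * Suc l) + K (2 * x + 1) (2 * l + 1)"
    using w(2) by (simp add: K_def l)
  have 3: "K (2 * x + 2) (2 * Suc l - 1) = \<zeta> * m (x + Suc l) * K (2 * x + 2) (2 * l) + K (2 * x + 2) (2 * l - 1)"
    using w(1) by (simp add: K_def l)
  have 4: "K (2 * x + 2) (2 * Suc l) = \<zeta> * K (2 * x + 2) (2 * Suc l - 1) + K (2 * x + 2) (2 * l)"
    using w(2) by (simp add: K_def l)
  show ?case
    unfolding orbit.simps step.IH unfolding 2 4 unfolding 1 3
    by (simp add: step_def shear_def coshear_def algebra_simps)
qed

definition polydisc :: "real \<Rightarrow> (complex \<times> complex) set" where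
  "polydisc r = cball 0 r \<times> cball 0 r"

lemma measurable_polydisc [measurable]: "polydisc r \<in> sets borel"
  unfolding polydisc_def by (intro borel_closed closed_Times closed_cball)

lemma emeasure_polydisc:
  assumes "0 \<le> r"
  shows "emeasure lborel (polydisc r) = ennreal ((pi * r\<^sup>2)\<^sup>2)"
proof -
  have "emeasure lborel (polydisc r) = emeasure lborel (cball (0::complex) r) * emeasure lborel (cball (0::complex) r)"
    unfolding polydisc_def lborel_prod[symmetric] by (intro lborel.emeasure_pair_measure_Times) auto
  also have "emeasure lborel (cball (0::complex) r) = ennreal (pi * r\<^sup>2)"
    using assms unit_ball_vol_2 by (simp add: emeasure_cball)
  finally show ?thesis using assms by (simp add: ennreal_mult power2_eq_square)
qed

definition overlap :: "complex \<Rightarrow> (nat \<Rightarrow> real) \<Rightarrow> nat \<Rightarrow> nat \<Rightarrow> ennreal" where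
  "overlap \<zeta> m x l = (\<integral>\<^sup>+z. indicator (polydisc 1) z * indicator (polydisc 1) (orbit \<zeta> m x l z) \<partial>lborel)"

text \<open>All entries of the transfer matrix are comparable to the continuant of the block, because
  \<open>Re \<zeta> > 0\<close>; hence the block matrix maps a polydisc of inverse radius into the unit polydisc.\<close>

lemma overlap_lower_bound:
  fixes \<zeta> :: complex and m :: "nat \<Rightarrow> real" and x l :: nat and c :: real
  assumes c: "0 < c" and Re: "\<And>k. c \<le> Re (\<zeta> * site_weight m k)" and c1: "c \<le> 1" and l: "1 \<le> l"
  defines "r \<equiv> min 1 (c\<^sup>2 / (2 * cmod (continuant (\<lambda>k. \<zeta> * site_weight m k) (2 * x + 1) (2 * l + 1))))"
  shows "ennreal ((pi * r\<^sup>2)\<^sup>2) \<le> overlap \<zeta> m x l"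
proof -
  let ?K = "continuant (\<lambda>k. \<zeta> * site_weight m k)"
  let ?b = "2 * x + 1"
  define D where "D = cmod (?K ?b (2 * l + 1))"
  obtain j where j: "l = Suc j" using l by (cases l) auto
  have D: "0 < D"
    using continuant_nonzero[where a = "\<lambda>k. \<zeta> * of_real (site_weight m k)" and i = "?b" and n = "2 * l", OF c Re] by (simp add: D_def)
  \<comment> \<open>Every entry of the matrix is at most D / c^2, so entries times coordinates of
    size r are at most 1/2, and the two terms of each image coordinate add up to at most 1. The
    minimum with 1 keeps the small polydisc inside the unit one.\<close>
  have r: "0 < r" "r \<le> 1" "r * D \<le> c\<^sup>2 / 2"
    using D c unfolding r_def D_def[symmetric] by (auto simp: min_def field_simps)
  have b1: "c * cmod (?K ?b (2 * l)) \<le> D"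
    using norm_continuant_right[where a = "\<lambda>k. \<zeta> * of_real (site_weight m k)" and i = "?b" and n = "2 * l", OF c Re] by (simp add: D_def)
  have b2: "c * cmod (?K (2 * x + 2) (2 * l)) \<le> D"
    using norm_continuant_left[where a = "\<lambda>k. \<zeta> * of_real (site_weight m k)" and i = "?b" and n = "2 * l", OF c Re] by (simp add: D_def)
  have "c * cmod (?K (2 * x + 2) (2 * l - 1)) \<le> cmod (?K ?b (2 * l))"
    using norm_continuant_left[where a = "\<lambda>k. \<zeta> * of_real (site_weight m k)" and i = "?b" and n = "2 * l - 1", OF c Re] by (simp add: j del: continuant.simps)
  then have "c * (c * cmod (?K (2 * x + 2) (2 * l - 1))) \<le> c * cmod (?K ?b (2 * l))"
    using c by (intro mult_left_mono) auto
  then have b3: "c\<^sup>2 * cmod (?K (2 * x + 2) (2 * l - 1)) \<le> D"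
    using b1 unfolding power2_eq_square mult.assoc by (rule order_trans)
  have sq: "c\<^sup>2 * y \<le> D" if "c * y \<le> D" "0 \<le> y" for y
  proof -
    have "c * (c * y) \<le> 1 * (c * y)" using c c1 that by (intro mult_right_mono) auto
    then show ?thesis using that by (simp add: power2_eq_square mult.assoc)
  qed
  have bb: "c\<^sup>2 * cmod (?K ?b (2 * l + 1)) \<le> D" "c\<^sup>2 * cmod (?K ?b (2 * l)) \<le> D"
    "c\<^sup>2 * cmod (?K (2 * x + 2) (2 * l)) \<le> D"
  proof -
    have "c\<^sup>2 \<le> 1" using c c1 by (simp add: power_le_one)
    then show "c\<^sup>2 * cmod (?K ?b (2 * l + 1)) \<le> D"
      using D mult_right_mono[of "c\<^sup>2" 1 D] by (simp only: D_def[symmetric]) simp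
  qed (use sq[OF b1] sq[OF b2] in simp_all)
  have small: "cmod (p * u + q * v) \<le> 1"
    if "c\<^sup>2 * cmod p \<le> D" "c\<^sup>2 * cmod q \<le> D" "cmod u \<le> r" "cmod v \<le> r" for p q u v
  proof -
    have "c\<^sup>2 * cmod (p * u) \<le> c\<^sup>2 / 2" if "c\<^sup>2 * cmod p \<le> D" "cmod u \<le> r" for p u
    proof -
      have "c\<^sup>2 * cmod (p * u) = (c\<^sup>2 * cmod p) * cmod u" by (simp add: norm_mult)
      also have "\<dots> \<le> D * r" using that D r by (intro mult_mono) auto
      finally show ?thesis using r by (simp add: mult.commute)
    qed
    then have "c\<^sup>2 * cmod (p * u) \<le> c\<^sup>2 / 2" "c\<^sup>2 * cmod (q * v) \<le> c\<^sup>2 / 2" using that by blast+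
    then have "c\<^sup>2 * (cmod (p * u) + cmod (q * v)) \<le> c\<^sup>2 * 1" by (simp add: distrib_left)
    then have "cmod (p * u) + cmod (q * v) \<le> 1" using c by (subst (asm) mult_le_cancel_left_pos) auto
    then show ?thesis using norm_triangle_ineq[of "p * u" "q * v"] by linarith
  qed
  have sub: "indicator (polydisc r) z \<le> (indicator (polydisc 1) z * indicator (polydisc 1) (orbit \<zeta> m x l z) :: ennreal)" for z
  proof (cases "z \<in> polydisc r")
    case True
    obtain u v where z: "z = (u, v)" by (cases z)
    have uv: "cmod u \<le> r" "cmod v \<le> r" using True by (auto simp: z polydisc_def)
    have "orbit \<zeta> m x l z \<in> polydisc 1"
      unfolding z orbit_continuant[OF l] polydisc_def
      using small[OF bb(1,3) uv] small[OF bb(2) b3 uv] by (simp del: continuant.simps)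
    moreover have "z \<in> polydisc 1" using uv r by (auto simp: z polydisc_def)
    ultimately show ?thesis using True by simp
  qed simp
  have "ennreal ((pi * r\<^sup>2)\<^sup>2) = (\<integral>\<^sup>+z. indicator (polydisc r) z \<partial>lborel)"
    using emeasure_polydisc[of r] r by simp
  also have "\<dots> \<le> overlap \<zeta> m x l"
    unfolding overlap_def by (intro nn_integral_mono sub)
  finally show ?thesis .
qed

lemma sqint_polydisc: "sqint (indicator (polydisc 1))" and sqnorm_polydisc: "sqnorm (indicator (polydisc 1)) = pi\<^sup>2"
proof -
  have sq: "(indicator (polydisc 1) z)\<^sup>2 = (indicator (polydisc 1) z :: real)" for z
    by (simp add: indicator_def)
  have e: "emeasure lborel (polydisc 1) = ennreal (pi\<^sup>2)" using emeasure_polydisc[of 1] by simp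
  have "integrable lborel (indicator (polydisc 1) :: complex \<times> complex \<Rightarrow> real)"
    using e by (intro integrable_real_indicator) auto
  then show "sqint (indicator (polydisc 1))"
    unfolding sqint_def sq by (auto intro!: exI[of _ 1])
  show "sqnorm (indicator (polydisc 1)) = pi\<^sup>2"
    unfolding sqnorm_def sq using e by (simp add: measure_def)
qed

section \<open>Averages over independent masses\<close>

context mass_law
begin

lemma transfer_op_nonneg: "(\<And>z. 0 \<le> \<phi> z) \<Longrightarrow> 0 \<le> transfer_op \<zeta> \<phi> z"
  unfolding transfer_op_def average_def by (intro integral_nonneg_AE) auto

lemma nn_integral_step:
  assumes "sqint \<phi>" "\<And>z. 0 \<le> \<phi> z"
  shows "(\<integral>\<^sup>+m. ennreal (\<phi> (step \<zeta> m z)) \<partial>\<mu>) = ennreal (transfer_op \<zeta> \<phi> z)"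
  unfolding step_def transfer_op_def average_def
  by (intro nn_integral_eq_integral integrable_mass(1)[OF sqint_compose[OF measure_preserving_coshear assms(1)]])
    (use assms in auto)

text \<open>The last mass is integrated first: given the others, it turns \<phi> into its transfer,
  and the remaining orbit is one step shorter.\<close>

lemma nn_integral_orbit_PiM:
  assumes "sqint \<phi>" "\<And>z. 0 \<le> \<phi> z"
  shows "(\<integral>\<^sup>+m. ennreal (\<phi> (orbit \<zeta> m x l z)) \<partial>PiM {x + 1..x + l} (\<lambda>_. \<mu>)) = ennreal ((transfer_op \<zeta> ^^ l) \<phi> z)"
  using assms
proof (induction l arbitrary: \<phi>)
  case 0
  interpret P: prob_space "PiM {x + 1..x + 0} (\<lambda>_. \<mu>)" by (intro prob_space_PiM prob_space_axioms)
  show ?case using P.emeasure_space_1 by simp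
next
  case (Suc l)
  interpret product_sigma_finite "\<lambda>_. \<mu>" by standard
  have ins: "{x + 1..x + Suc l} = insert (x + Suc l) {x + 1..x + l}" by auto
  have meas: "(\<lambda>m. orbit \<zeta> m x (Suc l) z) \<in> PiM {x + 1..x + Suc l} (\<lambda>_. \<mu>) \<rightarrow>\<^sub>M borel"
  proof (intro measurable_orbit)
    fix y assume "y \<in> {x + 1..x + Suc l}"
    then have "(\<lambda>m. m y) \<in> PiM {x + 1..x + Suc l} (\<lambda>_. \<mu>) \<rightarrow>\<^sub>M \<mu>"
      by (rule measurable_component_singleton)
    then show "(\<lambda>m. m y) \<in> borel_measurable (PiM {x + 1..x + Suc l} (\<lambda>_. \<mu>))"
      by (simp only: measurable_cong_sets[OF refl sets_mu])
  qed simp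
  have [measurable]: "\<phi> \<in> borel_measurable borel" using Suc.prems by (simp add: sqint_def)
  have meas': "(\<lambda>m. ennreal (\<phi> (orbit \<zeta> m x (Suc l) z))) \<in> borel_measurable (PiM {x + 1..x + Suc l} (\<lambda>_. \<mu>))"
    by (rule measurable_compose[OF meas]) measurable
  have "(\<integral>\<^sup>+m. ennreal (\<phi> (orbit \<zeta> m x (Suc l) z)) \<partial>PiM {x + 1..x + Suc l} (\<lambda>_. \<mu>)) =
      (\<integral>\<^sup>+m. (\<integral>\<^sup>+y. ennreal (\<phi> (orbit \<zeta> (m(x + Suc l := y)) x (Suc l) z)) \<partial>\<mu>) \<partial>PiM {x + 1..x + l} (\<lambda>_. \<mu>))"
    unfolding ins by (rule product_nn_integral_insert[OF _ _ meas'[unfolded ins]]) auto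
  also have "\<dots> = (\<integral>\<^sup>+m. ennreal (transfer_op \<zeta> \<phi> (orbit \<zeta> m x l z)) \<partial>PiM {x + 1..x + l} (\<lambda>_. \<mu>))"
  proof (intro nn_integral_cong)
    fix m :: "nat \<Rightarrow> real"
    have "orbit \<zeta> (m(x + Suc l := y)) x (Suc l) z = step \<zeta> y (orbit \<zeta> m x l z)" for y
      using orbit_cong[of x l "m(x + Suc l := y)" m \<zeta> z] by simp
    then show "(\<integral>\<^sup>+y. ennreal (\<phi> (orbit \<zeta> (m(x + Suc l := y)) x (Suc l) z)) \<partial>\<mu>) =
        ennreal (transfer_op \<zeta> \<phi> (orbit \<zeta> m x l z))"
      using nn_integral_step[OF Suc.prems] by (simp only:)
  qed
  also have "\<dots> = ennreal ((transfer_op \<zeta> ^^ l) (transfer_op \<zeta> \<phi>) z)"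
    by (rule Suc.IH) (use Suc.prems in \<open>auto intro: sqint_transfer transfer_op_nonneg\<close>)
  finally show ?case by (simp add: funpow_swap1)
qed

end

locale iid_mass_chain = mass_law \<mu> d0 + P: prob_space M
  for \<mu> d0 and M :: "'w measure" +
  fixes X :: "nat \<Rightarrow> 'w \<Rightarrow> real"
  assumes indep: "P.indep_vars (\<lambda>_. borel) X {1..}"
    and law: "\<And>x. 1 \<le> x \<Longrightarrow> distr M borel (X x) = \<mu>"
begin

lemma measurable_X: "1 \<le> x \<Longrightarrow> X x \<in> borel_measurable M"
  using indep unfolding P.indep_vars_def by auto

lemma nn_integral_orbit:
  assumes \<phi>: "sqint \<phi>" "\<And>z. 0 \<le> \<phi> z"
  shows "(\<integral>\<^sup>+\<omega>. ennreal (\<phi> (orbit \<zeta> (\<lambda>y. X y \<omega>) x l z)) \<partial>M) = ennreal ((transfer_op \<zeta> ^^ l) \<phi> z)"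
proof (cases "l = 0")
  case True
  then show ?thesis by (simp add: P.emeasure_space_1)
next
  case False
  let ?I = "{x + 1..x + l}"
  let ?X = "\<lambda>\<omega>. \<lambda>y\<in>?I. X y \<omega>"
  have rv: "X y \<in> borel_measurable M" if "y \<in> ?I" for y using that by (intro measurable_X) auto
  have "P.indep_vars (\<lambda>_. borel) X ?I" by (rule P.indep_vars_subset[OF indep]) auto
  then have "distr M (PiM ?I (\<lambda>_. borel)) ?X = PiM ?I (\<lambda>y. distr M borel (X y))"
    using False rv by (subst (asm) P.indep_vars_iff_distr_eq_PiM') auto
  also have "\<dots> = PiM ?I (\<lambda>_. \<mu>)" by (intro PiM_cong) (auto intro!: law)
  finally have eq: "distr M (PiM ?I (\<lambda>_. borel)) ?X = PiM ?I (\<lambda>_. \<mu>)" .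
  have [measurable]: "\<phi> \<in> borel_measurable borel" using \<phi> by (simp add: sqint_def)
  have meas: "(\<lambda>m. orbit \<zeta> m x l z) \<in> PiM ?I (\<lambda>_. borel) \<rightarrow>\<^sub>M borel"
    by (intro measurable_orbit measurable_component_singleton) auto
  have "ennreal ((transfer_op \<zeta> ^^ l) \<phi> z) = (\<integral>\<^sup>+m. ennreal (\<phi> (orbit \<zeta> m x l z)) \<partial>distr M (PiM ?I (\<lambda>_. borel)) ?X)"
    unfolding eq by (rule nn_integral_orbit_PiM[OF \<phi>, symmetric])
  also have "\<dots> = (\<integral>\<^sup>+\<omega>. ennreal (\<phi> (orbit \<zeta> (?X \<omega>) x l z)) \<partial>M)"
    using meas rv by (intro nn_integral_distr measurable_restrict) auto
  also have "\<dots> = (\<integral>\<^sup>+\<omega>. ennreal (\<phi> (orbit \<zeta> (\<lambda>y. X y \<omega>) x l z)) \<partial>M)"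
    by (intro nn_integral_cong arg_cong[where f = ennreal] arg_cong[where f = \<phi>] orbit_cong) auto
  finally show ?thesis ..
qed

lemma measurable_orbit_X:
  "(\<lambda>p. orbit \<zeta> (\<lambda>y. X y (fst p)) x l (snd p)) \<in> M \<Otimes>\<^sub>M lborel \<rightarrow>\<^sub>M borel"
  using measurable_X by (intro measurable_orbit) (auto intro!: measurable_compose[OF measurable_fst])

lemma measurable_overlap: "(\<lambda>\<omega>. overlap \<zeta> (\<lambda>y. X y \<omega>) x l) \<in> borel_measurable M"
proof -
  note measurable_orbit_X[measurable]
  show ?thesis
    unfolding overlap_def by (intro lborel.borel_measurable_nn_integral) measurable
qed

text \<open>By Fubini the expectation is the inner product of the indicator with its l-fold
  transfer, and contraction makes the latter small in L^2. Since two steps contract,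
  \<open>l div 2\<close> counts; an odd last step does not increase the norm.\<close>

lemma expected_overlap:
  assumes \<zeta>: "\<zeta> \<noteq> 0" and k: "6 \<le> real k * d0 * (cmod \<zeta>)\<^sup>2"
  shows "(\<integral>\<^sup>+\<omega>. overlap \<zeta> (\<lambda>y. X y \<omega>) x l \<partial>M) \<le>
    ennreal (pi\<^sup>2 * sqrt ((1 - 1 / (4500 * (real k)\<^sup>2)) ^ (l div 2)))"
proof -
  interpret pair_sigma_finite M lborel by standard
  let ?B = "indicator (polydisc 1) :: complex \<times> complex \<Rightarrow> real"
  let ?\<psi> = "(transfer_op \<zeta> ^^ l) ?B"
  define q where "q = 1 - 1 / (4500 * (real k)\<^sup>2)"
  define \<rho> where "\<rho> = sqrt (q ^ (l div 2))"
  have k0: "1 \<le> (real k)\<^sup>2"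
    using k by (cases "k = 0") (simp_all add: one_le_power)
  then have "1 / (4500 * (real k)\<^sup>2) \<le> 1 / 4500" by (intro frac_le) auto
  then have q: "0 < q" unfolding q_def by simp
  then have \<rho>: "0 < \<rho>" "\<rho>\<^sup>2 = q ^ (l div 2)" unfolding \<rho>_def by auto
  have s\<psi>: "sqint ?\<psi>" by (rule sqint_transfer_pow[OF sqint_polydisc])
  have n\<psi>: "sqnorm ?\<psi> \<le> \<rho>\<^sup>2 * pi\<^sup>2"
  proof -
    have "sqnorm ?\<psi> \<le> sqnorm ((transfer_op \<zeta> ^^ (2 * (l div 2))) ?B)"
    proof (cases "even l")
      case False
      then have "l = Suc (2 * (l div 2))" by simp
      then have "?\<psi> = transfer_op \<zeta> ((transfer_op \<zeta> ^^ (2 * (l div 2))) ?B)"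
        by (metis comp_apply funpow.simps(2))
      then show ?thesis using sqnorm_transfer_le[OF sqint_transfer_pow[OF sqint_polydisc]] by simp
    qed simp
    also have "\<dots> \<le> q ^ (l div 2) * pi\<^sup>2"
      using transfer_pow_decay[OF sqint_polydisc \<zeta> k, of "l div 2"] by (simp add: q_def sqnorm_polydisc)
    finally show ?thesis using \<rho> by simp
  qed
  note measurable_orbit_X[measurable]
  have [measurable]: "?\<psi> \<in> borel_measurable borel" using s\<psi> by (simp add: sqint_def)
  have "(\<integral>\<^sup>+\<omega>. overlap \<zeta> (\<lambda>y. X y \<omega>) x l \<partial>M) =
      (\<integral>\<^sup>+z. (\<integral>\<^sup>+\<omega>. indicator (polydisc 1) z * indicator (polydisc 1) (orbit \<zeta> (\<lambda>y. X y \<omega>) x l z) \<partial>M) \<partial>lborel)"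
    unfolding overlap_def by (rule Fubini'[symmetric]) (simp add: split_beta', measurable)
  also have "\<dots> = (\<integral>\<^sup>+z. ennreal (?B z * ?\<psi> z) \<partial>lborel)"
  proof (intro nn_integral_cong)
    fix z
    have "(\<lambda>\<omega>. orbit \<zeta> (\<lambda>y. X y \<omega>) x l z) \<in> M \<rightarrow>\<^sub>M borel"
      using measurable_X by (intro measurable_orbit) auto
    then have [measurable]: "(\<lambda>\<omega>. indicator (polydisc 1) (orbit \<zeta> (\<lambda>y. X y \<omega>) x l z) :: ennreal) \<in> borel_measurable M"
      by measurable
    have "(\<integral>\<^sup>+\<omega>. indicator (polydisc 1) z * indicator (polydisc 1) (orbit \<zeta> (\<lambda>y. X y \<omega>) x l z) \<partial>M) =
        indicator (polydisc 1) z * (\<integral>\<^sup>+\<omega>. ennreal (?B (orbit \<zeta> (\<lambda>y. X y \<omega>) x l z)) \<partial>M)"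
      by (subst nn_integral_cmult) (auto simp: ennreal_indicator)
    also have "\<dots> = indicator (polydisc 1) z * ennreal (?\<psi> z)"
      by (subst nn_integral_orbit[OF sqint_polydisc]) auto
    also have "\<dots> = ennreal (?B z * ?\<psi> z)"
      by (simp add: indicator_def)
    finally show "(\<integral>\<^sup>+\<omega>. indicator (polydisc 1) z * indicator (polydisc 1) (orbit \<zeta> (\<lambda>y. X y \<omega>) x l z) \<partial>M) = ennreal (?B z * ?\<psi> z)" .
  qed
  \<comment> \<open>Cauchy-Schwarz in the form of Young's inequality, weighted by the known decay
    factor \<rho>; both halves become \<rho> pi^2 / 2.\<close>
  also have "\<dots> \<le> (\<integral>\<^sup>+z. ennreal (\<rho> / 2 * (?B z)\<^sup>2 + 1 / (2 * \<rho>) * (?\<psi> z)\<^sup>2) \<partial>lborel)"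
  proof (intro nn_integral_mono ennreal_leI)
    fix z
    have "\<rho> * 2 * (?B z * ?\<psi> z) \<le> \<rho>\<^sup>2 * (?B z)\<^sup>2 + (?\<psi> z)\<^sup>2"
      using sum_squares_bound[of "\<rho> * ?B z" "?\<psi> z"] by (simp add: power_mult_distrib mult_ac)
    then show "?B z * ?\<psi> z \<le> \<rho> / 2 * (?B z)\<^sup>2 + 1 / (2 * \<rho>) * (?\<psi> z)\<^sup>2"
      using \<rho>(1) by (simp add: field_simps power2_eq_square)
  qed
  also have "\<dots> = ennreal (\<integral>z. \<rho> / 2 * (?B z)\<^sup>2 + 1 / (2 * \<rho>) * (?\<psi> z)\<^sup>2 \<partial>lborel)"
    using sqint_integrable[OF sqint_polydisc] sqint_integrable[OF s\<psi>] \<rho>(1)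
    by (intro nn_integral_eq_integral) auto
  also have "(\<integral>z. \<rho> / 2 * (?B z)\<^sup>2 + 1 / (2 * \<rho>) * (?\<psi> z)\<^sup>2 \<partial>lborel) = \<rho> / 2 * pi\<^sup>2 + 1 / (2 * \<rho>) * sqnorm ?\<psi>"
    using sqint_integrable[OF sqint_polydisc] sqint_integrable[OF s\<psi>] sqnorm_polydisc
    by (simp add: sqnorm_def)
  also have "\<rho> / 2 * pi\<^sup>2 + 1 / (2 * \<rho>) * sqnorm ?\<psi> \<le> \<rho> / 2 * pi\<^sup>2 + 1 / (2 * \<rho>) * (\<rho>\<^sup>2 * pi\<^sup>2)"
    using n\<psi> \<rho>(1) by (intro add_left_mono mult_left_mono) auto
  also have "\<dots> = pi\<^sup>2 * \<rho>" using \<rho>(1) by (simp add: power2_eq_square)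
  finally show ?thesis unfolding \<rho>_def q_def by (simp add: ennreal_leI)
qed

end

section \<open>Second moments in the local Gibbs state\<close>

lemma PiM_density:
  fixes f :: "'i \<Rightarrow> 'a \<Rightarrow> ennreal" and L :: "'a measure"
  assumes "sigma_finite_measure L" and I: "finite I"
    and f [measurable]: "\<And>i. f i \<in> borel_measurable L"
    and prob: "\<And>i. prob_space (density L (f i))"
  shows "PiM I (\<lambda>i. density L (f i)) = density (PiM I (\<lambda>_. L)) (\<lambda>x. \<Prod>i\<in>I. f i (x i))"
proof -
  interpret L: sigma_finite_measure L by fact
  interpret pL: product_sigma_finite "\<lambda>_. L" by standard
  interpret D: product_prob_space "\<lambda>i. density L (f i)"
    using prob by (intro product_prob_spaceI)
  have meas: "(\<lambda>x. \<Prod>i\<in>I. f i (x i)) \<in> borel_measurable (PiM I (\<lambda>_. L))"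
  proof (intro borel_measurable_prod_ennreal)
    fix i assume "i \<in> I"
    then have "(\<lambda>x. x i) \<in> PiM I (\<lambda>_. L) \<rightarrow>\<^sub>M L" by (rule measurable_component_singleton)
    then show "(\<lambda>x. f i (x i)) \<in> borel_measurable (PiM I (\<lambda>_. L))" by (rule measurable_compose[OF _ f])
  qed
  show ?thesis
  proof (rule D.PiM_eqI[OF I, symmetric])
    show "sets (density (PiM I (\<lambda>_. L)) (\<lambda>x. \<Prod>i\<in>I. f i (x i))) = sets (PiM I (\<lambda>i. density L (f i)))"
      by (simp, intro sets_PiM_cong) auto
    fix A assume A: "\<And>i. i \<in> I \<Longrightarrow> A i \<in> sets (density L (f i))"
    have ind: "indicator (PiE I A) x = (\<Prod>i\<in>I. indicator (A i) (x i) :: ennreal)" if xs: "x \<in> space (PiM I (\<lambda>_. L))" for x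
    proof (cases "x \<in> PiE I A")
      case False
      then obtain i where "i \<in> I" "x i \<notin> A i" using xs by (auto simp: PiE_iff space_PiM)
      then show ?thesis using False I by (auto simp: prod_zero_iff intro!: bexI[of _ i])
    next
      case True
      then show ?thesis by (auto simp: PiE_iff intro!: prod.neutral[symmetric])
    qed
    have "emeasure (density (PiM I (\<lambda>_. L)) (\<lambda>x. \<Prod>i\<in>I. f i (x i))) (PiE I A) =
        (\<integral>\<^sup>+x. (\<Prod>i\<in>I. f i (x i)) * indicator (PiE I A) x \<partial>PiM I (\<lambda>_. L))"
      using A I by (intro emeasure_density meas sets_PiM_I_finite) auto
    also have "\<dots> = (\<integral>\<^sup>+x. (\<Prod>i\<in>I. f i (x i) * indicator (A i) (x i)) \<partial>PiM I (\<lambda>_. L))"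
      by (intro nn_integral_cong) (simp add: ind prod.distrib)
    also have "\<dots> = (\<Prod>i\<in>I. \<integral>\<^sup>+y. f i y * indicator (A i) y \<partial>L)"
      using A by (intro pL.product_nn_integral_prod I) auto
    also have "\<dots> = (\<Prod>i\<in>I. emeasure (density L (f i)) (A i))"
      using A by (intro prod.cong refl) (auto simp: emeasure_density)
    finally show "emeasure (density (PiM I (\<lambda>_. L)) (\<lambda>x. \<Prod>i\<in>I. f i (x i))) (PiE I A) =
      (\<Prod>i\<in>I. emeasure (density L (f i)) (A i))" .
  qed
qed

lemma PiM_linear_moments:
  fixes \<nu> :: "nat \<Rightarrow> real measure" and c \<mu> v :: "nat \<Rightarrow> real"
  assumes prob: "\<And>i. prob_space (\<nu> i)" and sets: "\<And>i. sets (\<nu> i) = sets borel" and I: "finite I"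
    and int1: "\<And>i. integrable (\<nu> i) (\<lambda>x. x - \<mu> i)" and int2: "\<And>i. integrable (\<nu> i) (\<lambda>x. (x - \<mu> i)\<^sup>2)"
    and mean: "\<And>i. (\<integral>x. x - \<mu> i \<partial>\<nu> i) = 0" and var: "\<And>i. (\<integral>x. (x - \<mu> i)\<^sup>2 \<partial>\<nu> i) = v i"
  defines "a \<equiv> \<lambda>x. \<Sum>i\<in>I. c i * (x i - \<mu> i)"
  shows "integrable (PiM I \<nu>) a" "integrable (PiM I \<nu>) (\<lambda>x. (a x)\<^sup>2)"
    "(\<integral>x. a x \<partial>PiM I \<nu>) = 0" "(\<integral>x. (a x)\<^sup>2 \<partial>PiM I \<nu>) = (\<Sum>i\<in>I. (c i)\<^sup>2 * v i)"
proof -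
  interpret product_prob_space \<nu> using prob by (intro product_prob_spaceI)
  have one: "integrable (PiM I \<nu>) (\<lambda>x. h (x i))" "(\<integral>x. h (x i) \<partial>PiM I \<nu>) = (\<integral>y. h y \<partial>\<nu> i)"
    if i: "i \<in> I" and h: "integrable (\<nu> i) h" for i and h :: "real \<Rightarrow> real"
  proof -
    have d: "distr (PiM I \<nu>) (\<nu> i) (\<lambda>x. x i) = \<nu> i"
      by (rule distr_PiM_component[OF prob i])
    have m: "(\<lambda>x. x i) \<in> PiM I \<nu> \<rightarrow>\<^sub>M \<nu> i" using i by measurable
    show "integrable (PiM I \<nu>) (\<lambda>x. h (x i))"
      using integrable_distr[OF m, of h] h d by simp
    show "(\<integral>x. h (x i) \<partial>PiM I \<nu>) = (\<integral>y. h y \<partial>\<nu> i)"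
      using integral_distr[OF m, of h] h d by simp
  qed
  have two: "integrable (PiM I \<nu>) (\<lambda>x. (x i - \<mu> i) * (x j - \<mu> j)) \<and>
      (\<integral>x. (x i - \<mu> i) * (x j - \<mu> j) \<partial>PiM I \<nu>) = (if i = j then v i else 0)"
    if ij: "i \<in> I" "j \<in> I" for i j
  proof (cases "i = j")
    case True
    then show ?thesis
      using one[OF ij(1) int2] var by (simp add: power2_eq_square)
  next
    case False
    \<comment> \<open>The cross term is a product over all coordinates, with 1 at the indifferent
      ones; its integral contains the factor with mean 0.\<close>
    define F where "F k y = (if k = i then y - \<mu> i else if k = j then y - \<mu> j else 1)" for k and y :: real
    have F: "integrable (\<nu> k) (F k)" for k
      using int1[of i] int1[of j] prob_space.prob_space[OF prob[of k]]
      by (cases "k = i"; cases "k = j") (auto simp: F_def[abs_def] prob_space.finite_measure[OF prob] intro!: finite_measure.integrable_const)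
    have eq: "(\<Prod>k\<in>I. F k (x k)) = (x i - \<mu> i) * (x j - \<mu> j)" for x
    proof -
      have "(\<Prod>k\<in>I. F k (x k)) = (\<Prod>k\<in>{i, j}. F k (x k))"
        using ij I by (intro prod.mono_neutral_right) (auto simp: F_def)
      then show ?thesis using False by (simp add: F_def)
    qed
    have "(\<Prod>k\<in>I. \<integral>y. F k y \<partial>\<nu> k) = 0"
      using ij I mean[of i] by (auto simp: prod_zero_iff F_def[abs_def] intro!: bexI[of _ i])
    then show ?thesis
      using product_integrable_prod[OF I F] product_integral_prod[OF I F] False by (simp add: eq)
  qed
  have i1: "integrable (PiM I \<nu>) (\<lambda>x. c i * (x i - \<mu> i))" if "i \<in> I" for i
    using one(1)[OF that int1] by simp
  then show "integrable (PiM I \<nu>) a" unfolding a_def by auto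
  show "(\<integral>x. a x \<partial>PiM I \<nu>) = 0"
  proof -
    have "(\<integral>x. a x \<partial>PiM I \<nu>) = (\<Sum>i\<in>I. \<integral>x. c i * (x i - \<mu> i) \<partial>PiM I \<nu>)"
      unfolding a_def by (rule Bochner_Integration.integral_sum[OF i1])
    also have "\<dots> = (\<Sum>i\<in>I. c i * (\<integral>y. y - \<mu> i \<partial>\<nu> i))"
      using one(2)[OF _ int1] by (intro sum.cong) auto
    finally show ?thesis by (simp only: mean) simp
  qed
  have sq: "(a x)\<^sup>2 = (\<Sum>i\<in>I. \<Sum>j\<in>I. c i * c j * ((x i - \<mu> i) * (x j - \<mu> j)))" for x
    unfolding a_def power2_eq_square sum_product by (intro sum.cong refl) (simp add: mult_ac)
  have i2: "integrable (PiM I \<nu>) (\<lambda>x. c i * c j * ((x i - \<mu> i) * (x j - \<mu> j)))" if "i \<in> I" "j \<in> I" for i j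
    using two[OF that] by simp
  show "integrable (PiM I \<nu>) (\<lambda>x. (a x)\<^sup>2)"
    unfolding sq by (intro Bochner_Integration.integrable_sum i2)
  have "(\<integral>x. (a x)\<^sup>2 \<partial>PiM I \<nu>) = (\<Sum>i\<in>I. \<Sum>j\<in>I. c i * c j * (if i = j then v i else 0))"
    unfolding sq using i2 two
    by (subst Bochner_Integration.integral_sum, auto intro!: sum.cong)+
  also have "\<dots> = (\<Sum>i\<in>I. (c i)\<^sup>2 * v i)"
    using I by (intro sum.cong refl) (simp add: if_distrib[of "\<lambda>x. _ * x"] power2_eq_square cong: if_cong)
  finally show "(\<integral>x. (a x)\<^sup>2 \<partial>PiM I \<nu>) = (\<Sum>i\<in>I. (c i)\<^sup>2 * v i)" .
qed

lemma pair_sum_second_moment: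
  fixes a :: "'a \<Rightarrow> real" and b :: "'b \<Rightarrow> real"
  assumes "prob_space A" "prob_space B"
    and a: "integrable A a" "integrable A (\<lambda>x. (a x)\<^sup>2)" "(\<integral>x. a x \<partial>A) = 0"
    and b: "integrable B b" "integrable B (\<lambda>y. (b y)\<^sup>2)" "(\<integral>y. b y \<partial>B) = 0"
  shows "integrable (A \<Otimes>\<^sub>M B) (\<lambda>z. a (fst z) + b (snd z))"
    and "(\<integral>z. a (fst z) + b (snd z) \<partial>(A \<Otimes>\<^sub>M B)) = 0"
    and "(\<integral>z. (a (fst z) + b (snd z))\<^sup>2 \<partial>(A \<Otimes>\<^sub>M B)) = (\<integral>x. (a x)\<^sup>2 \<partial>A) + (\<integral>y. (b y)\<^sup>2 \<partial>B)"
proof -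
  interpret A: prob_space A by fact
  interpret B: prob_space B by fact
  interpret pair_prob_space A B by standard
  have fst: "integrable (A \<Otimes>\<^sub>M B) (\<lambda>z. h (fst z))" "(\<integral>z. h (fst z) \<partial>(A \<Otimes>\<^sub>M B)) = (\<integral>x. h x \<partial>A)"
    if "integrable A h" for h :: "'a \<Rightarrow> real"
    using integrable_distr[of fst "A \<Otimes>\<^sub>M B" A h] integral_distr[of fst "A \<Otimes>\<^sub>M B" A h] that B.distr_pair_fst[of A]
    by auto
  have snd: "integrable (A \<Otimes>\<^sub>M B) (\<lambda>z. h (snd z))" "(\<integral>z. h (snd z) \<partial>(A \<Otimes>\<^sub>M B)) = (\<integral>y. h y \<partial>B)"
    if "integrable B h" for h :: "'b \<Rightarrow> real"
  proof -
    have [measurable]: "h \<in> borel_measurable B" using that by auto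
    have "(\<integral>\<^sup>+z. ennreal \<bar>h (snd z)\<bar> \<partial>(A \<Otimes>\<^sub>M B)) = (\<integral>\<^sup>+y. ennreal \<bar>h y\<bar> \<partial>B)"
      by (subst B.nn_integral_fst[symmetric]) (auto simp: A.emeasure_space_1)
    then show i: "integrable (A \<Otimes>\<^sub>M B) (\<lambda>z. h (snd z))"
      using that unfolding integrable_iff_bounded by auto
    show "(\<integral>z. h (snd z) \<partial>(A \<Otimes>\<^sub>M B)) = (\<integral>y. h y \<partial>B)"
      using integral_fst'[OF i] by (simp add: A.prob_space)
  qed
  show "integrable (A \<Otimes>\<^sub>M B) (\<lambda>z. a (fst z) + b (snd z))" "(\<integral>z. a (fst z) + b (snd z) \<partial>(A \<Otimes>\<^sub>M B)) = 0"
    using fst[OF a(1)] snd[OF b(1)] a(3) b(3) by auto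
  have [measurable]: "a \<in> borel_measurable A" "b \<in> borel_measurable B" using a b by auto
  have cross: "integrable (A \<Otimes>\<^sub>M B) (\<lambda>z. a (fst z) * b (snd z))"
  proof (rule Bochner_Integration.integrable_bound)
    show "integrable (A \<Otimes>\<^sub>M B) (\<lambda>z. (a (fst z))\<^sup>2 + (b (snd z))\<^sup>2)"
      using fst(1)[OF a(2)] snd(1)[OF b(2)] by auto
    have "\<bar>x * y\<bar> \<le> x\<^sup>2 + y\<^sup>2" for x y :: real
      using sum_squares_bound[of "\<bar>x\<bar>" "\<bar>y\<bar>"] abs_ge_zero[of "x * y"]
      by (simp only: abs_mult power2_abs)
    then show "AE z in A \<Otimes>\<^sub>M B. norm (a (fst z) * b (snd z)) \<le> norm ((a (fst z))\<^sup>2 + (b (snd z))\<^sup>2)"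
      by simp
  qed measurable
  have "(\<integral>z. a (fst z) * b (snd z) \<partial>(A \<Otimes>\<^sub>M B)) = (\<integral>x. (\<integral>y. a x * b y \<partial>B) \<partial>A)"
    using integral_fst'[OF cross] by simp
  also have "\<dots> = 0" using b by simp
  finally have c0: "(\<integral>z. a (fst z) * b (snd z) \<partial>(A \<Otimes>\<^sub>M B)) = 0" .
  have "(\<integral>z. (a (fst z) + b (snd z))\<^sup>2 \<partial>(A \<Otimes>\<^sub>M B)) =
      (\<integral>z. (a (fst z))\<^sup>2 + (b (snd z))\<^sup>2 + 2 * (a (fst z) * b (snd z)) \<partial>(A \<Otimes>\<^sub>M B))"
    by (intro Bochner_Integration.integral_cong) (auto simp: power2_sum)
  also have "\<dots> = (\<integral>x. (a x)\<^sup>2 \<partial>A) + (\<integral>y. (b y)\<^sup>2 \<partial>B)"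
    using fst[OF a(2)] snd[OF b(2)] cross c0 by simp
  finally show "(\<integral>z. (a (fst z) + b (snd z))\<^sup>2 \<partial>(A \<Otimes>\<^sub>M B)) = (\<integral>x. (a x)\<^sup>2 \<partial>A) + (\<integral>y. (b y)\<^sup>2 \<partial>B)" .
qed

definition normal_measure :: "real \<Rightarrow> real \<Rightarrow> real measure" where
  "normal_measure \<mu> v = density lborel (\<lambda>x. ennreal (normal_density \<mu> (sqrt v) x))"

lemma normal_measure_moments:
  assumes v: "0 < v"
  shows "prob_space (normal_measure \<mu> v)" "sets (normal_measure \<mu> v) = sets borel"
    "integrable (normal_measure \<mu> v) (\<lambda>x. x - \<mu>)" "integrable (normal_measure \<mu> v) (\<lambda>x. (x - \<mu>)\<^sup>2)"
    "(\<integral>x. x - \<mu> \<partial>normal_measure \<mu> v) = 0" "(\<integral>x. (x - \<mu>)\<^sup>2 \<partial>normal_measure \<mu> v) = v"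
proof -
  have s: "0 < sqrt v" using v by simp
  show "prob_space (normal_measure \<mu> v)"
    unfolding normal_measure_def by (rule prob_space_normal_density[OF s])
  show "sets (normal_measure \<mu> v) = sets borel" by (simp add: normal_measure_def)
  show "integrable (normal_measure \<mu> v) (\<lambda>x. x - \<mu>)"
    unfolding normal_measure_def using integrable_normal_moment[OF s, of \<mu> 1]
    by (subst integrable_density) auto
  show "integrable (normal_measure \<mu> v) (\<lambda>x. (x - \<mu>)\<^sup>2)"
    unfolding normal_measure_def using integrable_normal_moment[OF s, of \<mu> 2]
    by (subst integrable_density) auto
  show "(\<integral>x. x - \<mu> \<partial>normal_measure \<mu> v) = 0"
    unfolding normal_measure_def using integral_normal_moment_odd[OF s, of \<mu> 0]
    by (subst integral_density) auto
  show "(\<integral>x. (x - \<mu>)\<^sup>2 \<partial>normal_measure \<mu> v) = v"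
    unfolding normal_measure_def using integral_normal_moment_even[OF s, of \<mu> 1] v
    by (subst integral_density) (auto simp: power2_eq_square)
qed

lemma normal_density_weight:
  assumes v: "0 < v"
  shows "exp (- (x - \<mu>)\<^sup>2 / (2 * v)) = sqrt (2 * pi * v) * normal_density \<mu> (sqrt v) x"
  using v by (simp add: normal_density_def)

text \<open>Rewriting the exponent in p gives a Gaussian with mean m pp / mbar and variance m /
  \<beta>. The partition function needs no separate integration: the normal densities have total
  mass 1, so it is the constant in front of them.\<close>

lemma local_gibbs_eq:
  assumes N: "1 \<le> N" and m: "\<And>x. x \<in> {1..N} \<Longrightarrow> 0 < m x" and \<beta>: "\<And>x. x \<in> {1..N} \<Longrightarrow> 0 < \<beta> (real x / real N)"
    and vr: "\<And>x. 0 < vr x" "\<And>x. x \<in> {1..<N} \<Longrightarrow> vr x = 1 / \<beta> (real x / real N)"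
    and vp: "\<And>x. 0 < vp x" "\<And>x. x \<in> {1..N} \<Longrightarrow> vp x = m x / \<beta> (real x / real N)"
  shows "local_gibbs \<beta> rr pp mbar N m =
    PiM {1..<N} (\<lambda>x. normal_measure (rr (x / N)) (vr x)) \<Otimes>\<^sub>M
    PiM {1..N} (\<lambda>x. normal_measure (m x * (pp (x / N) / mbar)) (vp x))"
proof -
  let ?mr = "\<lambda>x. rr (real x / real N)" and ?mp = "\<lambda>x. m x * (pp (real x / real N) / mbar)"
  let ?fr = "\<lambda>r. \<Prod>x\<in>{1..<N}. normal_density (?mr x) (sqrt (vr x)) (r x)"
  let ?fp = "\<lambda>p. \<Prod>x\<in>{1..N}. normal_density (?mp x) (sqrt (vp x)) (p x)"
  let ?R = "PiM {1..<N} (\<lambda>_. lborel) :: (nat \<Rightarrow> real) measure" and ?P = "PiM {1..N} (\<lambda>_. lborel) :: (nat \<Rightarrow> real) measure"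
  let ?G = "PiM {1..<N} (\<lambda>x. normal_measure (?mr x) (vr x)) \<Otimes>\<^sub>M PiM {1..N} (\<lambda>x. normal_measure (?mp x) (vp x))"
  have frm [measurable]: "?fr \<in> borel_measurable ?R"
    by (intro borel_measurable_prod) (auto intro!: measurable_compose[OF measurable_component_singleton])
  have fpm [measurable]: "?fp \<in> borel_measurable ?P"
    by (intro borel_measurable_prod) (auto intro!: measurable_compose[OF measurable_component_singleton])
  have R: "PiM {1..<N} (\<lambda>x. normal_measure (?mr x) (vr x)) = density ?R (\<lambda>r. ennreal (?fr r))"
    unfolding normal_measure_def
    by (subst PiM_density[OF lborel.sigma_finite_measure_axioms])
      (auto simp: prod_ennreal prob_space_normal_density vr)
  have P: "PiM {1..N} (\<lambda>x. normal_measure (?mp x) (vp x)) = density ?P (\<lambda>p. ennreal (?fp p))"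
    unfolding normal_measure_def
    by (subst PiM_density[OF lborel.sigma_finite_measure_axioms])
      (auto simp: prod_ennreal prob_space_normal_density vp)
  have PR: "prob_space (PiM {1..<N} (\<lambda>x. normal_measure (?mr x) (vr x)))"
    by (intro prob_space_PiM normal_measure_moments vr)
  have PP: "prob_space (PiM {1..N} (\<lambda>x. normal_measure (?mp x) (vp x)))"
    by (intro prob_space_PiM normal_measure_moments vp)
  interpret pG: pair_prob_space "PiM {1..<N} (\<lambda>x. normal_measure (?mr x) (vr x))" "PiM {1..N} (\<lambda>x. normal_measure (?mp x) (vp x))"
    unfolding pair_prob_space_def pair_sigma_finite_def using PR PP
    by (auto intro: prob_space_imp_sigma_finite)
  interpret fP: finite_product_sigma_finite "\<lambda>_. lborel :: real measure" "{1..N}" by standard auto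
  have sf: "sigma_finite_measure (density ?P (\<lambda>p. ennreal (?fp p)))"
    using prob_space_imp_sigma_finite[OF PP] unfolding P .
  have G: "?G = density (phase_space N) (\<lambda>(r, p). ennreal (?fr r) * ennreal (?fp p))"
    unfolding phase_space_def R P
    by (rule pair_measure_density) (use fP.sigma_finite_measure_axioms sf in auto)
  have f0: "0 \<le> ?fr r" "0 \<le> ?fp p" for r p by (auto intro!: prod_nonneg)
  let ?f = "\<lambda>z. ?fr (fst z) * ?fp (snd z)"
  have G': "?G = density (phase_space N) (\<lambda>z. ennreal (?f z))"
    unfolding G by (intro arg_cong[where f = "density _"] ext) (simp only: split_beta' ennreal_mult[OF f0])
  have fm [measurable]: "?f \<in> borel_measurable (phase_space N)"
    unfolding phase_space_def by measurable
  have fm': "(\<lambda>z. ennreal (?f z)) \<in> borel_measurable (phase_space N)"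
    by (rule measurable_compose[OF fm]) measurable
  have "(\<integral>\<^sup>+z. ennreal (?f z) \<partial>phase_space N) =
      (\<integral>\<^sup>+z. ennreal (?f z) * indicator (space (phase_space N)) z \<partial>phase_space N)"
    by (rule nn_integral_cong) (simp only: indicator_simps mult_1_right)
  also have "\<dots> = emeasure (density (phase_space N) (\<lambda>z. ennreal (?f z))) (space (phase_space N))"
    by (rule emeasure_density[OF fm' sets.top, symmetric])
  also have "\<dots> = 1"
    using pG.emeasure_space_1 unfolding G' space_density .
  finally have tot: "(\<integral>\<^sup>+z. ennreal (?f z) \<partial>phase_space N) = 1" .
  have "(\<integral>z. ?f z \<partial>phase_space N) = enn2real (\<integral>\<^sup>+z. ennreal (?f z) \<partial>phase_space N)"
    by (rule integral_eq_nn_integral[OF fm AE_I2]) (rule mult_nonneg_nonneg[OF f0])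
  then have int1: "(\<integral>z. ?f z \<partial>phase_space N) = 1" unfolding tot by simp
  define C where "C = (\<Prod>x\<in>{1..<N}. sqrt (2 * pi * vr x)) * (\<Prod>x\<in>{1..N}. sqrt (2 * pi * vp x))"
  have C: "0 < C" unfolding C_def using vr(1) vp(1) by (intro mult_pos_pos prod_pos) auto
  have w: "gibbs_weight \<beta> rr pp mbar N m z = C * ?f z" for z
  proof -
    obtain r p where z: "z = (r, p)" by (cases z)
    have er: "exp (- (1/2) * (\<beta> (real x / real N) * (r x - ?mr x)\<^sup>2)) = sqrt (2 * pi * vr x) * normal_density (?mr x) (sqrt (vr x)) (r x)"
      if "x \<in> {1..<N}" for x
    proof -
      have "- (1/2) * (\<beta> (real x / real N) * (r x - ?mr x)\<^sup>2) = - (r x - ?mr x)\<^sup>2 / (2 * vr x)"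
        unfolding vr(2)[OF that] by simp
      then show ?thesis by (simp only: normal_density_weight[OF vr(1)])
    qed
    have ep: "exp (- (1/2) * (\<beta> (real x / real N) * m x * (p x / m x - pp (real x / real N) / mbar)\<^sup>2)) =
        sqrt (2 * pi * vp x) * normal_density (?mp x) (sqrt (vp x)) (p x)"
      if x: "x \<in> {1..N}" for x
    proof -
      have "p x / m x - pp (real x / real N) / mbar = (p x - ?mp x) / m x"
        using m[OF x] by (simp add: diff_divide_distrib)
      then have "- (1/2) * (\<beta> (real x / real N) * m x * (p x / m x - pp (real x / real N) / mbar)\<^sup>2) = - (p x - ?mp x)\<^sup>2 / (2 * vp x)"
        unfolding vp(2)[OF x] using m[OF x] by (simp add: power_divide power2_eq_square)
      then show ?thesis by (simp only: normal_density_weight[OF vp(1)])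
    qed
    have "gibbs_weight \<beta> rr pp mbar N m z =
      exp (\<Sum>x\<in>{1..<N}. - (1/2) * (\<beta> (real x / real N) * (r x - ?mr x)\<^sup>2)) *
      exp (\<Sum>x\<in>{1..N}. - (1/2) * (\<beta> (real x / real N) * m x * (p x / m x - pp (real x / real N) / mbar)\<^sup>2))"
      unfolding gibbs_weight_def z exp_add[symmetric] sum_distrib_left[symmetric] by simp
    also have "\<dots> = (\<Prod>x\<in>{1..<N}. sqrt (2 * pi * vr x) * normal_density (?mr x) (sqrt (vr x)) (r x)) *
        (\<Prod>x\<in>{1..N}. sqrt (2 * pi * vp x) * normal_density (?mp x) (sqrt (vp x)) (p x))"
      unfolding exp_sum[OF finite_atLeastLessThan] exp_sum[OF finite_atLeastAtMost]
      by (intro arg_cong2[where f = "(*)"] prod.cong refl er ep)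
    finally show ?thesis by (simp add: C_def z prod.distrib)
  qed
  have "gibbs_Z \<beta> rr pp mbar N m = C"
    unfolding gibbs_Z_def w[abs_def] using int1 by simp
  then show ?thesis
    unfolding local_gibbs_def G' w using C by simp
qed

text \<open>Centering removes the profile means, and the variances 1 / \<beta> and m / \<beta> of
  independent coordinates add up.\<close>

lemma centered_square_mean_linear:
  assumes N: "1 \<le> N" and m: "\<And>x. x \<in> {1..N} \<Longrightarrow> 0 < m x" and \<beta>: "\<And>x. x \<in> {1..N} \<Longrightarrow> 0 < \<beta> (real x / real N)"
    and X: "\<And>z. X z = (\<Sum>x\<in>{1..<N}. a x * fst z x) + (\<Sum>x\<in>{1..N}. b x * snd z x)"
  shows "centered_square_mean (local_gibbs \<beta> rr pp mbar N m) X =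
    (\<Sum>x\<in>{1..<N}. (a x)\<^sup>2 / \<beta> (real x / real N)) + (\<Sum>x\<in>{1..N}. (b x)\<^sup>2 * (m x / \<beta> (real x / real N)))"
proof -
  \<comment> \<open>The value 1 off the index range keeps all factors of the product measures
    probability measures.\<close>
  define vr where "vr x = (if x \<in> {1..<N} then 1 / \<beta> (real x / real N) else 1)" for x
  define vp where "vp x = (if x \<in> {1..N} then m x / \<beta> (real x / real N) else 1)" for x
  let ?mr = "\<lambda>x. rr (real x / real N)" and ?mp = "\<lambda>x. m x * (pp (real x / real N) / mbar)"
  have vr: "0 < vr x" for x using \<beta>[of x] by (auto simp: vr_def)
  have vp: "0 < vp x" for x using \<beta>[of x] m[of x] by (auto simp: vp_def)
  let ?A = "PiM {1..<N} (\<lambda>x. normal_measure (?mr x) (vr x))" and ?B = "PiM {1..N} (\<lambda>x. normal_measure (?mp x) (vp x))"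
  have G: "local_gibbs \<beta> rr pp mbar N m = ?A \<Otimes>\<^sub>M ?B"
    by (rule local_gibbs_eq[where m = m and \<beta> = \<beta>, OF N m \<beta>]) (auto simp: vr vp, auto simp: vr_def vp_def)
  have PA: "prob_space ?A" by (intro prob_space_PiM normal_measure_moments vr)
  have PB: "prob_space ?B" by (intro prob_space_PiM normal_measure_moments vp)
  interpret pair_prob_space ?A ?B
    unfolding pair_prob_space_def pair_sigma_finite_def using PA PB by (auto intro: prob_space_imp_sigma_finite)
  let ?a = "\<lambda>r. \<Sum>x\<in>{1..<N}. a x * (r x - ?mr x)" and ?b = "\<lambda>p. \<Sum>x\<in>{1..N}. b x * (p x - ?mp x)"
  note A = PiM_linear_moments[where \<nu> = "\<lambda>x. normal_measure (?mr x) (vr x)" and I = "{1..<N}" and \<mu> = ?mr and v = vr and c = a, OF normal_measure_moments(1,2)[OF vr]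
      finite_atLeastLessThan normal_measure_moments(3-6)[OF vr]]
  note B = PiM_linear_moments[where \<nu> = "\<lambda>x. normal_measure (?mp x) (vp x)" and I = "{1..N}" and \<mu> = ?mp and v = vp and c = b, OF normal_measure_moments(1,2)[OF vp]
      finite_atLeastAtMost normal_measure_moments(3-6)[OF vp]]
  define c where "c = (\<Sum>x\<in>{1..<N}. a x * ?mr x) + (\<Sum>x\<in>{1..N}. b x * ?mp x)"
  have Xc: "X z = ?a (fst z) + ?b (snd z) + c" for z
    unfolding X c_def by (simp add: right_diff_distrib sum_subtractf)
  note S = pair_sum_second_moment[OF PA PB A(1,2,3) B(1,2,3)]
  have mean: "(\<integral>z. X z \<partial>(?A \<Otimes>\<^sub>M ?B)) = c"
  proof -
    have "(\<integral>z. X z \<partial>(?A \<Otimes>\<^sub>M ?B)) = (\<integral>z. ?a (fst z) + ?b (snd z) \<partial>(?A \<Otimes>\<^sub>M ?B)) + (\<integral>z. c \<partial>(?A \<Otimes>\<^sub>M ?B))"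
      unfolding Xc by (rule Bochner_Integration.integral_add[OF S(1) P.integrable_const])
    then show ?thesis unfolding S(2) lebesgue_integral_const P.prob_space by simp
  qed
  have "centered_square_mean (local_gibbs \<beta> rr pp mbar N m) X = (\<integral>z. (?a (fst z) + ?b (snd z))\<^sup>2 \<partial>(?A \<Otimes>\<^sub>M ?B))"
    unfolding centered_square_mean_def G mean by (simp add: Xc)
  also have "\<dots> = (\<Sum>x\<in>{1..<N}. (a x)\<^sup>2 * vr x) + (\<Sum>x\<in>{1..N}. (b x)\<^sup>2 * vp x)"
    unfolding S(3) A(4) B(4) ..
  finally show ?thesis by (simp add: vr_def vp_def)
qed

section \<open>Thermal energy as transport along the flow\<close>

lemma sum_odd_even:
  fixes g :: "nat \<Rightarrow> 'a::comm_monoid_add"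
  assumes "1 \<le> N"
  shows "(\<Sum>i=1..2 * N - 1. g i) = (\<Sum>x\<in>{1..N}. g (2 * x - 1)) + (\<Sum>x\<in>{1..<N}. g (2 * x))"
  using assms
proof (induction N rule: dec_induct)
  case (step N)
  have "{1..2 * Suc N - 1} = insert (2 * N + 1) (insert (2 * N) {1..2 * N - 1})" using step(1) by auto
  then have "(\<Sum>i=1..2 * Suc N - 1. g i) = g (2 * N + 1) + (g (2 * N) + (\<Sum>i=1..2 * N - 1. g i))"
    using step(1) by simp
  moreover have "{1..<Suc N} = insert N {1..<N}" using step(1) by auto
  ultimately show ?case using step by (simp add: add_ac)
qed simp

context weighted_chain
begin

definition \<Phi> :: "real \<Rightarrow> nat \<Rightarrow> nat \<Rightarrow> complex" where
  "\<Phi> s i j = flow (of_real s) (basis j) i"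

text \<open>The fraction of the energy of an excitation at j that is found at i at time s. Columns
  sum to 1 by conservation of energy.\<close>

definition transport :: "real \<Rightarrow> nat \<Rightarrow> nat \<Rightarrow> real" where
  "transport s i j = d i * (cmod (\<Phi> s i j))\<^sup>2 / d j"

lemma Im_gen_pow: "(\<And>i. Im (w i) = 0) \<Longrightarrow> Im ((gen ^^ k) w i) = 0"
  by (induction k arbitrary: i) (simp_all add: gen_def Im_divide_of_real)

lemma Im_flow:
  assumes "supported w" "\<And>i. Im (w i) = 0"
  shows "Im (flow (of_real s) w i) = 0"
proof -
  have "Im (flow (of_real s) w i) = (\<Sum>k. Im ((gen ^^ k) w i / fact k * of_real s ^ k))"
    unfolding flow_def by (rule bounded_linear.suminf[OF bounded_linear_Im flow_summable[OF assms(1)]])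
  also have "\<dots> = 0"
  proof -
    have "Im (z / fact k * of_real s ^ k) = Im z / fact k * s ^ k" for z :: complex and k
    proof -
      have "z / fact k * of_real s ^ k = z * of_real (s ^ k / fact k)" by simp
      then have "Im (z / fact k * of_real s ^ k) = Im (z * of_real (s ^ k / fact k))" by (rule arg_cong)
      also have "Im (z * of_real c) = Im z * c" for c by simp
      finally show ?thesis by simp
    qed
    then show ?thesis using Im_gen_pow[OF assms(2)] by simp
  qed
  finally show ?thesis .
qed

text \<open>The generator is real, hence so is the flow of real data, and real parts lose
  nothing.\<close>

lemma Re_\<Phi>_square: "j \<in> {1..n} \<Longrightarrow> (Re (\<Phi> s i j))\<^sup>2 = (cmod (\<Phi> s i j))\<^sup>2"
  using Im_flow[OF supported_basis, of j s i] by (simp add: cmod_power2 \<Phi>_def basis_def)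

lemma transport_nonneg: "0 \<le> transport s i j"
  using d_pos[of i] d_pos[of j] by (simp add: transport_def)

lemma transport_column: "j \<in> {1..n} \<Longrightarrow> 0 \<le> s \<Longrightarrow> (\<Sum>i=1..n. transport s i j) = 1"
  using nrm2_flow[OF supported_basis, of j s] nrm2_basis[of j] d_pos[of j]
  by (simp add: transport_def \<Phi>_def nrm2_def sum_divide_distrib[symmetric])

lemma transport_0: "transport 0 i j = (if i = j then 1 else 0)"
  using d_pos[of j] by (simp add: transport_def \<Phi>_def flow_0 basis_def)

lemma flow_expand:
  assumes "supported w"
  shows "flow (of_real s) w i = (\<Sum>j=1..n. w j * \<Phi> s i j)"
proof -
  have "w = (\<lambda>i. \<Sum>j=1..n. w j * basis j i)"
  proof
    fix i
    have "(\<Sum>j=1..n. w j * basis j i) = (\<Sum>j=1..n. if j = i then w i else 0)"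
      by (intro sum.cong) (auto simp: basis_def)
    then show "w i = (\<Sum>j=1..n. w j * basis j i)"
      using supportedD[OF assms] by auto
  qed
  then have "flow (of_real s) w i = flow (of_real s) (\<lambda>i. \<Sum>j=1..n. w j * basis j i) i" by simp
  also have "\<dots> = (\<Sum>j=1..n. w j * \<Phi> s i j)"
    unfolding \<Phi>_def by (rule flow_sum) (auto intro: supported_basis)
  finally show ?thesis .
qed

end

text \<open>Dividing momenta by masses makes the dynamics a weighted difference; the zero value off
  the chain encodes r_0 = r_N = 0.\<close>

definition encode :: "nat \<Rightarrow> (nat \<Rightarrow> real) \<Rightarrow> (nat \<Rightarrow> real) \<Rightarrow> (nat \<Rightarrow> real) \<Rightarrow> nat \<Rightarrow> complex" where
  "encode N m r p i = (if i \<in> {1..2 * N - 1} then of_real (if odd i then p (Suc i div 2) / m (Suc i div 2) else r (i div 2)) else 0)"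

section \<open>The mass-spring chain as a weighted chain\<close>

locale mass_chain = weighted_chain "site_weight m" n dl du
  for m :: "nat \<Rightarrow> real" and n :: nat and dl du :: real +
  fixes N :: nat
  assumes N: "1 \<le> N" and n: "n = 2 * N - 1"
begin

lemma sum_sites: "(\<Sum>i=1..n. g i) = (\<Sum>x\<in>{1..N}. g (2 * x - 1)) + (\<Sum>x\<in>{1..<N}. g (2 * x))"
  for g :: "nat \<Rightarrow> real"
  unfolding n by (rule sum_odd_even[OF N])

lemma m_pos: "1 \<le> x \<Longrightarrow> 0 < m x"
  using d_pos[of "2 * x - 1"] by (simp add: site_weight_def split: if_splits)

lemma supported_encode: "supported (encode N m r p)"
  unfolding supported_def encode_def n[symmetric] by auto

lemma encode_odd: "x \<in> {1..N} \<Longrightarrow> encode N m r p (2 * x - 1) = of_real (p x / m x)"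
  by (auto simp: encode_def)

lemma encode_even:
  assumes "r 0 = 0" "r N = 0" "x \<le> N"
  shows "encode N m r p (2 * x) = of_real (r x)"
proof (cases "x = 0 \<or> x = N")
  case True
  then show ?thesis using assms N by (auto simp: encode_def)
next
  case False
  then show ?thesis using assms by (auto simp: encode_def)
qed

lemma encode_interior: "x \<in> {1..<N} \<Longrightarrow> encode N m r p (2 * x) = of_real (r x)"
  by (auto simp: encode_def)

lemma trajectory_solution:
  assumes "chain_trajectory N m r p"
  shows "solution (\<lambda>s. encode N m (r s) (p s))"
  unfolding solution_def
proof (intro allI impI conjI ballI supported_encode)
  fix s :: real and i assume s: "0 \<le> s" and i: "i \<in> {1..n}"
  have bd: "r s 0 = 0" "r s N = 0" using assms s by (auto simp: chain_trajectory_def)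
  have lift: "((\<lambda>s. complex_of_real (h s)) has_vector_derivative of_real D) (at s within {0..})"
    if "(h has_real_derivative D) (at s within {0..})" for h D
    using that by (intro has_vector_derivative_of_real) (simp add: has_real_derivative_iff_has_vector_derivative)
  show "((\<lambda>s. encode N m (r s) (p s) i) has_vector_derivative gen (encode N m (r s) (p s)) i) (at s within {0..})"
  proof (cases "odd i")
    case True
    define x where "x = Suc i div 2"
    have x1: "i = 2 * x - 1" using True unfolding x_def by presburger
    moreover have "x \<in> {1..N}" using i True by (auto simp: x_def n)
    ultimately have x: "i = 2 * x - 1" "x \<in> {1..N}" by blast+
    have "((\<lambda>s. p s x) has_real_derivative r s x - r s (x - 1)) (at s within {0..})"
      using assms s x by (simp add: chain_trajectory_def)
    then have "((\<lambda>s. p s x / m x) has_real_derivative (r s x - r s (x - 1)) / m x) (at s within {0..})"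
      by (rule DERIV_cdivide)
    note lift[OF this]
    moreover have "gen (encode N m (r s) (p s)) i = of_real ((r s x - r s (x - 1)) / m x)"
    proof -
      have "Suc i = 2 * x" "i - 1 = 2 * (x - 1)" "site_weight m i = m x" using x by (auto simp: site_weight_def)
      then show ?thesis
        using i encode_even[OF bd, of x "p s"] encode_even[OF bd, of "x - 1" "p s"] x(2) by (simp add: gen_def)
    qed
    ultimately show ?thesis using encode_odd[OF x(2)] x(1) by simp
  next
    case False
    then obtain x where x: "i = 2 * x" by (auto elim: evenE)
    then have xN: "x \<in> {1..<N}" using i by (auto simp: n)
    have "((\<lambda>s. r s x) has_real_derivative p s (x + 1) / m (x + 1) - p s x / m x) (at s within {0..})"
      using assms s xN by (simp add: chain_trajectory_def)
    note lift[OF this]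
    moreover have "gen (encode N m (r s) (p s)) i = of_real (p s (x + 1) / m (x + 1) - p s x / m x)"
    proof -
      have "Suc i = 2 * (x + 1) - 1" "i - 1 = 2 * x - 1" "site_weight m i = 1" using x by (auto simp: site_weight_def)
      then show ?thesis
        using i encode_odd[of "x + 1" "r s" "p s"] encode_odd[of x "r s" "p s"] xN by (simp add: gen_def)
    qed
    moreover have "(\<lambda>s. encode N m (r s) (p s) i) = (\<lambda>s. of_real (r s x))"
      using xN by (auto simp: encode_def x n)
    ultimately show ?thesis by simp
  qed
qed

lemma flow_trajectory:
  fixes ra pa :: "nat \<Rightarrow> real"
  defines "v \<equiv> \<lambda>s i. Re (flow (of_real s) (encode N m ra pa) i)"
  shows "chain_trajectory N m (\<lambda>s x. v s (2 * x)) (\<lambda>s x. m x * v s (2 * x - 1))"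
    and "x \<in> {1..<N} \<Longrightarrow> v 0 (2 * x) = ra x"
    and "x \<in> {1..N} \<Longrightarrow> m x * v 0 (2 * x - 1) = pa x"
proof -
  let ?w = "encode N m ra pa"
  have out: "v s i = 0" if "i \<notin> {1..n}" for s i
    unfolding v_def supportedD[OF supported_flow[OF supported_encode] that] by simp
  have der: "((\<lambda>s. v s i) has_real_derivative (v s (Suc i) - v s (i - 1)) / site_weight m i) (at s within {0..})"
    if "i \<in> {1..n}" "0 \<le> s" for s i
  proof -
    have "((\<lambda>s. flow (of_real s) ?w i) has_vector_derivative gen (flow (of_real s) ?w) i) (at s within {0..})"
      using solution_flow[OF supported_encode] that unfolding solution_def by blast
    from bounded_linear.has_vector_derivative[OF bounded_linear_Re this]
    show ?thesis
      using that(1) unfolding v_def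
      by (simp add: has_real_derivative_iff_has_vector_derivative gen_def Re_divide_of_real)
  qed
  show "chain_trajectory N m (\<lambda>s x. v s (2 * x)) (\<lambda>s x. m x * v s (2 * x - 1))"
    unfolding chain_trajectory_def
  proof (intro allI impI conjI ballI)
    fix s :: real assume s: "0 \<le> s"
    show "v s (2 * 0) = 0" "v s (2 * N) = 0" using N by (auto intro!: out simp: n)
    { fix x assume x: "x \<in> {1..<N}"
      have "((\<lambda>s. v s (2 * x)) has_real_derivative (v s (Suc (2 * x)) - v s (2 * x - 1)) / site_weight m (2 * x)) (at s within {0..})"
        using x s by (intro der) (auto simp: n)
      moreover have "m (x + 1) * v s (2 * (x + 1) - 1) / m (x + 1) = v s (Suc (2 * x))" "m x * v s (2 * x - 1) / m x = v s (2 * x - 1)"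
        using m_pos[of "x + 1"] m_pos[of x] x by auto
      ultimately show "((\<lambda>s. v s (2 * x)) has_real_derivative m (x + 1) * v s (2 * (x + 1) - 1) / m (x + 1) -
            m x * v s (2 * x - 1) / m x) (at s within {0..})"
        by (simp only:) (simp add: site_weight_def)
    }
    { fix x assume x: "x \<in> {1..N}"
      have "((\<lambda>s. v s (2 * x - 1)) has_real_derivative (v s (Suc (2 * x - 1)) - v s (2 * x - 1 - 1)) / site_weight m (2 * x - 1)) (at s within {0..})"
        using x s by (intro der) (auto simp: n)
      moreover have "2 * x - 1 - 1 = 2 * (x - 1)" "Suc (2 * x - 1) = 2 * x" "site_weight m (2 * x - 1) = m x"
        using x by (auto simp: site_weight_def)
      ultimately have "((\<lambda>s. v s (2 * x - 1)) has_real_derivative (v s (2 * x) - v s (2 * (x - 1))) / m x) (at s within {0..})"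
        by (simp only:)
      from DERIV_cmult[OF this, of "m x"]
      show "((\<lambda>s. m x * v s (2 * x - 1)) has_real_derivative v s (2 * x) - v s (2 * (x - 1))) (at s within {0..})"
        using x m_pos[of x] by simp
    }
  qed
  show "x \<in> {1..<N} \<Longrightarrow> v 0 (2 * x) = ra x"
    by (simp add: v_def flow_0 encode_interior)
  show "x \<in> {1..N} \<Longrightarrow> m x * v 0 (2 * x - 1) = pa x"
    using m_pos[of x] encode_odd[of x ra pa] by (simp add: v_def flow_0)
qed

text \<open>Existence of a trajectory gives the choice in \<open>chain_flow\<close> its defining
  property; uniqueness by energy then identifies whatever was chosen with the linear flow.\<close>

lemma chain_flow_eq:
  assumes s: "0 \<le> s"
  shows "x \<le> N \<Longrightarrow> flow_r N m s x z = Re (flow (of_real s) (encode N m (fst z) (snd z)) (2 * x))"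
    and "x \<in> {1..N} \<Longrightarrow> flow_p N m s x z = m x * Re (flow (of_real s) (encode N m (fst z) (snd z)) (2 * x - 1))"
proof -
  let ?P = "\<lambda>(r, p). chain_trajectory N m r p \<and> (\<forall>x\<in>{1..<N}. r 0 x = fst z x) \<and> (\<forall>x\<in>{1..N}. p 0 x = snd z x)"
  let ?w = "encode N m (fst z) (snd z)"
  obtain r p where rp: "chain_flow N m z = (r, p)" by (cases "chain_flow N m z")
  have "\<exists>rp. ?P rp"
    using flow_trajectory[where ra = "fst z" and pa = "snd z"]
    by (intro exI[of _ "(\<lambda>s x. Re (flow (of_real s) ?w (2 * x)), \<lambda>s x. m x * Re (flow (of_real s) ?w (2 * x - 1)))"]) auto
  then have "?P (chain_flow N m z)" unfolding chain_flow_def by (rule someI_ex)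
  then have traj: "chain_trajectory N m r p" and init: "\<And>x. x \<in> {1..<N} \<Longrightarrow> r 0 x = fst z x" "\<And>x. x \<in> {1..N} \<Longrightarrow> p 0 x = snd z x"
    unfolding rp by auto
  have w0: "encode N m (r 0) (p 0) = ?w"
  proof
    fix i show "encode N m (r 0) (p 0) i = ?w i"
      using init(1)[of "i div 2"] init(2)[of "Suc i div 2"] by (auto simp: encode_def elim!: evenE oddE)
  qed
  have eq: "encode N m (r s) (p s) i = flow (of_real s) ?w i" for i
    using solution_eq_flow[OF trajectory_solution[OF traj] s, of i] unfolding w0 .
  have bd: "r s 0 = 0" "r s N = 0" using traj s by (auto simp: chain_trajectory_def)
  show "x \<le> N \<Longrightarrow> flow_r N m s x z = Re (flow (of_real s) ?w (2 * x))"
    unfolding eq[symmetric] flow_r_def rp using encode_even[OF bd, of x "p s"] by simp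
  show "x \<in> {1..N} \<Longrightarrow> flow_p N m s x z = m x * Re (flow (of_real s) ?w (2 * x - 1))"
    unfolding eq[symmetric] flow_p_def rp using encode_odd[of x "r s" "p s"] m_pos[of x] by simp
qed

lemma Re_flow_encode:
  "Re (flow (of_real s) (encode N m r p) i) =
    (\<Sum>x\<in>{1..<N}. Re (\<Phi> s i (2 * x)) * r x) + (\<Sum>x\<in>{1..N}. (Re (\<Phi> s i (2 * x - 1)) / m x) * p x)"
proof -
  have "Re (flow (of_real s) (encode N m r p) i) = (\<Sum>j=1..n. Re (encode N m r p j * \<Phi> s i j))"
    unfolding flow_expand[OF supported_encode] by simp
  also have "\<dots> = (\<Sum>x\<in>{1..N}. Re (encode N m r p (2 * x - 1) * \<Phi> s i (2 * x - 1))) + (\<Sum>x\<in>{1..<N}. Re (encode N m r p (2 * x) * \<Phi> s i (2 * x)))"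
    by (rule sum_sites)
  also have "(\<Sum>x\<in>{1..N}. Re (encode N m r p (2 * x - 1) * \<Phi> s i (2 * x - 1))) = (\<Sum>x\<in>{1..N}. (Re (\<Phi> s i (2 * x - 1)) / m x) * p x)"
    by (intro sum.cong refl, subst encode_odd) auto
  also have "(\<Sum>x\<in>{1..<N}. Re (encode N m r p (2 * x) * \<Phi> s i (2 * x))) = (\<Sum>x\<in>{1..<N}. Re (\<Phi> s i (2 * x)) * r x)"
    by (intro sum.cong refl) (auto simp: encode_def n)
  finally show ?thesis by simp
qed

lemma variance_flow:
  assumes \<beta>: "\<And>x. x \<in> {1..N} \<Longrightarrow> 0 < \<beta> (real x / real N)"
    and X: "\<And>z. X z = c * Re (flow (of_real s) (encode N m (fst z) (snd z)) i)"
  shows "centered_square_mean (local_gibbs \<beta> rr pp mbar N m) X =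
    c\<^sup>2 * (\<Sum>j=1..n. (cmod (\<Phi> s i j))\<^sup>2 / (site_weight m j * \<beta> (real (Suc j div 2) / real N)))"
proof -
  let ?T = "\<lambda>j. (cmod (\<Phi> s i j))\<^sup>2 / (site_weight m j * \<beta> (real (Suc j div 2) / real N))"
  have Xz: "X z = (\<Sum>x\<in>{1..<N}. (c * Re (\<Phi> s i (2 * x))) * fst z x) + (\<Sum>x\<in>{1..N}. (c * (Re (\<Phi> s i (2 * x - 1)) / m x)) * snd z x)" for z
    unfolding X Re_flow_encode by (simp add: distrib_left sum_distrib_left mult_ac)
  have "centered_square_mean (local_gibbs \<beta> rr pp mbar N m) X =
    (\<Sum>x\<in>{1..<N}. (c * Re (\<Phi> s i (2 * x)))\<^sup>2 / \<beta> (real x / real N)) +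
    (\<Sum>x\<in>{1..N}. (c * (Re (\<Phi> s i (2 * x - 1)) / m x))\<^sup>2 * (m x / \<beta> (real x / real N)))"
    by (rule centered_square_mean_linear[where \<beta> = \<beta> and m = m, OF N]) (use m_pos \<beta> Xz in auto)
  also have "(\<Sum>x\<in>{1..<N}. (c * Re (\<Phi> s i (2 * x)))\<^sup>2 / \<beta> (real x / real N)) = (\<Sum>x\<in>{1..<N}. c\<^sup>2 * ?T (2 * x))"
  proof (intro sum.cong refl)
    fix x assume x: "x \<in> {1..<N}"
    then have "2 * x \<in> {1..n}" by (auto simp: n)
    from Re_\<Phi>_square[OF this, of s i] show "(c * Re (\<Phi> s i (2 * x)))\<^sup>2 / \<beta> (real x / real N) = c\<^sup>2 * ?T (2 * x)"
      by (simp add: power_mult_distrib site_weight_def)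
  qed
  also have "(\<Sum>x\<in>{1..N}. (c * (Re (\<Phi> s i (2 * x - 1)) / m x))\<^sup>2 * (m x / \<beta> (real x / real N))) = (\<Sum>x\<in>{1..N}. c\<^sup>2 * ?T (2 * x - 1))"
  proof (intro sum.cong refl)
    fix x assume x: "x \<in> {1..N}"
    then have "2 * x - 1 \<in> {1..n}" by (auto simp: n)
    note R = Re_\<Phi>_square[OF this, of s i]
    have w: "site_weight m (2 * x - 1) = m x" "Suc (2 * x - 1) div 2 = x" using x by (auto simp: site_weight_def)
    have "(c * (Re (\<Phi> s i (2 * x - 1)) / m x))\<^sup>2 * (m x / \<beta> (real x / real N)) = c\<^sup>2 * ((Re (\<Phi> s i (2 * x - 1)))\<^sup>2 / (m x * \<beta> (real x / real N)))"
      using m_pos[of x] x by (simp add: power_mult_distrib power_divide power2_eq_square)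
    then show "(c * (Re (\<Phi> s i (2 * x - 1)) / m x))\<^sup>2 * (m x / \<beta> (real x / real N)) = c\<^sup>2 * ?T (2 * x - 1)"
      unfolding w R .
  qed
  finally show ?thesis
    unfolding sum_sites by (simp add: sum_distrib_left distrib_left)
qed

lemma thermal_energy_eq:
  assumes \<beta>: "\<And>x. x \<in> {1..N} \<Longrightarrow> 0 < \<beta> (real x / real N)" and s: "0 \<le> s"
  shows "thermal_energy f \<beta> rr pp mbar N m s = 1 / (2 * real N) *
    (\<Sum>i=1..n. f (real (Suc i div 2) / real N) *
      (\<Sum>j=1..n. transport (real N * s) i j / \<beta> (real (Suc j div 2) / real N)))"
proof -
  let ?G = "local_gibbs \<beta> rr pp mbar N m" and ?s = "real N * s"
  let ?f = "\<lambda>i. f (real (Suc i div 2) / real N)"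
  have s': "0 \<le> ?s" using s by simp
  let ?T = "\<lambda>i. \<Sum>j=1..n. transport ?s i j / \<beta> (real (Suc j div 2) / real N)"
  let ?V = "\<lambda>i. \<Sum>j=1..n. (cmod (\<Phi> ?s i j))\<^sup>2 / (site_weight m j * \<beta> (real (Suc j div 2) / real N))"
  have TV: "?T i = site_weight m i * ?V i" for i
    by (simp add: transport_def sum_distrib_left)
  have p: "centered_square_mean ?G (flow_p N m ?s x) / (2 * m x) = ?T (2 * x - 1) / 2" if x: "x \<in> {1..N}" for x
  proof -
    have w: "site_weight m (2 * x - 1) = m x" using x by (auto simp: site_weight_def)
    have "centered_square_mean ?G (flow_p N m ?s x) = (m x)\<^sup>2 * ?V (2 * x - 1)"
      by (rule variance_flow[where \<beta> = \<beta>, OF \<beta>]) (use chain_flow_eq(2)[OF s' x] in auto)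
    then show ?thesis unfolding TV w using m_pos[of x] x by (simp add: power2_eq_square)
  qed
  have r: "centered_square_mean ?G (flow_r N m ?s x) / 2 = ?T (2 * x) / 2" if x: "x \<in> {1..N}" for x
  proof -
    have w: "site_weight m (2 * x) = 1" by (simp add: site_weight_def)
    have "centered_square_mean ?G (flow_r N m ?s x) = 1\<^sup>2 * ?V (2 * x)"
      by (rule variance_flow[where \<beta> = \<beta>, OF \<beta>]) (use chain_flow_eq(1)[OF s', of x] x in auto)
    then show ?thesis unfolding TV w by simp
  qed
  \<comment> \<open>The coordinate r_N has index 2 N, just beyond the last site 2 N - 1.\<close>
  have last: "?T (2 * N) = 0"
  proof -
    have "transport ?s (2 * N) j = 0" if "j \<in> {1..n}" for j
    proof -
      have "2 * N \<notin> {1..n}" unfolding n using N by auto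
      from supportedD[OF supported_flow[OF supported_basis[OF that]] this]
      show ?thesis by (simp add: transport_def \<Phi>_def)
    qed
    then show ?thesis by (intro sum.neutral) auto
  qed
  have "thermal_energy f \<beta> rr pp mbar N m s =
      (1 / real N) * (\<Sum>x=1..N. f (real x / real N) * (?T (2 * x - 1) / 2 + ?T (2 * x) / 2))"
    unfolding thermal_energy_def Let_def
    by (intro arg_cong[where f = "(*) _"] sum.cong refl arg_cong2[where f = "(*)"] arg_cong2[where f = "(+)"] p r)
  also have "\<dots> = 1 / (2 * real N) * ((\<Sum>x\<in>{1..N}. f (real x / real N) * ?T (2 * x - 1)) + (\<Sum>x\<in>{1..N}. f (real x / real N) * ?T (2 * x)))"
  proof -
    have "(1 / real N) * (\<Sum>x=1..N. g x * (A x / 2 + B x / 2)) =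
        1 / (2 * real N) * ((\<Sum>x\<in>{1..N}. g x * A x) + (\<Sum>x\<in>{1..N}. g x * B x))" for g A B :: "nat \<Rightarrow> real"
    proof -
      have "(\<Sum>x=1..N. g x * (A x / 2 + B x / 2)) = (\<Sum>x=1..N. (g x * A x + g x * B x) / 2)"
        by (intro sum.cong refl) (simp add: distrib_left add_divide_distrib)
      then have *: "(\<Sum>x=1..N. g x * (A x / 2 + B x / 2)) = ((\<Sum>x=1..N. g x * A x) + (\<Sum>x=1..N. g x * B x)) / 2"
        by (simp only: sum_divide_distrib[symmetric] sum.distrib)
      show ?thesis unfolding * by simp
    qed
    then show ?thesis .
  qed
  also have "(\<Sum>x\<in>{1..N}. f (real x / real N) * ?T (2 * x)) = (\<Sum>x\<in>{1..<N}. f (real x / real N) * ?T (2 * x))"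
  proof -
    have "{1..N} = insert N {1..<N}" using N by auto
    then show ?thesis using last by (simp only:) simp
  qed
  also have "(\<Sum>x\<in>{1..<N}. f (real x / real N) * ?T (2 * x)) = (\<Sum>x\<in>{1..<N}. ?f (2 * x) * ?T (2 * x))" by simp
  also have "(\<Sum>x\<in>{1..N}. f (real x / real N) * ?T (2 * x - 1)) = (\<Sum>x\<in>{1..N}. ?f (2 * x - 1) * ?T (2 * x - 1))"
    by (intro sum.cong refl) (auto simp del: One_nat_def)
  finally show ?thesis unfolding sum_sites .
qed

text \<open>Energy that stays near its starting site changes the weighted sum by at most \<omega>
  per unit, energy that travels far by at most 2 F. The initial temperature enters only through 1 /
  \<beta> \<le> 1 / b.\<close>

lemma thermal_energy_difference:
  assumes \<beta>: "\<And>x. x \<in> {1..N} \<Longrightarrow> b \<le> \<beta> (real x / real N)" and b: "0 < b" and s: "0 \<le> s"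
    and F: "\<And>x. x \<in> {1..N} \<Longrightarrow> \<bar>f (real x / real N)\<bar> \<le> F"
    and \<omega>0: "0 \<le> \<omega>"
    and near: "\<And>i j. i \<in> {1..n} \<Longrightarrow> j \<in> {1..n} \<Longrightarrow> \<not> far i j \<Longrightarrow>
      \<bar>f (real (Suc i div 2) / real N) - f (real (Suc j div 2) / real N)\<bar> \<le> \<omega>"
  shows "\<bar>thermal_energy f \<beta> rr pp mbar N m s - thermal_energy f \<beta> rr pp mbar N m 0\<bar> \<le>
    1 / b * (\<omega> + F / real N * (\<Sum>j=1..n. \<Sum>i\<in>{i \<in> {1..n}. far i j}. transport (real N * s) i j))"
proof -
  let ?s = "real N * s"
  let ?f = "\<lambda>i. f (real (Suc i div 2) / real N)" and ?c = "\<lambda>j. 1 / \<beta> (real (Suc j div 2) / real N)"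
  let ?T = "transport ?s"
  have s': "0 \<le> ?s" using s by simp
  have idx: "Suc i div 2 \<in> {1..N}" if "i \<in> {1..n}" for i using that by (auto simp: n)
  have \<beta>0: "0 < \<beta> (real x / real N)" if "x \<in> {1..N}" for x using \<beta>[OF that] b by linarith
  have c: "0 \<le> ?c j" "?c j \<le> 1 / b" if "j \<in> {1..n}" for j
    using \<beta>[OF idx[OF that]] \<beta>0[OF idx[OF that]] b by (auto intro!: frac_le)
  have F0: "0 \<le> F" using F[of 1] N by (auto intro: order_trans[OF abs_ge_zero])
  have "thermal_energy f \<beta> rr pp mbar N m s - thermal_energy f \<beta> rr pp mbar N m 0 =
    1 / (2 * real N) * ((\<Sum>i=1..n. \<Sum>j=1..n. ?f i * (?T i j * ?c j)) - (\<Sum>i=1..n. \<Sum>j=1..n. ?f i * (transport 0 i j * ?c j)))"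
    using thermal_energy_eq[where \<beta> = \<beta> and f = f and rr = rr and pp = pp and mbar = mbar, OF \<beta>0 s]
      thermal_energy_eq[where \<beta> = \<beta> and f = f and rr = rr and pp = pp and mbar = mbar, OF \<beta>0 order_refl]
    by (simp add: sum_distrib_left right_diff_distrib)
  also have "(\<Sum>i=1..n. \<Sum>j=1..n. ?f i * (transport 0 i j * ?c j)) = (\<Sum>j=1..n. \<Sum>i=1..n. ?f i * (transport 0 i j * ?c j))"
    by (rule sum.swap)
  also have "\<dots> = (\<Sum>j=1..n. \<Sum>i=1..n. if i = j then ?f j * ?c j else 0)"
    by (intro sum.cong refl) (auto simp: transport_0)
  also have "\<dots> = (\<Sum>j=1..n. ?f j * ?c j)"
    by (intro sum.cong refl) simp
  \<comment> \<open>Columns of the transport sum to 1, so the initial energy at j can be distributed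
    over i and compared term by term.\<close>
  also have "\<dots> = (\<Sum>j=1..n. \<Sum>i=1..n. ?f j * (?T i j * ?c j))"
  proof (intro sum.cong refl)
    fix j assume j: "j \<in> {1..n}"
    have "(\<Sum>i=1..n. ?f j * (?T i j * ?c j)) = ?f j * ?c j * (\<Sum>i=1..n. ?T i j)"
      unfolding sum_distrib_left by (intro sum.cong refl) (simp add: mult_ac)
    then show "?f j * ?c j = (\<Sum>i=1..n. ?f j * (?T i j * ?c j))"
      unfolding transport_column[OF j s'] by simp
  qed
  also have "(\<Sum>i=1..n. \<Sum>j=1..n. ?f i * (?T i j * ?c j)) = (\<Sum>j=1..n. \<Sum>i=1..n. ?f i * (?T i j * ?c j))"
    by (rule sum.swap)
  also have "(\<Sum>j=1..n. \<Sum>i=1..n. ?f i * (?T i j * ?c j)) - (\<Sum>j=1..n. \<Sum>i=1..n. ?f j * (?T i j * ?c j)) =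
      (\<Sum>j=1..n. ?c j * (\<Sum>i=1..n. (?f i - ?f j) * ?T i j))"
    unfolding sum_subtractf[symmetric] sum_distrib_left by (intro sum.cong refl) (simp add: algebra_simps diff_divide_distrib)
  finally have eq: "thermal_energy f \<beta> rr pp mbar N m s - thermal_energy f \<beta> rr pp mbar N m 0 =
      1 / (2 * real N) * (\<Sum>j=1..n. ?c j * (\<Sum>i=1..n. (?f i - ?f j) * ?T i j))" .
  have col: "\<bar>\<Sum>i=1..n. (?f i - ?f j) * ?T i j\<bar> \<le> \<omega> + 2 * F * (\<Sum>i\<in>{i \<in> {1..n}. far i j}. ?T i j)"
    if j: "j \<in> {1..n}" for j
  proof -
    have "\<bar>\<Sum>i=1..n. (?f i - ?f j) * ?T i j\<bar> \<le> (\<Sum>i=1..n. \<bar>(?f i - ?f j) * ?T i j\<bar>)" by (rule sum_abs)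
    also have "\<dots> \<le> (\<Sum>i=1..n. \<omega> * ?T i j + (if far i j then 2 * F * ?T i j else 0))"
    proof (rule sum_mono)
      fix i assume i: "i \<in> {1..n}"
      have T0: "0 \<le> ?T i j" by (rule transport_nonneg)
      show "\<bar>(?f i - ?f j) * ?T i j\<bar> \<le> \<omega> * ?T i j + (if far i j then 2 * F * ?T i j else 0)"
      proof (cases "far i j")
        case True
        have "\<bar>?f i - ?f j\<bar> \<le> 2 * F" using F[OF idx[OF i]] F[OF idx[OF j]] by linarith
        then have "\<bar>?f i - ?f j\<bar> * ?T i j \<le> 2 * F * ?T i j" using T0 by (intro mult_right_mono)
        moreover have "0 \<le> \<omega> * ?T i j" using T0 \<omega>0 by simp
        ultimately show ?thesis using True T0 by (simp add: abs_mult)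
      next
        case False
        have "\<bar>?f i - ?f j\<bar> \<le> \<omega>" by (rule near[OF i j False])
        then have "\<bar>?f i - ?f j\<bar> * ?T i j \<le> \<omega> * ?T i j" using T0 by (intro mult_right_mono)
        then show ?thesis using False T0 by (simp add: abs_mult)
      qed
    qed
    also have "\<dots> = \<omega> + (\<Sum>i=1..n. if far i j then 2 * F * ?T i j else 0)"
      unfolding sum.distrib sum_distrib_left[symmetric] transport_column[OF j s'] by simp
    also have "(\<Sum>i=1..n. if far i j then 2 * F * ?T i j else 0) = 2 * F * (\<Sum>i\<in>{i \<in> {1..n}. far i j}. ?T i j)"
      unfolding sum_distrib_left by (subst sum.inter_filter) auto
    finally show ?thesis .
  qed
  let ?S = "\<lambda>j. \<Sum>i\<in>{i \<in> {1..n}. far i j}. ?T i j"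
  have S0: "0 \<le> ?S j" for j by (intro sum_nonneg transport_nonneg)
  have n2: "real n \<le> 2 * real N" unfolding n by linarith
  have "\<bar>\<Sum>j=1..n. ?c j * (\<Sum>i=1..n. (?f i - ?f j) * ?T i j)\<bar> \<le> (\<Sum>j=1..n. \<bar>?c j * (\<Sum>i=1..n. (?f i - ?f j) * ?T i j)\<bar>)"
    by (rule sum_abs)
  also have "\<dots> \<le> (\<Sum>j=1..n. 1 / b * (\<omega> + 2 * F * ?S j))"
    unfolding abs_mult using c b by (intro sum_mono mult_mono col) auto
  also have "\<dots> = 1 / b * (real n * \<omega> + 2 * F * (\<Sum>j=1..n. ?S j))"
    unfolding sum_distrib_left[symmetric] sum.distrib by simp
  also have "\<dots> \<le> 1 / b * (2 * real N * \<omega> + 2 * F * (\<Sum>j=1..n. ?S j))"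
    using b n2 \<omega>0 by (intro mult_left_mono add_right_mono mult_right_mono) auto
  finally have le: "\<bar>\<Sum>j=1..n. ?c j * (\<Sum>i=1..n. (?f i - ?f j) * ?T i j)\<bar> \<le> 1 / b * (2 * real N * \<omega> + 2 * F * (\<Sum>j=1..n. ?S j))" .
  have "\<bar>thermal_energy f \<beta> rr pp mbar N m s - thermal_energy f \<beta> rr pp mbar N m 0\<bar> \<le>
      1 / (2 * real N) * (1 / b * (2 * real N * \<omega> + 2 * F * (\<Sum>j=1..n. ?S j)))"
    unfolding eq abs_mult using le N by (intro mult_mono) auto
  also have "\<dots> = 1 / b * (\<omega> + F / real N * (\<Sum>j=1..n. ?S j))"
    using N b by (simp add: field_simps)
  finally show ?thesis .
qed

end

section \<open>Transport between far sites\<close>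

context weighted_chain
begin

lemma norm_res_basis: "i \<in> {1..n} \<Longrightarrow> j \<in> {1..n} \<Longrightarrow> cmod (res \<zeta> (basis j) i) = cmod (green (\<lambda>k. \<zeta> * d k) n i j) * d j"
  using d_pos[of j] by (simp add: res_basis norm_mult)

lemma norm_res_basis_uminus:
  assumes "i \<in> {1..n}" "j \<in> {1..n}"
  shows "cmod (res (- \<zeta>) (basis j) i) = cmod (res \<zeta> (basis j) i)"
  unfolding norm_res_basis[OF assms] using norm_green_uminus[of "\<lambda>k. \<zeta> * d k" n i j] by simp

lemma entry_le_sqrt_nrm2:
  assumes "i \<in> {1..n}" "nrm2 w \<le> du * c\<^sup>2" "0 \<le> c"
  shows "cmod (w i) \<le> sqrt (du / dl) * c"
proof -
  have "dl * (cmod (w i))\<^sup>2 \<le> d i * (cmod (w i))\<^sup>2"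
    using d_bounds[of i] by (intro mult_right_mono) auto
  also have "\<dots> \<le> du * c\<^sup>2" using nrm2_entry[OF assms(1), of w] assms(2) by linarith
  finally have "(cmod (w i))\<^sup>2 \<le> du / dl * c\<^sup>2" using dl by (simp add: field_simps)
  then have "sqrt ((cmod (w i))\<^sup>2) \<le> sqrt (du / dl * c\<^sup>2)" by (rule real_sqrt_le_mono)
  also have "sqrt (du / dl * c\<^sup>2) = sqrt (du / dl) * c"
    using assms(3) by (simp only: real_sqrt_mult real_sqrt_abs abs_of_nonneg)
  finally show ?thesis by simp
qed

lemma norm_res_basis_le:
  assumes "i \<in> {1..n}" "j \<in> {1..n}" "\<bar>Re \<zeta>\<bar> = \<eta>" "0 < \<eta>"
  shows "cmod (res \<zeta> (basis j) i) \<le> sqrt (du / dl) / \<eta>"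
proof -
  have *: "cmod (res \<zeta> (basis j) i) \<le> sqrt (du / dl) / \<eta>" if "Re \<zeta> = \<eta>" for \<zeta>
  proof -
    have "nrm2 (res \<zeta> (basis j)) \<le> nrm2 (basis j) / \<eta>\<^sup>2"
      using nrm2_res_le[of \<zeta> "basis j"] det_nonzero[of \<zeta>] that assms(4) by simp
    also have "\<dots> \<le> du / \<eta>\<^sup>2" using d_bounds[of j] assms(4) by (simp add: nrm2_basis[OF assms(2)] divide_right_mono)
    also have "\<dots> = du * (1 / \<eta>)\<^sup>2" by (simp add: power_divide)
    finally show ?thesis using entry_le_sqrt_nrm2[OF assms(1), of "res \<zeta> (basis j)" "1 / \<eta>"] assms(4) by simp
  qed
  show ?thesis
  proof (cases "Re \<zeta> = \<eta>")
    case False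
    then have "Re (- \<zeta>) = \<eta>" using assms(3,4) by (auto simp: abs_if split: if_splits)
    from *[OF this] show ?thesis using norm_res_basis_uminus[OF assms(1,2)] by simp
  qed (rule *)
qed

text \<open>The resolvent identity gives the Lipschitz constant 1 / \<eta>^2, polynomial in N; this
  is why finitely many points on the contour suffice.\<close>

lemma res_basis_lipschitz:
  assumes i: "i \<in> {1..n}" and j: "j \<in> {1..n}" and \<zeta>: "Re \<zeta> = \<eta>" "Re \<zeta>' = \<eta>" "0 < \<eta>"
  shows "cmod (res \<zeta> (basis j) i) \<le> cmod (res \<zeta>' (basis j) i) + cmod (\<zeta> - \<zeta>') * (sqrt (du / dl) / \<eta>\<^sup>2)"
proof (cases "\<zeta> = \<zeta>'")
  case False
  have det: "det \<zeta> \<noteq> 0" "det \<zeta>' \<noteq> 0" using \<zeta> det_nonzero[of \<zeta>] det_nonzero[of \<zeta>'] by auto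
  let ?y = "res \<zeta> (res \<zeta>' (basis j))"
  have "nrm2 ?y \<le> nrm2 (res \<zeta>' (basis j)) / \<eta>\<^sup>2"
    using nrm2_res_le[OF det(1), of "res \<zeta>' (basis j)"] \<zeta> by simp
  also have "\<dots> \<le> (nrm2 (basis j) / \<eta>\<^sup>2) / \<eta>\<^sup>2"
    using nrm2_res_le[OF det(2), of "basis j"] \<zeta> by (intro divide_right_mono) auto
  also have "\<dots> \<le> (du / \<eta>\<^sup>2) / \<eta>\<^sup>2"
    using d_bounds[of j] by (simp add: nrm2_basis[OF j] divide_right_mono)
  also have "\<dots> = du * (1 / \<eta>\<^sup>2)\<^sup>2" by (simp add: power_divide power2_eq_square)
  finally have y: "cmod (?y i) \<le> sqrt (du / dl) / \<eta>\<^sup>2"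
    using entry_le_sqrt_nrm2[OF i, of ?y "1 / \<eta>\<^sup>2"] by simp
  have "?y i = (res \<zeta>' (basis j) i - res \<zeta> (basis j) i) / (\<zeta> - \<zeta>')"
    by (rule res_res_identity[OF det False supported_basis[OF j]])
  then have "res \<zeta> (basis j) i = res \<zeta>' (basis j) i - (\<zeta> - \<zeta>') * ?y i"
    using False by simp
  then have "cmod (res \<zeta> (basis j) i) \<le> cmod (res \<zeta>' (basis j) i) + cmod ((\<zeta> - \<zeta>') * ?y i)"
    by (metis norm_triangle_ineq4)
  also have "cmod ((\<zeta> - \<zeta>') * ?y i) \<le> cmod (\<zeta> - \<zeta>') * (sqrt (du / dl) / \<eta>\<^sup>2)"
    unfolding norm_mult using y by (intro mult_left_mono) auto
  finally show ?thesis by simp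
qed simp

lemma norm_res_basis_large:
  assumes i: "i \<in> {1..n}" and j: "j \<in> {1..n}" and \<zeta>: "3 \<le> dl * cmod \<zeta>"
    and far: "i + Suc D \<le> j \<or> j + Suc D \<le> i"
  shows "cmod (res \<zeta> (basis j) i) \<le> du / 2 ^ D"
proof -
  let ?a = "\<lambda>k. \<zeta> * of_real (d k)"
  have large: "3 \<le> cmod (?a k)" for k
  proof -
    have "dl * cmod \<zeta> \<le> d k * cmod \<zeta>" using d_bounds[of k] by (intro mult_right_mono) auto
    then show ?thesis using \<zeta> d_pos[of k] by (simp add: norm_mult mult.commute)
  qed
  have *: "cmod (green ?a n i j) \<le> 1 / 2 ^ D" if i: "i \<in> {1..n}" and j: "j \<in> {1..n}" and ij: "i + Suc D \<le> j" for i j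
  proof -
    define p where "p = j - i - 1"
    have p: "j - i = Suc p" "D \<le> p" using ij unfolding p_def by auto
    have "cmod (green ?a n i j) \<le> 1 / (1\<^sup>2 * cmod (continuant ?a (Suc i) (j - i)))"
      by (rule continuant_cut_bound_imp_green)
        (use i j ij norm_continuant_cut_large[OF large] continuant_large_nonzero[OF large] in \<open>auto simp del: continuant.simps\<close>)
    also have "\<dots> \<le> 1 / 2 ^ D"
    proof -
      have "(2::real) ^ D \<le> 2 ^ p" using p by (intro power_increasing) auto
      also have "\<dots> \<le> cmod (continuant ?a (Suc i) (j - i))"
        unfolding p(1) by (rule continuant_large_growth[OF large])
      finally have "1 / cmod (continuant ?a (Suc i) (j - i)) \<le> 1 / 2 ^ D" by (intro frac_le) simp_all
      then show ?thesis by simp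
    qed
    finally show ?thesis .
  qed
  have "cmod (green ?a n i j) \<le> 1 / 2 ^ D"
    using far *[OF i j] *[OF j i] norm_green_commute[of ?a n i j] by auto
  then have "cmod (green ?a n i j) * d j \<le> 1 / 2 ^ D * du"
    using d_bounds[of j] d_pos[of j] by (intro mult_mono) auto
  then show ?thesis unfolding norm_res_basis[OF i j] by simp
qed

text \<open>The filtered part is controlled entrywise, the remaining low-frequency part in norm.\<close>

lemma far_transport_le:
  assumes \<epsilon>: "0 < \<epsilon>" and s: "0 \<le> s" and j: "j \<in> {1..n}" and A: "A \<subseteq> {1..n}"
    and B: "\<And>i. i \<in> A \<Longrightarrow> cmod (flow (of_real s) ((high \<epsilon> ^^ k) (basis j)) i) \<le> B"
  shows "(\<Sum>i\<in>A. transport s i j) \<le>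
    2 / dl * (n * du * B\<^sup>2 + (real k)\<^sup>2 * nrm2 (\<lambda>i. \<epsilon> * res \<epsilon> (basis j) i))"
proof -
  let ?h = "(high \<epsilon> ^^ k) (basis j)"
  let ?e = "\<lambda>i. basis j i - ?h i"
  have sb: "supported (basis j)" by (rule supported_basis[OF j])
  have sh: "supported ?h" by (rule supported_high_pow[OF sb])
  have se: "supported ?e" using sb sh by (simp add: supported_def)
  have fA: "finite A" using A finite_subset by blast
  have split: "\<Phi> s i j = flow (of_real s) ?h i + flow (of_real s) ?e i" for i
    using flow_diff[OF sb sh, of "of_real s" i] by (simp add: \<Phi>_def)
  have entry: "transport s i j \<le> 2 / dl * (du * B\<^sup>2 + d i * (cmod (flow (of_real s) ?e i))\<^sup>2)" if i: "i \<in> A" for i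
  proof -
    let ?x = "cmod (flow (of_real s) ?h i)" and ?y = "cmod (flow (of_real s) ?e i)"
    have "(cmod (\<Phi> s i j))\<^sup>2 \<le> (?x + ?y)\<^sup>2"
      unfolding split by (intro power_mono norm_triangle_ineq) auto
    also have "\<dots> \<le> 2 * ?x\<^sup>2 + 2 * ?y\<^sup>2"
      using sum_squares_bound[of ?x ?y] by (simp add: power2_sum)
    also have "\<dots> \<le> 2 * B\<^sup>2 + 2 * ?y\<^sup>2"
      using B[OF i] by (intro add_right_mono mult_left_mono power_mono) auto
    finally have "d i * (cmod (\<Phi> s i j))\<^sup>2 \<le> d i * (2 * B\<^sup>2 + 2 * ?y\<^sup>2)"
      using d_pos[of i] by (intro mult_left_mono) auto
    also have "\<dots> \<le> 2 * (du * B\<^sup>2 + d i * ?y\<^sup>2)"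
      using mult_right_mono[of "d i" du "B\<^sup>2"] d_bounds[of i] by (simp add: algebra_simps)
    finally have le: "d i * (cmod (\<Phi> s i j))\<^sup>2 \<le> 2 * (du * B\<^sup>2 + d i * ?y\<^sup>2)" .
    have "transport s i j \<le> d i * (cmod (\<Phi> s i j))\<^sup>2 / dl"
      unfolding transport_def using d_bounds[of j] dl d_pos[of i] by (intro divide_left_mono) auto
    also have "\<dots> \<le> 2 * (du * B\<^sup>2 + d i * ?y\<^sup>2) / dl" using le dl by (intro divide_right_mono) auto
    finally show ?thesis by simp
  qed
  have "(\<Sum>i\<in>A. transport s i j) \<le> (\<Sum>i\<in>A. 2 / dl * (du * B\<^sup>2 + d i * (cmod (flow (of_real s) ?e i))\<^sup>2))"
    by (intro sum_mono entry)
  also have "\<dots> \<le> (\<Sum>i=1..n. 2 / dl * (du * B\<^sup>2 + d i * (cmod (flow (of_real s) ?e i))\<^sup>2))"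
    using A dl du d_pos by (intro sum_mono2) (auto intro!: mult_nonneg_nonneg add_nonneg_nonneg simp: less_imp_le)
  also have "\<dots> = 2 / dl * (n * du * B\<^sup>2 + nrm2 (flow (of_real s) ?e))"
    unfolding sum_distrib_left[symmetric] sum.distrib nrm2_def by simp
  also have "nrm2 (flow (of_real s) ?e) = nrm2 ?e" by (rule nrm2_flow[OF se s])
  also have "2 / dl * (n * du * B\<^sup>2 + nrm2 ?e) \<le> 2 / dl * (n * du * B\<^sup>2 + (real k)\<^sup>2 * nrm2 (\<lambda>i. \<epsilon> * res \<epsilon> (basis j) i))"
    using nrm2_high_pow_error[OF \<epsilon>] dl by (intro mult_left_mono add_left_mono) auto
  finally show ?thesis .
qed

lemma sum_low_norm:
  assumes \<epsilon>: "0 < \<epsilon>" "\<epsilon> \<le> 1"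
  shows "(\<Sum>j=1..n. nrm2 (\<lambda>i. \<epsilon> * res \<epsilon> (basis j) i)) \<le> n * (2 * \<epsilon> * du\<^sup>2 * (1 / dl + 2 * du)) + 4 * du / \<epsilon>"
proof -
  \<comment> \<open>L of order 1 / \<epsilon> balances the two terms 1 / (L \<epsilon>) and L
    \<epsilon> of the diagonal bound.\<close>
  define L where "L = nat \<lceil>1 / \<epsilon>\<rceil>"
  let ?E = "\<lambda>j. nrm2 (\<lambda>i. \<epsilon> * res \<epsilon> (basis j) i)"
  have L: "1 / \<epsilon> \<le> real L" "real L \<le> 1 / \<epsilon> + 1" 
  proof -
    have "0 < 1 / \<epsilon>" using \<epsilon> by simp
    then have "0 \<le> \<lceil>1 / \<epsilon>\<rceil>" by linarith
    then have "real L = of_int \<lceil>1 / \<epsilon>\<rceil>" by (simp add: L_def)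
    then show "1 / \<epsilon> \<le> real L" "real L \<le> 1 / \<epsilon> + 1" by linarith+
  qed
  have "1 \<le> 1 / \<epsilon>" using \<epsilon> by simp
  with L have L2: "real L \<le> 2 / \<epsilon>" "0 < L" by (auto simp: field_simps)
  have L\<epsilon>: "1 \<le> L * \<epsilon>" "L * \<epsilon> \<le> 2" using L(1) L2(1) \<epsilon> by (auto simp: field_simps)
  let ?C = "2 * \<epsilon> * du\<^sup>2 * (1 / dl + 2 * du)"
  have C0: "0 \<le> ?C" using \<epsilon> dl du by auto
  \<comment> \<open>Within 2 L sites of the right end there is no room for the averaging window; the
    trivial bound is used there, and these sites cost at most 2 L du in total.\<close>
  have main: "?E j \<le> ?C + (if n < j + 2 * L then du else 0)" if j: "j \<in> {1..n}" for j
  proof (cases "n < j + 2 * L")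
    case True
    then show ?thesis using nrm2_low_basis_trivial[OF \<epsilon>(1) j] C0 by simp
  next
    case False
    have "?E j = \<epsilon> * d j * Re (res \<epsilon> (basis j) j)" by (rule nrm2_low_basis[OF \<epsilon>(1) j])
    also have "\<dots> \<le> \<epsilon> * d j * (2 * du * (1 / (dl * L * \<epsilon>) + L * \<epsilon> * du))"
      using res_basis_diagonal_bound[OF \<epsilon>(1) j L2(2)] False \<epsilon> d_pos[of j] by (intro mult_left_mono) auto
    also have "\<dots> \<le> \<epsilon> * du * (2 * du * (1 / dl + 2 * du))"
    proof (intro mult_mono add_mono mult_left_mono)
      have "dl * 1 \<le> dl * (L * \<epsilon>)" using L\<epsilon> dl by (intro mult_left_mono) auto
      then show "1 / (dl * L * \<epsilon>) \<le> 1 / dl" using dl by (intro frac_le) (auto simp: mult.assoc)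
    qed (use \<epsilon> du dl d_bounds[of j] d_pos[of j] L\<epsilon> L2 in auto)
    finally show ?thesis using False by (simp add: power2_eq_square mult_ac)
  qed
  have "(\<Sum>j=1..n. ?E j) \<le> (\<Sum>j=1..n. ?C + (if n < j + 2 * L then du else 0))" by (intro sum_mono main)
  also have "\<dots> = n * ?C + (\<Sum>j=1..n. if n < j + 2 * L then du else 0)" by (simp add: sum.distrib)
  also have "(\<Sum>j=1..n. if n < j + 2 * L then du else 0) = (\<Sum>j\<in>{j \<in> {1..n}. n < j + 2 * L}. du)"
    by (subst sum.inter_filter) auto
  also have "\<dots> = card {j \<in> {1..n}. n < j + 2 * L} * du" by simp
  also have "\<dots> \<le> (2 * L) * du"
  proof (intro mult_right_mono)
    have "{j \<in> {1..n}. n < j + 2 * L} \<subseteq> {n + 1 - 2 * L..n}" by auto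
    then have "card {j \<in> {1..n}. n < j + 2 * L} \<le> card {n + 1 - 2 * L..n}" by (intro card_mono) auto
    also have "\<dots> \<le> 2 * L" by simp
    finally show "real (card {j \<in> {1..n}. n < j + 2 * L}) \<le> real (2 * L)" by simp
  qed (use du in auto)
  also have "(2 * L) * du \<le> 4 * du / \<epsilon>"
    using mult_right_mono[OF L2(1), of "2 * du"] du by (simp add: mult_ac)
  finally show ?thesis by simp
qed

end

text \<open>The distance 2 R + 3 leaves at least R whole mass-spring pairs strictly between the two
  sites, whatever their parities.\<close>

definition far :: "nat \<Rightarrow> nat \<Rightarrow> nat \<Rightarrow> bool" where
  "far R i j \<longleftrightarrow> i + (2 * R + 3) \<le> j \<or> j + (2 * R + 3) \<le> i"

definition grid :: "real \<Rightarrow> real \<Rightarrow> nat \<Rightarrow> nat \<Rightarrow> complex" where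
  "grid \<eta> Y Q g = Complex \<eta> (2 * Y * real g / real Q - Y)"

lemma grid_close:
  assumes "0 < Y" "1 \<le> Q" "Re \<zeta> = \<eta>" "\<bar>Im \<zeta>\<bar> \<le> Y"
  obtains g where "g \<le> Q" "cmod (\<zeta> - grid \<eta> Y Q g) \<le> 2 * Y / Q"
proof -
  define t where "t = (Im \<zeta> + Y) * Q / (2 * Y)"
  define g where "g = nat \<lfloor>t\<rfloor>"
  have t: "0 \<le> t" "t \<le> Q" 
  proof -
    have "0 \<le> Im \<zeta> + Y" "Im \<zeta> + Y \<le> 2 * Y" using assms(4) by (auto simp: abs_le_iff)
    then show "0 \<le> t" "t \<le> Q"
      using assms(1) mult_right_mono[of "Im \<zeta> + Y" "2 * Y" "real Q"]
      by (auto simp: t_def pos_divide_le_eq mult.commute intro!: divide_nonneg_pos)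
  qed
  have g: "real g \<le> t" "t < real g + 1" using t(1) unfolding g_def by linarith+
  have "g \<le> Q" using g t by linarith
  moreover have "cmod (\<zeta> - grid \<eta> Y Q g) \<le> 2 * Y / Q"
  proof -
    have "\<zeta> - grid \<eta> Y Q g = Complex 0 (Im \<zeta> - (2 * Y * real g / real Q - Y))"
      using assms by (simp add: grid_def complex_eq_iff)
    moreover have "cmod (Complex 0 y) = \<bar>y\<bar>" for y by (simp add: cmod_def)
    ultimately have "cmod (\<zeta> - grid \<eta> Y Q g) = \<bar>Im \<zeta> - (2 * Y * real g / real Q - Y)\<bar>"
      by (simp only:)
    also have "Im \<zeta> - (2 * Y * real g / real Q - Y) = Im \<zeta> + Y - 2 * Y * real g / real Q" by simp
    also have "Im \<zeta> + Y - 2 * Y * real g / real Q = (2 * Y / Q) * (t - g)"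
      using assms by (simp add: t_def field_simps)
    also have "\<bar>(2 * Y / Q) * (t - g)\<bar> \<le> 2 * Y / Q * 1"
      unfolding abs_mult using g assms by (intro mult_mono) auto
    finally show ?thesis by simp
  qed
  ultimately show thesis using that by blast
qed

section \<open>From small overlaps to small flow between far sites\<close>

context mass_chain
begin

text \<open>A small overlap forces the block determinant to be at least c^2 / (2 \<tau>), as
  otherwise a polydisc that is too large would be mapped into the unit one. The six powers of c come
  in pairs: from this bound, from trimming the block to whole pairs, and from the two cuts at i and
  j.\<close>

lemma green_overlap_bound:
  assumes \<zeta>: "0 < Re \<zeta>" "Re \<zeta> \<le> 1" and \<tau>: "0 < \<tau>" "\<tau> < 1" and R: "1 \<le> R"
    and ov: "\<And>x l. R \<le> l \<Longrightarrow> x + l \<le> N \<Longrightarrow> overlap \<zeta> m x l \<le> ennreal (\<tau> ^ 4)"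
    and i: "i \<in> {1..n}" and j: "j \<in> {1..n}" and far: "i + (2 * R + 3) \<le> j"
  shows "cmod (green (\<lambda>k. \<zeta> * site_weight m k) n i j) \<le> 2 * \<tau> / (Re \<zeta> * dl) ^ 6"
proof -
  let ?a = "\<lambda>k. \<zeta> * of_real (site_weight m k)"
  define c where "c = Re \<zeta> * dl"
  have c: "0 < c" "c \<le> 1" using \<zeta> dl by (auto simp: c_def mult_le_one)
  have Re: "c \<le> Re (?a k)" for k using d_bounds[of k] \<zeta> by (simp add: c_def)
  \<comment> \<open>i / 2 is rounded up and (j - 1) / 2 down, so the sites 2 x + 1, ..., 2 y are the
    whole pairs between i and j; e and e' count the site possibly lost at either end.\<close>
  define x where "x = Suc i div 2"
  define y where "y = (j - 1) div 2"
  define l where "l = y - x"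
  define e where "e = 2 * x - i"
  define e' where "e' = (j - 1) - 2 * y"
  have x: "i \<le> 2 * x" "2 * x \<le> Suc i" unfolding x_def by linarith+
  have y: "2 * y \<le> j - 1" "j - 1 \<le> Suc (2 * y)" unfolding y_def by linarith+
  have xy: "x + R \<le> y" using x y far by linarith
  have xl: "x + l = y" "R \<le> l" "e \<le> 1" "e' \<le> 1" "Suc i + e = 2 * x + 1"
    using x y xy unfolding l_def e_def e'_def by linarith+
  have blk: "j - i = Suc (2 * l) + e + e'"
    using x y xy far unfolding l_def e_def e'_def by linarith
  have xN: "x + l \<le> N" using xl(1) y j by (auto simp: n)
  let ?D = "cmod (continuant ?a (2 * x + 1) (2 * l + 1))"
  have D: "0 < ?D" using continuant_nonzero[where a = ?a and i = "2 * x + 1" and n = "2 * l", OF c(1) Re] by simp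
  define r where "r = min 1 (c\<^sup>2 / (2 * ?D))"
  have "ennreal ((pi * r\<^sup>2)\<^sup>2) \<le> ennreal (\<tau> ^ 4)"
    using overlap_lower_bound[where \<zeta> = \<zeta> and m = m and c = c and l = l and x = x, OF c(1) Re c(2)] ov[OF xl(2) xN] R xl(2)
    unfolding r_def by (meson order_trans)
  then have "(pi * r\<^sup>2)\<^sup>2 \<le> \<tau> ^ 4" using \<tau> by (simp add: ennreal_le_iff)
  moreover have "(r\<^sup>2)\<^sup>2 \<le> (pi * r\<^sup>2)\<^sup>2"
    using pi_gt3 mult_right_mono[of 1 pi "r\<^sup>2"] by (intro power_mono) auto
  ultimately have r4: "r ^ 4 \<le> \<tau> ^ 4" by (simp add: power_mult[symmetric])
  have r0: "0 \<le> r" using D c by (simp add: r_def)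
  have "r \<le> \<tau>" using power_le_imp_le_base[of r 3 \<tau>] r4 \<tau> by simp
  \<comment> \<open>As r \<le> \<tau> < 1, the minimum defining r is not 1.\<close>
  then have "r = c\<^sup>2 / (2 * ?D)" using \<tau> unfolding r_def by (auto simp: min_def split: if_splits)
  with \<open>r \<le> \<tau>\<close> have Dl: "c\<^sup>2 / (2 * \<tau>) \<le> ?D" using D \<tau> by (simp add: field_simps)
  have "c\<^sup>2 * ?D \<le> cmod (continuant ?a (Suc i) (Suc (2 * l) + e + e'))"
    using norm_continuant_subblock[where a = ?a and c = c and b = "Suc i" and e = e and e' = e' and l = "2 * l", OF c(1) Re c(2) xl(3,4)]
    unfolding xl(5) by simp
  then have K: "c\<^sup>2 * ?D \<le> cmod (continuant ?a (Suc i) (j - i))" unfolding blk .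
  have "cmod (green ?a n i j) \<le> 1 / (c\<^sup>2 * cmod (continuant ?a (Suc i) (j - i)))"
  proof (rule continuant_cut_bound_imp_green[OF c(1)])
    show "c * cmod (continuant ?a b (Suc p) * continuant ?a (Suc (b + p)) (Suc q)) \<le> cmod (continuant ?a b (Suc (Suc (p + q))))" for b p q
      by (rule norm_continuant_cut[OF c(1) Re])
    show "continuant ?a b (Suc p) \<noteq> 0" for b p by (rule continuant_nonzero[OF c(1) Re])
  qed (use i j far in auto)
  also have "\<dots> \<le> 1 / (c\<^sup>2 * (c\<^sup>2 * (c\<^sup>2 / (2 * \<tau>))))"
  proof -
    have "c\<^sup>2 * (c\<^sup>2 / (2 * \<tau>)) \<le> c\<^sup>2 * ?D" using Dl by (intro mult_left_mono) auto
    then have "c\<^sup>2 * (c\<^sup>2 / (2 * \<tau>)) \<le> cmod (continuant ?a (Suc i) (j - i))" using K by linarith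
    then have "c\<^sup>2 * (c\<^sup>2 * (c\<^sup>2 / (2 * \<tau>))) \<le> c\<^sup>2 * cmod (continuant ?a (Suc i) (j - i))"
      by (intro mult_left_mono) auto
    moreover have "0 < c\<^sup>2 * (c\<^sup>2 * (c\<^sup>2 / (2 * \<tau>)))" using c \<tau> by simp
    ultimately show ?thesis by (intro frac_le) simp_all
  qed
  also have "\<dots> = 2 * \<tau> / c ^ 6" using c \<tau> by (simp add: power_add[symmetric])
  finally show ?thesis by (simp add: c_def)
qed

text \<open>The three terms belong to three pieces of the contour: the horizontal edges, where
  diagonal dominance gives decay in the distance; the vertical part with |\<zeta>| < \<nu>, where
  the zero of the filter compensates the bound 1 / \<eta>; and the remaining vertical part, handled
  by the overlap at the nearest grid point plus a Lipschitz error.\<close>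

lemma far_flow_bound:
  assumes \<eta>: "0 < \<eta>" "2 * \<eta> \<le> \<epsilon>" and \<epsilon>: "\<epsilon> \<le> 1" and \<nu>: "0 < \<nu>" and Y: "2 \<le> Y" "3 \<le> dl * Y"
    and Q: "1 \<le> Q" "4 * Y / Q \<le> \<nu>" and \<tau>: "0 < \<tau>" "\<tau> < 1" and R: "1 \<le> R"
    and ov: "\<And>g x l. g \<le> Q \<Longrightarrow> \<nu> / 2 \<le> cmod (grid \<eta> Y Q g) \<Longrightarrow> R \<le> l \<Longrightarrow> x + l \<le> N \<Longrightarrow>
      overlap (grid \<eta> Y Q g) m x l \<le> ennreal (\<tau> ^ 4)"
    and i: "i \<in> {1..n}" and j: "j \<in> {1..n}" and far: "far R i j" and s: "0 \<le> s"
  shows "cmod (flow (of_real s) ((high \<epsilon> ^^ k) (basis j)) i) \<le> exp (s * \<eta>) *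
    (2 ^ k * (du / 2 ^ (2 * R + 2)) + (2 * \<nu> / \<epsilon>) ^ k * (sqrt (du / dl) / \<eta>) +
     (2 * (Y + 1) / \<epsilon>) ^ k * (2 * du * \<tau> / (\<eta> * dl) ^ 6 + 2 * Y / Q * (sqrt (du / dl) / \<eta>\<^sup>2))) * (\<eta> + Y)"
proof (rule flow_filtered_bound[OF \<eta>(1) _ Y(2) _ s supported_basis[OF j]])
  let ?B1 = "2 ^ k * (du / 2 ^ (2 * R + 2))" and ?B2 = "(2 * \<nu> / \<epsilon>) ^ k * (sqrt (du / dl) / \<eta>)"
  let ?\<xi> = "2 * du * \<tau> / (\<eta> * dl) ^ 6 + 2 * Y / Q * (sqrt (du / dl) / \<eta>\<^sup>2)"
  let ?B3 = "(2 * (Y + 1) / \<epsilon>) ^ k * ?\<xi>"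
  have \<epsilon>0: "0 < \<epsilon>" using \<eta> by linarith
  show "0 < Y" "\<eta> < \<epsilon>" using Y \<eta> by linarith+
  have \<xi>0: "0 \<le> ?\<xi>" using du dl \<tau> \<eta> Y by (intro add_nonneg_nonneg divide_nonneg_nonneg mult_nonneg_nonneg) auto
  have nn: "0 \<le> ?B1" "0 \<le> ?B2" "0 \<le> ?B3"
    using du dl \<eta> \<epsilon>0 \<nu> Y \<xi>0 by (auto intro!: mult_nonneg_nonneg zero_le_power divide_nonneg_nonneg simp del: power_divide)
  fix \<zeta> assume "\<zeta> \<in> path_image (rectpath (Complex (- \<eta>) (- Y)) (Complex \<eta> Y))"
  then have cases: "\<bar>Re \<zeta>\<bar> = \<eta> \<and> \<bar>Im \<zeta>\<bar> \<le> Y \<or> \<bar>Im \<zeta>\<bar> = Y \<and> \<bar>Re \<zeta>\<bar> \<le> \<eta>"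
    unfolding path_image_rect[OF \<eta>(1) \<open>0 < Y\<close> Y(2)] by auto
  have h: "cmod (\<zeta> / (\<zeta> - of_real \<epsilon>)) \<le> t" if "q * t \<ge> cmod \<zeta>" "q \<le> cmod (\<zeta> - of_real \<epsilon>)" "0 < q" "0 \<le> t" for q t
  proof -
    have "cmod \<zeta> \<le> cmod (\<zeta> - of_real \<epsilon>) * t" using that mult_right_mono[of q "cmod (\<zeta> - of_real \<epsilon>)" t] by linarith
    moreover have "0 < cmod (\<zeta> - of_real \<epsilon>)" using that by linarith
    ultimately show ?thesis by (simp only: norm_divide pos_divide_le_eq mult.commute)
  qed
  have prod: "cmod ((\<zeta> / (\<zeta> - of_real \<epsilon>)) ^ k * res \<zeta> (basis j) i) \<le> t ^ k * b"
    if "cmod (\<zeta> / (\<zeta> - of_real \<epsilon>)) \<le> t" "cmod (res \<zeta> (basis j) i) \<le> b" for t b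
    unfolding norm_mult norm_power using that by (intro mult_mono power_mono zero_le_power) (auto intro: order_trans[OF norm_ge_zero])
  show "cmod ((\<zeta> / (\<zeta> - of_real \<epsilon>)) ^ k * res \<zeta> (basis j) i) \<le> ?B1 + ?B2 + ?B3"
  proof (cases "\<bar>Im \<zeta>\<bar> = Y")
    case True
    have "Y \<le> cmod \<zeta>" using abs_Im_le_cmod[of \<zeta>] True by simp
    then have big: "3 \<le> dl * cmod \<zeta>" "2 * \<epsilon> \<le> cmod \<zeta>" using Y \<epsilon> mult_left_mono[of Y "cmod \<zeta>" dl] dl by linarith+
    have "cmod \<zeta> - \<epsilon> \<le> cmod (\<zeta> - of_real \<epsilon>)" using norm_triangle_ineq2[of \<zeta> "of_real \<epsilon>"] \<epsilon>0 by simp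
    then have "cmod (\<zeta> / (\<zeta> - of_real \<epsilon>)) \<le> 2"
      using big \<epsilon>0 by (intro h[of "cmod \<zeta> / 2"]) auto
    moreover have "cmod (res \<zeta> (basis j) i) \<le> du / 2 ^ (2 * R + 2)"
      using far by (intro norm_res_basis_large[OF i j big(1)]) (auto simp: far_def)
    ultimately have "cmod ((\<zeta> / (\<zeta> - of_real \<epsilon>)) ^ k * res \<zeta> (basis j) i) \<le> ?B1" by (rule prod)
    then show ?thesis using nn by linarith
  next
    case False
    then have vert: "\<bar>Re \<zeta>\<bar> = \<eta>" "\<bar>Im \<zeta>\<bar> \<le> Y" using cases by auto
    \<comment> \<open>The pole \<epsilon> of the filter keeps distance \<epsilon> / 2 from both
      vertical edges since 2 \<eta> \<le> \<epsilon>.\<close>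
    have "\<epsilon> / 2 \<le> \<bar>Re (\<zeta> - of_real \<epsilon>)\<bar>" using vert(1) \<eta> by (auto simp: abs_if split: if_splits)
    then have dist: "\<epsilon> / 2 \<le> cmod (\<zeta> - of_real \<epsilon>)" using abs_Re_le_cmod order_trans by blast
    show ?thesis
    proof (cases "cmod \<zeta> < \<nu>")
      case True
      have "cmod (\<zeta> / (\<zeta> - of_real \<epsilon>)) \<le> 2 * \<nu> / \<epsilon>"
        using True \<epsilon>0 \<nu> by (intro h[OF _ dist]) auto
      from prod[OF this norm_res_basis_le[OF i j vert(1) \<eta>(1)]] show ?thesis using nn by linarith
    next
      case large: False
      have "cmod \<zeta> \<le> Y + 1" using cmod_le[of \<zeta>] vert \<eta> \<epsilon> by linarith
      then have h3: "cmod (\<zeta> / (\<zeta> - of_real \<epsilon>)) \<le> 2 * (Y + 1) / \<epsilon>"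
        using \<epsilon>0 Y by (intro h[OF _ dist]) auto
      have *: "cmod (res \<zeta> (basis j) i) \<le> ?\<xi>" if \<zeta>': "Re \<zeta> = \<eta>" "\<bar>Im \<zeta>\<bar> \<le> Y" "\<nu> \<le> cmod \<zeta>" for \<zeta>
      proof -
        obtain g where g: "g \<le> Q" "cmod (\<zeta> - grid \<eta> Y Q g) \<le> 2 * Y / Q"
          using grid_close[OF \<open>0 < Y\<close> Q(1) \<zeta>'(1,2)] .
        let ?\<zeta> = "grid \<eta> Y Q g"
        have "cmod \<zeta> - cmod ?\<zeta> \<le> 2 * Y / Q" using norm_triangle_ineq2[of \<zeta> ?\<zeta>] g(2) by linarith
        \<comment> \<open>The grid spacing moves \<zeta> by at most \<nu> / 2, which explains the
          threshold \<nu> / 2 in the hypothesis on grid points.\<close>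
        then have big: "\<nu> / 2 \<le> cmod ?\<zeta>" using Q(2) \<zeta>'(3) by simp
        have Reg: "Re ?\<zeta> = \<eta>" by (simp add: grid_def)
        have ovg: "overlap ?\<zeta> m x l \<le> ennreal (\<tau> ^ 4)" if "R \<le> l" "x + l \<le> N" for x l
          by (rule ov[OF g(1) big that])
        have "cmod (green (\<lambda>k. ?\<zeta> * site_weight m k) n i j) \<le> 2 * \<tau> / (\<eta> * dl) ^ 6"
        proof (cases "i + (2 * R + 3) \<le> j")
          case True
          show ?thesis
            using green_overlap_bound[OF _ _ \<tau> R ovg i j True] \<eta> \<epsilon> unfolding Reg by simp
        next
          case False
          then have ji: "j + (2 * R + 3) \<le> i" using far by (simp add: far_def)
          show ?thesis
            using green_overlap_bound[OF _ _ \<tau> R ovg j i ji] \<eta> \<epsilon> norm_green_commute[of _ n i j] unfolding Reg by simp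
        qed
        then have "cmod (res ?\<zeta> (basis j) i) \<le> 2 * \<tau> / (\<eta> * dl) ^ 6 * du"
          unfolding norm_res_basis[OF i j] using d_bounds[of j] d_pos[of j] \<tau> \<eta> dl
          by (intro mult_mono) auto
        moreover have "cmod (\<zeta> - ?\<zeta>) * (sqrt (du / dl) / \<eta>\<^sup>2) \<le> 2 * Y / Q * (sqrt (du / dl) / \<eta>\<^sup>2)"
          using g(2) du dl by (intro mult_right_mono) auto
        ultimately show ?thesis
          using res_basis_lipschitz[OF i j \<zeta>'(1) Reg \<eta>(1)] by (simp add: mult_ac)
      qed
      have "cmod (res \<zeta> (basis j) i) \<le> ?\<xi>"
      proof (cases "Re \<zeta> = \<eta>")
        case True
        then show ?thesis using * vert large by simp
      next
        case False
        \<comment> \<open>The grid lies on the right edge only; the left edge is reached by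
          reflection.\<close>
        then have "Re (- \<zeta>) = \<eta>" using vert(1) \<eta> by (auto simp: abs_if split: if_splits)
        then show ?thesis using *[of "- \<zeta>"] vert large norm_res_basis_uminus[OF i j, of \<zeta>] by simp
      qed
      from prod[OF h3 this] show ?thesis using nn by linarith
    qed
  qed
qed

lemma far_transport_sum:
  assumes \<epsilon>: "0 < \<epsilon>" "\<epsilon> \<le> 1" and s: "0 \<le> s"
    and B: "\<And>i j. i \<in> {1..n} \<Longrightarrow> j \<in> {1..n} \<Longrightarrow> far R i j \<Longrightarrow>
      cmod (flow (of_real s) ((high \<epsilon> ^^ k) (basis j)) i) \<le> B"
  shows "(\<Sum>j=1..n. \<Sum>i\<in>{i \<in> {1..n}. far R i j}. transport s i j) \<le>
    2 / dl * ((real n)\<^sup>2 * du * B\<^sup>2 + (real k)\<^sup>2 * (n * (2 * \<epsilon> * du\<^sup>2 * (1 / dl + 2 * du)) + 4 * du / \<epsilon>))"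
proof -
  let ?E = "\<lambda>j. nrm2 (\<lambda>i. \<epsilon> * res \<epsilon> (basis j) i)"
  have "(\<Sum>j=1..n. \<Sum>i\<in>{i \<in> {1..n}. far R i j}. transport s i j) \<le>
      (\<Sum>j=1..n. 2 / dl * (n * du * B\<^sup>2 + (real k)\<^sup>2 * ?E j))"
    by (intro sum_mono far_transport_le[OF \<epsilon>(1) s]) (auto intro: B)
  also have "\<dots> = 2 / dl * ((real n)\<^sup>2 * du * B\<^sup>2 + (real k)\<^sup>2 * (\<Sum>j=1..n. ?E j))"
    unfolding sum_distrib_left[symmetric] sum.distrib by (simp add: power2_eq_square)
  also have "\<dots> \<le> 2 / dl * ((real n)\<^sup>2 * du * B\<^sup>2 + (real k)\<^sup>2 * (n * (2 * \<epsilon> * du\<^sup>2 * (1 / dl + 2 * du)) + 4 * du / \<epsilon>))"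
    using sum_low_norm[OF \<epsilon>] dl by (intro mult_left_mono add_left_mono) auto
  finally show ?thesis .
qed

end

section \<open>Choice of parameters\<close>

text \<open>Parameters: resolvent regularization \<open>eta\<close>, width \<open>eps\<close> of the spectral filter, cut-off \<open>nu\<close>
  below which the filter suffices, number of grid points on the contour, smallness threshold \<open>tau\<close>,
  filter order and distance scale.\<close>

definition filter_order :: "nat \<Rightarrow> nat" where "filter_order A = 16 * (A + 3)"
definition eta :: "nat \<Rightarrow> nat \<Rightarrow> real" where "eta A N = 1 / real N ^ A"
definition eps :: "nat \<Rightarrow> real" where "eps N = real N powr (- (1 / 16))"
definition nu :: "nat \<Rightarrow> real" where "nu N = real N powr (- (1 / 8))"
definition grid_size :: "nat \<Rightarrow> nat \<Rightarrow> nat" where "grid_size A N = N ^ (2 * A + filter_order A + 4)"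
definition tau :: "nat \<Rightarrow> nat \<Rightarrow> real" where "tau A N = 1 / real N ^ (6 * A + filter_order A + 3)"
definition reach :: "nat \<Rightarrow> nat" where "reach N = nat \<lfloor>real N powr (3 / 4)\<rfloor>"

lemma poly_times_exp_le_1:
  fixes c :: real
  assumes c: "0 < c"
  shows "\<forall>\<^sub>F N in sequentially. real N ^ p * exp (- (c * real N powr (1 / 4))) \<le> 1"
proof -
  have "filterlim (\<lambda>N. real N powr (1 / 4)) at_top sequentially" by real_asymp
  then have "filterlim (\<lambda>N. c * real N powr (1 / 4)) at_top sequentially"
    by (intro filterlim_tendsto_pos_mult_at_top[OF tendsto_const c])
  from filterlim_compose[OF tendsto_power_div_exp_0[of "4 * p"] this]
  have "\<forall>\<^sub>F N in sequentially. (c * real N powr (1 / 4)) ^ (4 * p) / exp (c * real N powr (1 / 4)) < c ^ (4 * p)"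
    by (rule order_tendstoD(2)) (use c in simp)
  then show ?thesis
    using eventually_gt_at_top[of 0]
  proof eventually_elim
    case (elim N)
    have "(real N powr (1 / 4)) ^ (4 * p) = real N ^ p"
      using elim(2) by (simp add: powr_power powr_realpow)
    then have "(c * real N powr (1 / 4)) ^ (4 * p) = c ^ (4 * p) * real N ^ p"
      by (simp only: power_mult_distrib)
    then have "c ^ (4 * p) * real N ^ p < c ^ (4 * p) * exp (c * real N powr (1 / 4))"
      using elim(1) by (simp only: pos_divide_less_eq[OF exp_gt_zero])
    then have "real N ^ p < exp (c * real N powr (1 / 4))"
      using c by (simp only: mult_less_cancel_left_pos zero_less_power)
    then show ?case by (simp add: exp_minus divide_inverse[symmetric] pos_divide_le_eq[OF exp_gt_zero])
  qed
qed

lemma sqrt_power_le_exp: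
  assumes "0 \<le> x" "x \<le> 1"
  shows "sqrt ((1 - x) ^ q) \<le> exp (- (x * real q / 2))"
proof -
  have "(1 - x) ^ q \<le> exp (- x) ^ q"
    using exp_ge_add_one_self[of "- x"] assms by (intro power_mono) auto
  also have "\<dots> = exp (- (x * real q / 2)) ^ 2"
    by (simp add: exp_of_nat_mult[symmetric] mult.commute)
  finally have "sqrt ((1 - x) ^ q) \<le> sqrt (exp (- (x * real q / 2)) ^ 2)" by (rule real_sqrt_le_mono)
  then show ?thesis by simp
qed

lemma contraction_factor_nonneg: "0 \<le> 1 - 1 / (4500 * (real k)\<^sup>2)"
proof (cases "k = 0")
  case False
  then have "1 \<le> (real k)\<^sup>2" by (intro one_le_power) simp
  then have "1 / (4500 * (real k)\<^sup>2) \<le> 1 / 1" by (intro frac_le) auto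
  then show ?thesis by simp
qed simp

text \<open>The 24 = 6 * 4 comes from |\<zeta>| \<ge> \<open>nu\<close> / 2 in the contraction
  hypothesis. As \<open>nu\<close>^(-2) = N^(1/4), the contraction per double step is at least of
  order N^(-1/2), and about N^(3/4) / 2 double steps leave an exponent of order N^(1/4).\<close>

lemma contraction_rate:
  fixes d0 :: real
  assumes d0: "0 < d0"
  defines "K \<equiv> \<lambda>N. nat \<lceil>24 / (d0 * (nu N)\<^sup>2)\<rceil>"
  defines "c \<equiv> 1 / (4500 * (24 / d0 + 1)\<^sup>2) / 8"
  shows "\<forall>\<^sub>F N in sequentially. sqrt ((1 - 1 / (4500 * (real (K N))\<^sup>2)) ^ (reach N div 2)) \<le> exp (- (c * real N powr (1 / 4)))"
proof -
  have "\<forall>\<^sub>F N in sequentially. real N powr (1 / 4) / 8 \<le> real N powr (- (1 / 2)) * ((real N powr (3 / 4) - 2) / 2) / 2"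
    by real_asymp
  moreover have "\<forall>\<^sub>F N in sequentially. 2 \<le> real N powr (3 / 4)" by real_asymp
  ultimately show ?thesis
    using eventually_ge_at_top[of 1]
  proof eventually_elim
    case (elim N)
    let ?M = "real N powr (1 / 4)" and ?C = "24 / d0 + 1" and ?q = "reach N div 2"
    have N: "1 \<le> real N" using elim(3) by simp
    have nu2: "(nu N)\<^sup>2 = 1 / ?M"
      using N powr_power[of "real N" "- (1 / 8)" 2] by (simp add: nu_def powr_minus_divide[of _ "1 / 4"] del: powr_minus)
    have M1: "1 \<le> ?M" using N by (simp add: ge_one_powr_ge_zero)
    have pos: "0 < 24 / (d0 * (nu N)\<^sup>2)" using d0 N by (simp add: nu2)
    then have "0 < \<lceil>24 / (d0 * (nu N)\<^sup>2)\<rceil>" by simp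
    then have K1: "1 \<le> real (K N)" unfolding K_def by linarith
    have "real (K N) \<le> 24 / (d0 * (nu N)\<^sup>2) + 1" using pos unfolding K_def by linarith
    also have "\<dots> \<le> ?C * ?M" using d0 M1 by (simp add: nu2 algebra_simps)
    finally have "(real (K N))\<^sup>2 \<le> (?C * ?M)\<^sup>2" using K1 by (intro power_mono) auto
    also have "(?C * ?M)\<^sup>2 = ?C\<^sup>2 * real N powr (1 / 2)"
      using N by (simp add: power_mult_distrib powr_power)
    finally have K2: "(real (K N))\<^sup>2 \<le> ?C\<^sup>2 * real N powr (1 / 2)" .
    define x where "x = 1 / (4500 * (real (K N))\<^sup>2)"
    have Ksq: "1 \<le> (real (K N))\<^sup>2" using K1 by (simp add: one_le_power)
    have "x \<le> 1 / 1" unfolding x_def using Ksq by (intro frac_le) auto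
    then have x: "0 \<le> x" "x \<le> 1" by (auto simp: x_def)
    have xl: "1 / (4500 * ?C\<^sup>2) * real N powr (- (1 / 2)) \<le> x"
    proof -
      have "1 / (4500 * (?C\<^sup>2 * real N powr (1 / 2))) \<le> x"
        unfolding x_def using K2 Ksq K1 by (intro frac_le) auto
      then show ?thesis by (simp add: powr_minus_divide)
    qed
    have "real N powr (3 / 4) - 1 \<le> real (reach N)" unfolding reach_def using elim(2) by linarith
    moreover have "reach N \<le> 2 * ?q + 1" by simp
    then have "real (reach N) \<le> real (2 * ?q + 1)" by (simp only: of_nat_le_iff)
    ultimately have ql: "(real N powr (3 / 4) - 2) / 2 \<le> real ?q" by simp
    have "c * ?M = 1 / (4500 * ?C\<^sup>2) * (?M / 8)" by (simp add: c_def)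
    also have "\<dots> \<le> 1 / (4500 * ?C\<^sup>2) * (real N powr (- (1 / 2)) * ((real N powr (3 / 4) - 2) / 2) / 2)"
      using elim(1) by (intro mult_left_mono) auto
    also have "\<dots> = (1 / (4500 * ?C\<^sup>2) * real N powr (- (1 / 2))) * ((real N powr (3 / 4) - 2) / 2) / 2" by simp
    also have "\<dots> \<le> x * real ?q / 2"
      using xl ql x elim(2) by (intro divide_right_mono mult_mono) auto
    finally have "exp (- (x * real ?q / 2)) \<le> exp (- (c * ?M))" by simp
    then show ?case using sqrt_power_le_exp[OF x, of ?q] unfolding x_def by linarith
  qed
qed

text \<open>The left side is the union bound over grid points, block positions and block lengths.
  Dividing by the threshold \<tau>^4 must still leave the summable N^(-2); all these powers are
  absorbed by exp(- c N^(1/4)).\<close>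

lemma small_probability_rate:
  fixes d0 :: real
  assumes d0: "0 < d0"
  defines "K \<equiv> \<lambda>N. nat \<lceil>24 / (d0 * (nu N)\<^sup>2)\<rceil>"
  shows "\<forall>\<^sub>F N in sequentially. (real (grid_size A N) + 1) * (real N + 1) * (real N + 1) *
    (pi\<^sup>2 * sqrt ((1 - 1 / (4500 * (real (K N))\<^sup>2)) ^ (reach N div 2))) \<le> tau A N ^ 4 / (real N)\<^sup>2"
proof -
  define c where "c = 1 / (4500 * (24 / d0 + 1)\<^sup>2) / 8"
  have c: "0 < c" using d0 unfolding c_def by (intro divide_pos_pos mult_pos_pos zero_less_power add_pos_pos) auto
  define q where "q = 2 * A + filter_order A + 4"
  define w where "w = 6 * A + filter_order A + 3"
  have "\<forall>\<^sub>F N in sequentially. sqrt ((1 - 1 / (4500 * (real (K N))\<^sup>2)) ^ (reach N div 2)) \<le> exp (- (c * real N powr (1 / 4)))"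
    unfolding K_def c_def by (rule contraction_rate[OF d0])
  moreover have "\<forall>\<^sub>F N in sequentially. real N ^ (q + 4 * w + 5) * exp (- (c * real N powr (1 / 4))) \<le> 1"
    by (rule poly_times_exp_le_1[OF c])
  ultimately show ?thesis
    using eventually_ge_at_top[of 128]
  proof eventually_elim
    case (elim N)
    let ?e = "exp (- (c * real N powr (1 / 4)))"
    have N: "1 \<le> real N" "128 \<le> real N" using elim(3) by auto
    have Q: "real (grid_size A N) + 1 \<le> 2 * real N ^ q"
      using N one_le_power[of "real N" q] by (simp add: grid_size_def q_def)
    have pi2: "pi\<^sup>2 \<le> 16" using pi_less_4 pi_gt_zero power_mono[of pi 4 2] by simp
    have "(real (grid_size A N) + 1) * (real N + 1) * (real N + 1) *
        (pi\<^sup>2 * sqrt ((1 - 1 / (4500 * (real (K N))\<^sup>2)) ^ (reach N div 2))) \<le>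
      (2 * real N ^ q) * (2 * real N) * (2 * real N) * (16 * ?e)"
      using Q N pi2 elim(1)
      by (intro mult_mono mult_nonneg_nonneg real_sqrt_ge_zero zero_le_power contraction_factor_nonneg) auto
    \<comment> \<open>The constant 128 = 2 * 2 * 2 * 16 is absorbed into one more power of
      N.\<close>
    also have "\<dots> = 128 * (real N ^ (q + 2) * ?e)" by (simp add: power_add power2_eq_square)
    also have "\<dots> \<le> real N * (real N ^ (q + 2) * ?e)" using N by (intro mult_right_mono) auto
    also have "\<dots> = (real N ^ (q + 4 * w + 5) * ?e) / (real N ^ (4 * w) * (real N)\<^sup>2)"
    proof -
      have "q + 4 * w + 5 = (q + 3) + (4 * w + 2)" by simp
      then have "real N ^ (q + 4 * w + 5) = real N ^ (q + 3) * (real N ^ (4 * w) * (real N)\<^sup>2)"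
        by (simp only: power_add)
      moreover have "real N * real N ^ (q + 2) = real N ^ (q + 3)" by (simp add: eval_nat_numeral)
      ultimately show ?thesis using N by (simp add: mult.assoc[symmetric])
    qed
    also have "\<dots> \<le> 1 / (real N ^ (4 * w) * (real N)\<^sup>2)"
      using elim(2) by (intro divide_right_mono) auto
    also have "\<dots> = tau A N ^ 4 / (real N)\<^sup>2"
      unfolding tau_def w_def[symmetric] by (simp add: power_divide power_mult[symmetric] mult.commute)
    finally show ?case .
  qed
qed

section \<open>Almost sure smallness of all overlaps\<close>

definition small_overlaps :: "(nat \<Rightarrow> real) \<Rightarrow> real \<Rightarrow> nat \<Rightarrow> nat \<Rightarrow> bool" where
  "small_overlaps m Y A N \<longleftrightarrow> (\<forall>g x l. g \<le> grid_size A N \<longrightarrow> nu N / 2 \<le> cmod (grid (eta A N) Y (grid_size A N) g) \<longrightarrow>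
     reach N \<le> l \<longrightarrow> x + l \<le> N \<longrightarrow> overlap (grid (eta A N) Y (grid_size A N) g) m x l \<le> ennreal (tau A N ^ 4))"

context iid_mass_chain
begin

text \<open>One Markov inequality for the sum \<open>Z\<close> of all relevant overlaps treats all
  blocks and grid points at once, since each of them is dominated by the sum. The resulting
  probabilities are summable.\<close>

lemma AE_small_overlaps: "AE \<omega> in M. \<forall>\<^sub>F N in sequentially. small_overlaps (\<lambda>y. X y \<omega>) Y A N"
proof -
  define \<zeta> where "\<zeta> N g = grid (eta A N) Y (grid_size A N) g" for N g
  define K where "K N = nat \<lceil>24 / (d0 * (nu N)\<^sup>2)\<rceil>" for N
  define S where "S N = pi\<^sup>2 * sqrt ((1 - 1 / (4500 * (real (K N))\<^sup>2)) ^ (reach N div 2))" for N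
  define T where "T N g x l \<omega> = (if nu N / 2 \<le> cmod (\<zeta> N g) \<and> reach N \<le> l then overlap (\<zeta> N g) (\<lambda>y. X y \<omega>) x l else 0)" for N g x l \<omega>
  define Z where "Z N \<omega> = (\<Sum>g\<le>grid_size A N. \<Sum>x\<le>N. \<Sum>l\<le>N. T N g x l \<omega>)" for N \<omega>
  have Tm [measurable]: "T N g x l \<in> borel_measurable M" for N g x l
    unfolding T_def[abs_def] using measurable_overlap by (cases "nu N / 2 \<le> cmod (\<zeta> N g) \<and> reach N \<le> l") auto
  have Zm [measurable]: "Z N \<in> borel_measurable M" for N
    unfolding Z_def[abs_def] by measurable
  have T_le: "(\<integral>\<^sup>+\<omega>. T N g x l \<omega> \<partial>M) \<le> ennreal (S N)" if N: "1 \<le> N" for N g x l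
  proof (cases "nu N / 2 \<le> cmod (\<zeta> N g) \<and> reach N \<le> l")
    case True
    have nu: "0 < nu N" using N by (simp add: nu_def)
    \<comment> \<open>The points retained satisfy |\<zeta>| \<ge> \<open>nu\<close> / 2, and
      squaring the 1/2 turns 24 into the required 6.\<close>
    have k: "6 \<le> real (K N) * d0 * (cmod (\<zeta> N g))\<^sup>2"
    proof -
      have "24 / (d0 * (nu N)\<^sup>2) \<le> real (K N)" unfolding K_def by linarith
      then have "24 \<le> real (K N) * d0 * (nu N)\<^sup>2" using d0 nu by (simp add: pos_divide_le_eq mult.assoc)
      moreover have "real (K N) * d0 * (nu N / 2)\<^sup>2 \<le> real (K N) * d0 * (cmod (\<zeta> N g))\<^sup>2"
        using True d0 nu by (intro mult_left_mono power_mono) auto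
      ultimately show ?thesis by (simp add: power_divide)
    qed
    have nz: "\<zeta> N g \<noteq> 0" using True nu by auto
    have "(\<integral>\<^sup>+\<omega>. T N g x l \<omega> \<partial>M) \<le> ennreal (pi\<^sup>2 * sqrt ((1 - 1 / (4500 * (real (K N))\<^sup>2)) ^ (l div 2)))"
      using expected_overlap[OF nz k, of x l] True by (simp add: T_def)
    also have "\<dots> \<le> ennreal (S N)"
    proof -
      have "(1 - 1 / (4500 * (real (K N))\<^sup>2)) ^ (l div 2) \<le> (1 - 1 / (4500 * (real (K N))\<^sup>2)) ^ (reach N div 2)"
        using True contraction_factor_nonneg[of "K N"] by (intro power_decreasing div_le_mono) auto
      then show ?thesis unfolding S_def by (intro ennreal_leI mult_left_mono real_sqrt_le_mono) auto
    qed
    finally show ?thesis .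
  next
    case False
    have "T N g x l = (\<lambda>\<omega>. 0)" unfolding T_def using False by (simp only: if_False)
    then show ?thesis by simp
  qed
  have S0: "0 \<le> S N" for N
    unfolding S_def by (intro mult_nonneg_nonneg real_sqrt_ge_zero zero_le_power contraction_factor_nonneg) auto
  have Z_le: "(\<integral>\<^sup>+\<omega>. Z N \<omega> \<partial>M) \<le> ennreal ((real (grid_size A N) + 1) * (real N + 1) * (real N + 1) * S N)" if N: "1 \<le> N" for N
  proof -
    have "(\<integral>\<^sup>+\<omega>. Z N \<omega> \<partial>M) = (\<Sum>g\<le>grid_size A N. \<Sum>x\<le>N. \<Sum>l\<le>N. \<integral>\<^sup>+\<omega>. T N g x l \<omega> \<partial>M)"
      unfolding Z_def by (simp add: nn_integral_sum)
    also have "\<dots> \<le> (\<Sum>g\<le>grid_size A N. \<Sum>x\<le>N. \<Sum>l\<le>N. ennreal (S N))"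
      by (intro sum_mono T_le N)
    also have "\<dots> = ennreal (\<Sum>g\<le>grid_size A N. \<Sum>x\<le>N. \<Sum>l\<le>N. S N)"
      using S0[of N] by (simp add: sum_ennreal sum_nonneg del: sum_constant)
    also have "(\<Sum>g\<le>grid_size A N. \<Sum>x\<le>N. \<Sum>l\<le>N. S N) = (real (grid_size A N) + 1) * (real N + 1) * (real N + 1) * S N"
      by (simp add: algebra_simps)
    finally show ?thesis .
  qed
  define E where "E N = {\<omega> \<in> space M. 1 \<le> ennreal (1 / tau A N ^ 4) * Z N \<omega>}" for N
  have Em: "E N \<in> sets M" for N unfolding E_def by measurable
  have rate: "\<forall>\<^sub>F N in sequentially. measure M (E N) \<le> 1 / (real N)\<^sup>2"
    using small_probability_rate[OF d0, of A] eventually_ge_at_top[of 1]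
  proof eventually_elim
    case (elim N)
    have t: "0 < tau A N ^ 4" using elim(2) by (simp add: tau_def)
    have "emeasure M (E N) \<le> ennreal (1 / tau A N ^ 4) * (\<integral>\<^sup>+\<omega>. Z N \<omega> * indicator (space M) \<omega> \<partial>M)"
      unfolding E_def by (intro nn_integral_Markov_inequality) auto
    also have "(\<integral>\<^sup>+\<omega>. Z N \<omega> * indicator (space M) \<omega> \<partial>M) = (\<integral>\<^sup>+\<omega>. Z N \<omega> \<partial>M)"
      by (intro nn_integral_cong) simp
    also have "ennreal (1 / tau A N ^ 4) * (\<integral>\<^sup>+\<omega>. Z N \<omega> \<partial>M) \<le> ennreal (1 / tau A N ^ 4) * ennreal (tau A N ^ 4 / (real N)\<^sup>2)"
      using Z_le[OF elim(2)] elim(1) unfolding S_def K_def by (intro mult_left_mono order_trans[OF Z_le[OF elim(2)]] ennreal_leI) (auto simp: S_def K_def)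
    also have "\<dots> = ennreal (1 / (real N)\<^sup>2)"
      using t by (subst ennreal_mult[symmetric]) auto
    finally show ?case by (simp add: P.emeasure_eq_measure)
  qed
  have "summable (\<lambda>N. measure M (E N))"
  proof (rule summable_comparison_test_ev)
    show "\<forall>\<^sub>F N in sequentially. norm (measure M (E N)) \<le> 1 / (real N)\<^sup>2" using rate by simp
    show "summable (\<lambda>N. 1 / (real N)\<^sup>2)"
      using inverse_power_summable[of 2, where 'a = real] by (simp add: divide_inverse)
  qed
  then have "AE \<omega> in M. \<forall>\<^sub>F N in sequentially. \<omega> \<in> space M - E N"
    by (intro borel_cantelli_AE1 Em) (auto simp: P.emeasure_eq_measure)
  then show ?thesis
  proof eventually_elim
    case (elim \<omega>)
    from elim eventually_ge_at_top[of 1] show ?case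
    proof eventually_elim
      case (elim N)
      have t: "0 < tau A N ^ 4" using elim(2) by (simp add: tau_def)
      have "\<not> 1 \<le> ennreal (1 / tau A N ^ 4) * Z N \<omega>" using elim(1) by (auto simp: E_def)
      then have lt: "ennreal (1 / tau A N ^ 4) * Z N \<omega> \<le> 1" by simp
      have "ennreal (tau A N ^ 4) * (ennreal (1 / tau A N ^ 4) * Z N \<omega>) = Z N \<omega>"
        using t by (simp add: mult.assoc[symmetric] ennreal_mult[symmetric])
      moreover have "ennreal (tau A N ^ 4) * (ennreal (1 / tau A N ^ 4) * Z N \<omega>) \<le> ennreal (tau A N ^ 4) * 1"
        using lt by (intro mult_left_mono) auto
      ultimately have Zt: "Z N \<omega> \<le> ennreal (tau A N ^ 4)" by simp
      show ?case
        unfolding small_overlaps_def \<zeta>_def[symmetric]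
      proof (intro allI impI)
        fix g x l
        assume h: "g \<le> grid_size A N" "nu N / 2 \<le> cmod (\<zeta> N g)" "reach N \<le> l" "x + l \<le> N"
        have "overlap (\<zeta> N g) (\<lambda>y. X y \<omega>) x l = T N g x l \<omega>" using h by (simp add: T_def)
        also have "\<dots> \<le> (\<Sum>l\<le>N. T N g x l \<omega>)" using h by (intro member_le_sum) auto
        also have "\<dots> \<le> (\<Sum>x\<le>N. \<Sum>l\<le>N. T N g x l \<omega>)"
          using h by (intro member_le_sum[of x _ "\<lambda>x. \<Sum>l\<le>N. T N g x l \<omega>"]) auto
        also have "\<dots> \<le> Z N \<omega>"
          unfolding Z_def using h by (intro member_le_sum[of g _ "\<lambda>g. \<Sum>x\<le>N. \<Sum>l\<le>N. T N g x l \<omega>"]) auto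
        finally show "overlap (\<zeta> N g) (\<lambda>y. X y \<omega>) x l \<le> ennreal (tau A N ^ 4)" using Zt by order
      qed
    qed
  qed
qed

end

text \<open>A continuous density with compact support is bounded, which gives the non-concentration
  \<open>d0\<close>; its support gives almost sure bounds on all masses simultaneously.\<close>

lemma iid_masses_law:
  assumes "prob_space M" "iid_masses M m"
  obtains d0 a b where "iid_mass_chain (distr M borel (m 1)) d0 M m" "0 < a" "AE \<omega> in M. \<forall>x\<ge>1. a \<le> m x \<omega> \<and> m x \<omega> \<le> b"
proof -
  interpret P: prob_space M by fact
  obtain g a b where g: "smooth g" "\<And>u. 0 \<le> g u" "0 < a" "\<And>u. u \<notin> {a..b} \<Longrightarrow> g u = 0"
    and dist: "\<And>x. 1 \<le> x \<Longrightarrow> distributed M lborel (m x) (\<lambda>u. ennreal (g u))"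
    and indep: "P.indep_vars (\<lambda>_. borel) m {1..}"
    using assms(2) unfolding iid_masses_def by blast
  have "g differentiable_on UNIV" using g(1) unfolding smooth_def by (auto dest: spec[of _ 0])
  then have cont: "continuous_on UNIV g" by (rule differentiable_imp_continuous_on)
  then have gm [measurable]: "g \<in> borel_measurable borel" by (rule borel_measurable_continuous_onI)
  have "compact (g ` {a..b})" by (intro compact_continuous_image continuous_on_subset[OF cont]) auto
  then obtain G0 where "\<forall>y\<in>g ` {a..b}. norm y \<le> G0"
    using compact_imp_bounded[of "g ` {a..b}"] unfolding bounded_iff by blast
  then have G0: "\<bar>g u\<bar> \<le> G0" if "u \<in> {a..b}" for u using that by auto
  define G where "G = max G0 0 + 1"
  have G: "g u \<le> G" for u using G0[of u] g(4)[of u] by (cases "u \<in> {a..b}") (auto simp: G_def)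
  have G1: "1 \<le> G" by (simp add: G_def)
  let ?\<mu> = "distr M borel (m 1)"
  have law: "distr M borel (m x) = density lborel (\<lambda>u. ennreal (g u))" if "1 \<le> x" for x
  proof -
    have "distr M borel (m x) = distr M lborel (m x)" by (intro distr_cong) auto
    then show ?thesis using distributed_distr_eq_density[OF dist[OF that]] by simp
  qed
  have rv: "m x \<in> borel_measurable M" if "1 \<le> x" for x
    using distributed_measurable[OF dist[OF that]] by simp
  \<comment> \<open>An interval of length 2 d0 = 1 / (2 G) has probability at most 1/2 under a
    density bounded by G.\<close>
  define d0 where "d0 = 1 / (4 * G)"
  have d0: "0 < d0" using G1 by (simp add: d0_def)
  interpret mu: prob_space ?\<mu> by (rule P.prob_space_distr[OF rv]) simp
  have spread: "measure ?\<mu> {x - d0<..<x + d0} \<le> 1 / 2" for x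
  proof -
    have "emeasure ?\<mu> {x - d0<..<x + d0} = (\<integral>\<^sup>+u. ennreal (g u) * indicator {x - d0<..<x + d0} u \<partial>lborel)"
      unfolding law[OF order_refl] by (intro emeasure_density) auto
    also have "\<dots> \<le> (\<integral>\<^sup>+u. ennreal G * indicator {x - d0<..<x + d0} u \<partial>lborel)"
      using G by (intro nn_integral_mono mult_right_mono ennreal_leI) auto
    also have "\<dots> = ennreal G * ennreal (2 * d0)"
      using d0 by (subst nn_integral_cmult_indicator) auto
    also have "\<dots> = ennreal (1 / 2)"
      using G1 by (subst ennreal_mult[symmetric]) (auto simp: d0_def)
    finally show ?thesis unfolding mu.emeasure_eq_measure by (subst (asm) ennreal_le_iff) auto
  qed
  have chain: "iid_mass_chain ?\<mu> d0 M m"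
  proof (intro iid_mass_chain.intro mass_law.intro mass_law_axioms.intro iid_mass_chain_axioms.intro)
    show "prob_space ?\<mu>" by (rule mu.prob_space_axioms)
    show "prob_space M" by fact
    show "P.indep_vars (\<lambda>_. borel) m {1..}" by (rule indep)
    show "distr M borel (m x) = ?\<mu>" if "1 \<le> x" for x using law[OF that] law[OF order_refl] by simp
  qed (use d0 spread in auto)
  have "AE \<omega> in M. a \<le> m x \<omega> \<and> m x \<omega> \<le> b" if x: "1 \<le> x" for x
  proof -
    have "AE u in density lborel (\<lambda>u. ennreal (g u)). a \<le> u \<and> u \<le> b"
    proof (subst AE_density)
      have "a \<le> u \<and> u \<le> b" if "0 < g u" for u
        using g(4)[of u] that by (cases "u \<in> {a..b}") auto
      then show "AE u in lborel. 0 < ennreal (g u) \<longrightarrow> a \<le> u \<and> u \<le> b" by auto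
    qed auto
    then have "AE u in distr M borel (m x). a \<le> u \<and> u \<le> b" unfolding law[OF x] .
    then show ?thesis by (rule AE_distrD[OF rv[OF x]])
  qed
  then have "AE \<omega> in M. \<forall>x. 1 \<le> x \<longrightarrow> a \<le> m x \<omega> \<and> m x \<omega> \<le> b"
    unfolding AE_all_countable by auto
  then show thesis using that[OF chain g(3)] by blast
qed

text \<open>The filter order is 16 (A + 3) because \<open>eps\<close> = N^(-1/16): A powers of N
  compensate 1 / \<open>eta\<close> and three remain as gain.\<close>

lemma eps_power_filter_order:
  assumes "1 \<le> N"
  shows "eps N ^ filter_order A = 1 / real N ^ (A + 3)" "nu N = (eps N)\<^sup>2"
proof -
  have "eps N ^ filter_order A = real N powr - real (A + 3)"
  proof -
    have "- (1 / 16) * real (filter_order A) = - real (A + 3)" unfolding filter_order_def by simp (simp add: field_simps)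
    then show ?thesis using assms powr_power[of "real N" "- (1 / 16)" "filter_order A"] unfolding eps_def by simp
  qed
  then show "eps N ^ filter_order A = 1 / real N ^ (A + 3)"
    using assms by (simp only: powr_minus_divide powr_realpow of_nat_0_less_iff)
  show "nu N = (eps N)\<^sup>2"
    using assms powr_power[of "real N" "- (1 / 16)" 2] unfolding eps_def nu_def by simp
qed

text \<open>Two to the power \<open>reach\<close> is superpolynomial; N^3 is what the other error
  terms reach.\<close>

lemma localized_rate: "\<forall>\<^sub>F N in sequentially. 1 / 2 ^ (2 * reach N + 2) \<le> 1 / real N ^ 3"
proof -
  have "0 < ln (2::real)" by simp
  from poly_times_exp_le_1[OF this, of 3]
  have "\<forall>\<^sub>F N in sequentially. real N ^ 3 * exp (- (ln 2 * real N powr (1 / 4))) \<le> 1" .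
  moreover have "\<forall>\<^sub>F N in sequentially. real N powr (1 / 4) \<le> 2 * real N powr (3 / 4)" by real_asymp
  ultimately show ?thesis using eventually_gt_at_top[of 0]
  proof eventually_elim
    case (elim N)
    have "real N powr (3 / 4) \<le> real (reach N) + 1" unfolding reach_def by linarith
    with elim(2) have le: "real N powr (1 / 4) \<le> real (2 * reach N + 2)" by simp
    have "real N ^ 3 \<le> exp (ln 2 * real N powr (1 / 4))"
      using elim(1) by (simp add: exp_minus divide_inverse[symmetric] pos_divide_le_eq)
    also have "\<dots> \<le> exp (ln 2 * real (2 * reach N + 2))"
      using le by (simp only: exp_le_cancel_iff mult_le_cancel_left_pos ln_gt_zero one_less_numeral_iff semiring_norm)
    also have "\<dots> = 2 ^ (2 * reach N + 2)"
      by (subst mult.commute, subst exp_of_nat_mult) simp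
    finally show ?case using elim(3) by (intro divide_left_mono) auto
  qed
qed

text \<open>All three terms are brought to order N^(-3). In \<open>tau\<close> the 6 A cancels
  \<open>eta\<close>^(-6), in \<open>grid_size\<close> the 2 A cancels \<open>eta\<close>^(-2), and
  in both the filter order cancels the growth of the filter away from 0, for which N^k is a generous
  bound.\<close>

lemma far_bound_rate:
  fixes dl du Y :: real
  assumes dl: "0 < dl" and du: "0 \<le> du" and Y: "0 \<le> Y"
  obtains C where "0 \<le> C" "\<forall>\<^sub>F N in sequentially.
    (2 ^ filter_order A * (du / 2 ^ (2 * reach N + 2)) +
      (2 * nu N / eps N) ^ filter_order A * (sqrt (du / dl) / eta A N) +
      (2 * (Y + 1) / eps N) ^ filter_order A * (2 * du * tau A N / (eta A N * dl) ^ 6 +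
        2 * Y / grid_size A N * (sqrt (du / dl) / (eta A N)\<^sup>2))) * (eta A N + Y) \<le> C / real N ^ 3"
proof -
  define k where "k = filter_order A"
  define r where "r = sqrt (du / dl)"
  define C1 where "C1 = 2 ^ k * du"
  define C2 where "C2 = 2 ^ k * r"
  define C3 where "C3 = (2 * (Y + 1)) ^ k * (2 * du / dl ^ 6 + 2 * Y * r)"
  have r: "0 \<le> r" using du dl by (simp add: r_def)
  have C0: "0 \<le> C1" "0 \<le> C2" "0 \<le> C3"
    using du dl Y r unfolding C1_def C2_def C3_def by (auto intro!: mult_nonneg_nonneg add_nonneg_nonneg)
  have "\<forall>\<^sub>F N in sequentially.
    (2 ^ k * (du / 2 ^ (2 * reach N + 2)) + (2 * nu N / eps N) ^ k * (r / eta A N) +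
      (2 * (Y + 1) / eps N) ^ k * (2 * du * tau A N / (eta A N * dl) ^ 6 +
        2 * Y / grid_size A N * (r / (eta A N)\<^sup>2))) * (eta A N + Y) \<le> (C1 + C2 + C3) * (1 + Y) / real N ^ 3"
    using localized_rate eventually_ge_at_top[of 1]
  proof eventually_elim
    case (elim N)
    let ?N = "real N" and ?e = "eps N"
    have N: "1 \<le> ?N" using elim(2) by simp
    have e: "0 < ?e" using N by (simp add: eps_def)
    have ek: "?e ^ k = 1 / ?N ^ (A + 3)" and nu: "nu N = ?e\<^sup>2"
      using eps_power_filter_order[OF elim(2)] by (auto simp: k_def)
    have T1: "2 ^ k * (du / 2 ^ (2 * reach N + 2)) \<le> C1 / ?N ^ 3"
      using mult_left_mono[OF elim(1) C0(1)] by (simp add: C1_def)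
    have "(2 * nu N / ?e) ^ k = 2 ^ k / ?N ^ (A + 3)"
      using e by (simp add: nu power2_eq_square power_mult_distrib ek)
    then have T2: "(2 * nu N / ?e) ^ k * (r / eta A N) = C2 / ?N ^ 3"
      using N by (simp add: eta_def C2_def power_add)
    have T3: "(2 * (Y + 1) / ?e) ^ k * (2 * du * tau A N / (eta A N * dl) ^ 6 + 2 * Y / grid_size A N * (r / (eta A N)\<^sup>2)) \<le> C3 / ?N ^ 3"
    proof -
      have "(2 * (Y + 1) / ?e) ^ k = (2 * (Y + 1)) ^ k * ?N ^ (A + 3)"
        by (simp add: power_divide ek)
      also have "\<dots> \<le> (2 * (Y + 1)) ^ k * ?N ^ k"
        using N Y by (intro mult_left_mono power_increasing) (auto simp: k_def filter_order_def)
      finally have a: "(2 * (Y + 1) / ?e) ^ k \<le> (2 * (Y + 1)) ^ k * ?N ^ k" .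
      have "2 * du * tau A N / (eta A N * dl) ^ 6 = 2 * du / dl ^ 6 * (1 / ?N ^ (k + 3))"
      proof -
        have "tau A N = 1 / (?N ^ A) ^ 6 * (1 / ?N ^ (k + 3))"
          by (simp add: tau_def k_def power_mult[symmetric] power_add mult.commute)
        then show ?thesis using N dl by (simp add: eta_def power_mult_distrib power_divide)
      qed
      moreover have "2 * Y / grid_size A N * (r / (eta A N)\<^sup>2) = 2 * Y * r * (1 / ?N ^ (k + 4))"
      proof -
        have "real (grid_size A N) = (?N ^ A)\<^sup>2 * ?N ^ (k + 4)"
          by (simp add: grid_size_def k_def power_mult[symmetric] power_add mult.commute)
        then show ?thesis using N by (simp add: eta_def power_divide)
      qed
      moreover have "2 * Y * r * (1 / ?N ^ (k + 4)) \<le> 2 * Y * r * (1 / ?N ^ (k + 3))"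
        using N Y r by (intro mult_left_mono divide_left_mono power_increasing) auto
      ultimately have b: "2 * du * tau A N / (eta A N * dl) ^ 6 + 2 * Y / grid_size A N * (r / (eta A N)\<^sup>2) \<le>
          (2 * du / dl ^ 6 + 2 * Y * r) * (1 / ?N ^ (k + 3))"
        by (simp only: distrib_right)
      have "(2 * (Y + 1) / ?e) ^ k * (2 * du * tau A N / (eta A N * dl) ^ 6 + 2 * Y / grid_size A N * (r / (eta A N)\<^sup>2)) \<le>
          ((2 * (Y + 1)) ^ k * ?N ^ k) * ((2 * du / dl ^ 6 + 2 * Y * r) * (1 / ?N ^ (k + 3)))"
        using a b Y du dl r e N
        by (intro mult_mono add_nonneg_nonneg mult_nonneg_nonneg divide_nonneg_nonneg) (auto simp: tau_def eta_def)
      also have "\<dots> = C3 / ?N ^ 3"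
        using N by (simp add: C3_def power_add)
      finally show ?thesis .
    qed
    have "eta A N \<le> 1" using N by (simp add: eta_def one_le_power)
    then have "(2 ^ k * (du / 2 ^ (2 * reach N + 2)) + (2 * nu N / ?e) ^ k * (r / eta A N) +
      (2 * (Y + 1) / ?e) ^ k * (2 * du * tau A N / (eta A N * dl) ^ 6 +
        2 * Y / grid_size A N * (r / (eta A N)\<^sup>2))) * (eta A N + Y) \<le>
      (C1 / ?N ^ 3 + C2 / ?N ^ 3 + C3 / ?N ^ 3) * (1 + Y)"
      using T1 T2 T3 Y N C0 by (intro mult_mono add_mono add_nonneg_nonneg divide_nonneg_nonneg) (auto simp: eta_def)
    also have "\<dots> = (C1 + C2 + C3) * (1 + Y) / ?N ^ 3"
      by (simp only: add_divide_distrib[symmetric] times_divide_eq_left)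
    finally show ?case .
  qed
  moreover have "0 \<le> (C1 + C2 + C3) * (1 + Y)" using C0 Y by auto
  ultimately show thesis using that unfolding k_def r_def by blast
qed

lemma parameters_admissible:
  assumes A: "1 \<le> A" and Y: "0 < Y"
  shows "\<forall>\<^sub>F N in sequentially. 2 \<le> N \<and> 1 \<le> reach N \<and> 2 * eta A N \<le> eps N \<and> 4 * Y / real (grid_size A N) \<le> nu N"
proof -
  have "\<forall>\<^sub>F N in sequentially. 1 \<le> real N powr (3 / 4)" by real_asymp
  moreover have "\<forall>\<^sub>F N in sequentially. 2 * (1 / real N) \<le> real N powr (- (1 / 16))" by real_asymp
  moreover have "\<forall>\<^sub>F N in sequentially. 4 * Y / real N \<le> real N powr (- (1 / 8))" using Y by real_asymp
  ultimately show ?thesis using eventually_ge_at_top[of 2]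
  proof eventually_elim
    case (elim N)
    have N: "1 \<le> real N" using elim(4) by simp
    have "real N ^ 1 \<le> real N ^ A" using A N by (intro power_increasing) auto
    then have "1 / real N ^ A \<le> 1 / real N" using N by (intro divide_left_mono) auto
    then have 1: "2 * eta A N \<le> eps N" using elim(2) unfolding eta_def eps_def by linarith
    have "real N ^ 1 \<le> real N ^ (2 * A + filter_order A + 4)" using N by (intro power_increasing) auto
    then have "4 * Y / real (grid_size A N) \<le> 4 * Y / real N"
      using N Y unfolding grid_size_def by (intro divide_left_mono) auto
    then have 2: "4 * Y / real (grid_size A N) \<le> nu N" using elim(3) unfolding nu_def by linarith
    have "1 \<le> reach N" using elim(1) unfolding reach_def by linarith
    then show ?case using 1 2 elim(4) by auto
  qed
qed

text \<open>e is the contribution of the modulus of continuity of f, while g collects the transport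
  over far distances: the entrywise bound on the filtered flow, and the low-frequency norm of order
  \<open>eps\<close> + 1 / (\<open>eps\<close> N) per site.\<close>

lemma thermal_energy_change_le:
  fixes m :: "nat \<Rightarrow> real" and \<beta> f rr pp :: "real \<Rightarrow> real"
  assumes dl: "0 < dl" "dl \<le> 1" and du: "1 \<le> du" and m: "\<And>x. 1 \<le> x \<Longrightarrow> dl \<le> m x \<and> m x \<le> du"
    and Y: "2 \<le> Y" "3 \<le> dl * Y" and A: "1 \<le> A" "\<alpha> \<le> real A" and t: "0 \<le> t"
    and small: "\<forall>\<^sub>F N in sequentially. small_overlaps m Y A N"
    and \<beta>: "\<And>u. u \<in> {0..1} \<Longrightarrow> b \<le> \<beta> u" "0 < b" and F: "\<And>u. u \<in> {0..1} \<Longrightarrow> \<bar>f u\<bar> \<le> F"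
    and \<delta>: "0 < \<delta>" "0 \<le> e"
    and f: "\<And>u v. u \<in> {0..1} \<Longrightarrow> v \<in> {0..1} \<Longrightarrow> \<bar>u - v\<bar> < \<delta> \<Longrightarrow> \<bar>f u - f v\<bar> \<le> e"
  obtains g where "g \<longlonglongrightarrow> 0" "\<forall>\<^sub>F N in sequentially.
    \<bar>thermal_energy f \<beta> rr pp mbar N m (real N powr (\<alpha> - 1) * t) - thermal_energy f \<beta> rr pp mbar N m 0\<bar> \<le>
      1 / b * (e + g N)"
proof -
  define k where "k = filter_order A"
  obtain C where C0: "0 \<le> C" and C: "\<forall>\<^sub>F N in sequentially.
    (2 ^ k * (du / 2 ^ (2 * reach N + 2)) + (2 * nu N / eps N) ^ k * (sqrt (du / dl) / eta A N) +
      (2 * (Y + 1) / eps N) ^ k * (2 * du * tau A N / (eta A N * dl) ^ 6 +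
        2 * Y / grid_size A N * (sqrt (du / dl) / (eta A N)\<^sup>2))) * (eta A N + Y) \<le> C / real N ^ 3"
    unfolding k_def by (rule far_bound_rate[OF dl(1), of du Y A]) (use du Y in auto)
  define D where "D = exp t * C"
  define w where "w = 2 * du\<^sup>2 * (1 / dl + 2 * du)"
  define g where "g N = F * (2 / dl) * (4 * du * D\<^sup>2 * (1 / real N ^ 5) +
    (real k)\<^sup>2 * (2 * w * eps N + 4 * du * (1 / (eps N * real N))))" for N
  have "F * (2 / dl) * (4 * du * D\<^sup>2 * 0 + (real k)\<^sup>2 * (2 * w * 0 + 4 * du * 0)) = 0" by simp
  moreover have "g \<longlonglongrightarrow> F * (2 / dl) * (4 * du * D\<^sup>2 * 0 + (real k)\<^sup>2 * (2 * w * 0 + 4 * du * 0))"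
    unfolding g_def[abs_def]
  proof (intro tendsto_intros)
    show "(\<lambda>N. 1 / real N ^ 5) \<longlonglongrightarrow> 0" by real_asymp
    show "eps \<longlonglongrightarrow> 0" unfolding eps_def[abs_def] by real_asymp
    show "(\<lambda>N. 1 / (eps N * real N)) \<longlonglongrightarrow> 0" unfolding eps_def[abs_def] by real_asymp
  qed
  ultimately have g0: "g \<longlonglongrightarrow> 0" by simp
  have "(\<lambda>N. (real N powr (3 / 4) + 2) / real N) \<longlonglongrightarrow> 0" by real_asymp
  then have close: "\<forall>\<^sub>F N in sequentially. (real N powr (3 / 4) + 2) / real N < \<delta>"
    using \<delta>(1) by (rule order_tendstoD(2))
  have F0: "0 \<le> F" using F[of 0] by fastforce
  have Ypos: "0 < Y" using Y by simp
  have w0: "0 \<le> w" using dl du by (simp add: w_def)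
  have "\<forall>\<^sub>F N in sequentially.
    \<bar>thermal_energy f \<beta> rr pp mbar N m (real N powr (\<alpha> - 1) * t) - thermal_energy f \<beta> rr pp mbar N m 0\<bar> \<le>
      1 / b * (e + g N)"
    using small C close parameters_admissible[OF A(1) Ypos]
  proof eventually_elim
    case (elim N)
    let ?R = "reach N" and ?e = "eps N" and ?s = "real N powr (\<alpha> - 1) * t"
    have N: "2 \<le> real N" "1 \<le> N" using elim(4) by auto
    define n where "n = 2 * N - 1"
    interpret mass_chain m n dl du N
    proof
      show "dl \<le> site_weight m i \<and> site_weight m i \<le> du" for i
        using m[of "Suc i div 2"] dl du by (cases "odd i") (auto simp: site_weight_def elim!: oddE)
    qed (use dl du N n_def in auto)
    have s: "0 \<le> ?s" "0 \<le> real N * ?s" using t by auto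
    have eps: "0 < ?e" "?e \<le> 1"
      using N powr_mono[of "- (1 / 16)" 0 "real N"] by (auto simp: eps_def)
    \<comment> \<open>The microscopic time is t N^\<alpha> with \<alpha> \<le> A, so the exponential
      on the contour of half-width N^(-A) is at most exp t.\<close>
    have "real N * ?s * eta A N \<le> t"
    proof -
      have "real N * real N powr (\<alpha> - 1) = real N powr \<alpha>" using N by (simp add: powr_diff)
      also have "\<dots> \<le> real N powr real A" using A N by (intro powr_mono) auto
      also have "\<dots> = real N ^ A" using N by (simp add: powr_realpow)
      finally have "real N * real N powr (\<alpha> - 1) / real N ^ A \<le> 1" using N by (simp add: pos_divide_le_eq)
      from mult_right_mono[OF this t] show ?thesis by (simp add: eta_def mult_ac)
    qed
    then have es: "exp (real N * ?s * eta A N) \<le> exp t" by simp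
    have entry: "cmod (flow (of_real (real N * ?s)) ((high ?e ^^ k) (basis j)) i) \<le> D / real N ^ 3"
      if ij: "i \<in> {1..n}" "j \<in> {1..n}" "far ?R i j" for i j
    proof -
      have "cmod (flow (of_real (real N * ?s)) ((high ?e ^^ k) (basis j)) i) \<le> exp (real N * ?s * eta A N) *
        (2 ^ k * (du / 2 ^ (2 * ?R + 2)) + (2 * nu N / ?e) ^ k * (sqrt (du / dl) / eta A N) +
          (2 * (Y + 1) / ?e) ^ k * (2 * du * tau A N / (eta A N * dl) ^ 6 +
          2 * Y / grid_size A N * (sqrt (du / dl) / (eta A N)\<^sup>2))) * (eta A N + Y)"
      proof (rule far_flow_bound[OF _ _ eps(2) _ Y _ _ _ _ _ _ ij s(2)])
        show "0 < eta A N" "0 < nu N" "0 < tau A N" using N by (auto simp: eta_def nu_def tau_def)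
        have "1 < real N ^ (6 * A + filter_order A + 3)" using elim(4) by (intro one_less_power) auto
        then show "tau A N < 1" unfolding tau_def using elim(4) by (simp only: divide_less_eq_1) auto
        show "1 \<le> grid_size A N" using N by (auto simp: grid_size_def)
      qed (use elim(1,4) in \<open>auto simp: small_overlaps_def\<close>)
      also have "\<dots> \<le> exp t * (C / real N ^ 3)"
        unfolding mult.assoc[of "exp _"] using elim(2) C0 es
        by (intro order_trans[OF mult_left_mono[OF elim(2)] mult_right_mono]) auto
      finally show ?thesis by (simp add: D_def)
    qed
    have sum_le: "(\<Sum>j=1..n. \<Sum>i\<in>{i \<in> {1..n}. far ?R i j}. transport (real N * ?s) i j) \<le>
      2 / dl * ((real n)\<^sup>2 * du * (D / real N ^ 3)\<^sup>2 + (real k)\<^sup>2 * (n * (2 * ?e * du\<^sup>2 * (1 / dl + 2 * du)) + 4 * du / ?e))"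
      by (rule far_transport_sum[OF eps s(2) entry])
    have nN: "real n \<le> 2 * real N" unfolding n_def by simp
    \<comment> \<open>N^2 pairs of sites with squared entries of order N^(-6) give N^(-4), and the
      prefactor 1 / N of the energy makes it N^(-5).\<close>
    have n1: "(real n)\<^sup>2 * du * (D / real N ^ 3)\<^sup>2 \<le> real N * (4 * du * D\<^sup>2 * (1 / real N ^ 5))"
    proof -
      have "(real n)\<^sup>2 * (du * (D / real N ^ 3)\<^sup>2) \<le> (2 * real N)\<^sup>2 * (du * (D / real N ^ 3)\<^sup>2)"
        using nN du by (intro mult_right_mono power_mono) auto
      also have "\<dots> = real N * (4 * du * D\<^sup>2 * (1 / real N ^ 5))"
        using N by (simp add: power_divide power_mult_distrib eval_nat_numeral)
      finally show ?thesis by (simp only: mult.assoc)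
    qed
    have n2: "real n * (2 * ?e * du\<^sup>2 * (1 / dl + 2 * du)) + 4 * du / ?e \<le>
      real N * (2 * w * ?e + 4 * du * (1 / (?e * real N)))"
    proof -
      have "real n * (w * ?e) \<le> 2 * real N * (w * ?e)"
        using nN w0 eps by (intro mult_right_mono) auto
      moreover have "real N * (4 * du * (1 / (?e * real N))) = 4 * du / ?e" using N eps by simp
      moreover have "2 * ?e * du\<^sup>2 * (1 / dl + 2 * du) = w * ?e" by (simp add: w_def mult_ac)
      ultimately show ?thesis by (simp only: distrib_left)
    qed
    have "F / real N * (\<Sum>j=1..n. \<Sum>i\<in>{i \<in> {1..n}. far ?R i j}. transport (real N * ?s) i j) \<le>
      F / real N * (2 / dl * (real N * (4 * du * D\<^sup>2 * (1 / real N ^ 5)) + (real k)\<^sup>2 * (real N * (2 * w * ?e + 4 * du * (1 / (?e * real N))))))"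
      using F0 dl by (intro mult_left_mono order_trans[OF sum_le] add_mono n1 n2) auto
    also have "\<dots> = g N"
    proof -
      have "F / real N * (2 / dl * (real N * x + y * (real N * z))) = F * (2 / dl) * (x + y * z)" for x y z
        using elim(4) dl by (simp add: field_simps)
      then show ?thesis unfolding g_def .
    qed
    finally have gN: "F / real N * (\<Sum>j=1..n. \<Sum>i\<in>{i \<in> {1..n}. far ?R i j}. transport (real N * ?s) i j) \<le> g N" .
    have unit: "real x / real N \<in> {0..1}" if "x \<in> {1..N}" for x using that by auto
    have near: "\<bar>f (real (Suc i div 2) / real N) - f (real (Suc j div 2) / real N)\<bar> \<le> e"
      if ij: "i \<in> {1..n}" "j \<in> {1..n}" "\<not> far ?R i j" for i j
    proof (rule f)
      show "real (Suc i div 2) / real N \<in> {0..1}" "real (Suc j div 2) / real N \<in> {0..1}"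
        using ij by (auto intro!: unit simp: n_def)
      \<comment> \<open>Indices of the doubled chain that are not far differ by at most 2 R + 2, so
        the corresponding sites differ by at most R + 2, which is o(N).\<close>
      have "Suc i div 2 \<le> Suc j div 2 + (?R + 2)" "Suc j div 2 \<le> Suc i div 2 + (?R + 2)"
        using ij(3) unfolding far_def by presburger+
      then have "\<bar>real (Suc i div 2) - real (Suc j div 2)\<bar> \<le> real ?R + 2" by linarith
      also have "\<dots> \<le> real N powr (3 / 4) + 2" unfolding reach_def by simp
      finally have "\<bar>real (Suc i div 2) - real (Suc j div 2)\<bar> / real N \<le> (real N powr (3 / 4) + 2) / real N"
        using N by (intro divide_right_mono) auto
      then show "\<bar>real (Suc i div 2) / real N - real (Suc j div 2) / real N\<bar> < \<delta>"
        using elim(3) by (simp add: diff_divide_distrib[symmetric])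
    qed
    have "\<bar>thermal_energy f \<beta> rr pp mbar N m ?s - thermal_energy f \<beta> rr pp mbar N m 0\<bar> \<le>
      1 / b * (e + F / real N * (\<Sum>j=1..n. \<Sum>i\<in>{i \<in> {1..n}. far ?R i j}. transport (real N * ?s) i j))"
    proof (rule thermal_energy_difference)
      show "b \<le> \<beta> (real x / real N)" "\<bar>f (real x / real N)\<bar> \<le> F" if "x \<in> {1..N}" for x
        using \<beta>(1)[OF unit[OF that]] F[OF unit[OF that]] .
    qed (use \<beta>(2) s(1) \<delta>(2) near in auto)
    also have "\<dots> \<le> 1 / b * (e + g N)" using gN \<beta>(2) by (intro mult_left_mono) auto
    finally show ?case .
  qed
  with g0 show thesis by (rule that)
qed

theorem mainTheorem2:
  fixes M :: "'w measure" and m :: "nat \<Rightarrow> 'w \<Rightarrow> real"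
    and \<beta> rr pp f :: "real \<Rightarrow> real" and mbar \<alpha> t :: real
  assumes "prob_space M"
    and "iid_masses M m"
    and "mbar = integral\<^sup>L M (m 1)"
    and "continuous_on {0..1} \<beta>" and "\<forall>u\<in>{0..1}. 0 < \<beta> u"
    and "C1_unit_interval rr" and "rr 0 = 0" and "rr 1 = 0"
    and "C1_unit_interval pp"
    and "C1_unit_interval f"
    and "\<alpha> \<ge> 1" and "t \<ge> 0"
  shows "AE \<omega> in M.
    (\<lambda>N. thermal_energy f \<beta> rr pp mbar N (\<lambda>x. m x \<omega>) (real N powr (\<alpha> - 1) * t)
          - thermal_energy f \<beta> rr pp mbar N (\<lambda>x. m x \<omega>) 0) \<longlonglongrightarrow> 0"
proof -
  obtain d0 a b where chain: "iid_mass_chain (distr M borel (m 1)) d0 M m" and a: "0 < a"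
    and ab: "AE \<omega> in M. \<forall>x\<ge>1. a \<le> m x \<omega> \<and> m x \<omega> \<le> b"
    by (rule iid_masses_law[OF assms(1,2)])
  define dl where "dl = min a 1"
  define du where "du = max b 1"
  define Y where "Y = max 2 (3 / dl)"
  define A where "A = nat \<lceil>\<alpha>\<rceil>"
  have dl: "0 < dl" "dl \<le> 1" "1 \<le> du" using a by (auto simp: dl_def du_def)
  have Y: "2 \<le> Y" "3 \<le> dl * Y" using dl by (auto simp: Y_def max_def field_simps)
  have A: "1 \<le> A" "\<alpha> \<le> real A" using assms(11) unfolding A_def by linarith+
  have "\<exists>u\<in>{0..1}. \<forall>v\<in>{0..1}. \<beta> u \<le> \<beta> v"
    by (rule continuous_attains_inf) (use assms(4) in auto)
  then obtain b0 where b0: "0 < b0" "\<And>u. u \<in> {0..1} \<Longrightarrow> b0 \<le> \<beta> u" using assms(5) by blast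
  have fc: "continuous_on {0..1} f"
    using assms(10) unfolding C1_unit_interval_def
    by (blast intro: DERIV_continuous_on)
  have "bounded (f ` {0..1})" by (intro compact_imp_bounded compact_continuous_image fc) auto
  then obtain F where "\<forall>y\<in>f ` {0..1}. norm y \<le> F" unfolding bounded_iff by blast
  then have F: "\<bar>f u\<bar> \<le> F" if "u \<in> {0..1}" for u using that by auto
  have uc: "uniformly_continuous_on {0..1} f" by (intro compact_uniformly_continuous fc) auto
  from ab iid_mass_chain.AE_small_overlaps[OF chain, of Y A] show ?thesis
  proof eventually_elim
    case (elim \<omega>)
    let ?D = "\<lambda>N. thermal_energy f \<beta> rr pp mbar N (\<lambda>x. m x \<omega>) (real N powr (\<alpha> - 1) * t)
          - thermal_energy f \<beta> rr pp mbar N (\<lambda>x. m x \<omega>) 0"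
    have masses: "dl \<le> m x \<omega> \<and> m x \<omega> \<le> du" if "1 \<le> x" for x
      using elim(1) that unfolding dl_def du_def by (auto intro: min.coboundedI1 max.coboundedI1)
    show ?case
    proof (rule tendstoI)
      fix r :: real assume r: "0 < r"
      \<comment> \<open>One third of the admissible error r, scaled by the lower bound of \<beta>: e
        and the eventual bound g N < e together give at most 2 r / 3.\<close>
      define e where "e = r * b0 / 3"
      have e: "0 < e" using r b0 by (simp add: e_def)
      obtain \<delta> where \<delta>: "0 < \<delta>" and f: "\<And>u v. u \<in> {0..1} \<Longrightarrow> v \<in> {0..1} \<Longrightarrow> \<bar>u - v\<bar> < \<delta> \<Longrightarrow> \<bar>f u - f v\<bar> < e"
        using uc e unfolding uniformly_continuous_on_def dist_real_def by metis
      obtain g where g: "g \<longlonglongrightarrow> 0" "\<forall>\<^sub>F N in sequentially. \<bar>?D N\<bar> \<le> 1 / b0 * (e + g N)"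
        by (rule thermal_energy_change_le[OF dl masses Y A assms(12) elim(2) b0(2,1) F \<delta> less_imp_le[OF e] less_imp_le[OF f]])
      have "\<forall>\<^sub>F N in sequentially. g N < e" using g(1) e by (rule order_tendstoD(2))
      with g(2) show "\<forall>\<^sub>F N in sequentially. dist (?D N) 0 < r"
      proof eventually_elim
        case (elim N)
        have "1 / b0 * (e + g N) < 1 / b0 * (2 * e)" using elim(2) b0(1) by (intro mult_strict_left_mono) auto
        also have "\<dots> \<le> r" using b0(1) r by (simp add: e_def)
        finally show ?case using elim(1) by simp
      qed
    qed
  qed
qed

end
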